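(* Let $Q(x,y)=ax^2+bxy+cy^2$ be a real positive definite binary quadratic form, with discriminant $d=b^2-4ac$, and let $k=\sqrt{|d|}/(2a)$, $k'=\sqrt{|d|}/(2c)$. Let $\phi_1(s)=\sum_{n\ge1}a_1(n)\lambda_n^{-s}$ and $\phi_2(s)=\sum_{n\ge1}a_2(n)\lambda_n'^{-s}$ be two Dirichlet series belonging to the class $\mathcal B$ with the same parity $\delta$ (see context), with dual series $\psi_1(s)=\sum_{n\ge1}b_1(n)\mu_n^{-s}$, $\psi_2(s)=\sum_{n\ge1}b_2(n)\mu_n'^{-s}$. Let $\sigma_a=\max\{\sigma_{a_1},\sigma_{a_2}\}$, $\sigma_b=\max\{\sigma_{b_1},\sigma_{b_2}\}$ be the maxima of the abscissas of absolute convergence of $\phi_1,\phi_2$ and of $\psi_1,\psi_2$, and let $s\in\mathbb C$ with $\mathrm{Re}(s)>\max\{\sigma_a,\sigma_b\}$. Let $(\nu_j)_{j\ge1}$ be the increasing enumeration of the distinct values of $\mu_m\lambda_n'$ ($m,n\ge1$), and $(\nu_j')_{j\ge1}$ that of the values $\mu_m'\lambda_n$ ($m,n\ge1$). (i) If $a_1(n),a_2(n)$ are even ($\delta=0$), and $\rho_i$ is the residue of $\phi_i$ at $s=1$, then $$a^s\Gamma(s)\mathcal Z_2(s;Q;a_1,a_2;\lambda,\lambda')=-4\phi_2(0)\Gamma(s)\phi_1(2s)+2\sqrt\pi\,\rho_1\Gamma\left(s-\tfrac12\right)k^{1-2s}\phi_2(2s-1)+8k^{\frac12-s}\sum_{j=1}^\infty\sigma_{2s-1}(\nu_j;b_1,a_2;\mu,\lambda')\cos\left(\frac{b\nu_j}{a}\right)\nu_j^{\frac12-s}K_{s-\frac12}(2k\nu_j)$$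 and $$c^s\Gamma(s)\mathcal Z_2(s;Q;a_1,a_2;\lambda,\lambda')=-4\phi_1(0)\Gamma(s)\phi_2(2s)+2\sqrt\pi\,\rho_2\Gamma\left(s-\tfrac12\right)k'^{1-2s}\phi_1(2s-1)+8k'^{\frac12-s}\sum_{j=1}^\infty\sigma_{2s-1}(\nu_j';b_2,a_1;\mu',\lambda)\cos\left(\frac{b\nu_j'}{c}\right)\nu_j'^{\frac12-s}K_{s-\frac12}(2k'\nu_j').$$ (ii) If $a_1(n),a_2(n)$ are odd ($\delta=1$), then $$a^s\Gamma(s)\mathcal Z_2(s;Q;a_1,a_2;\lambda,\lambda')=-8k^{\frac12-s}\sum_{j=1}^\infty\sigma_{2s-1}(\nu_j;b_1,a_2;\mu,\lambda')\sin\left(\frac{b\nu_j}{a}\right)\nu_j^{\frac12-s}K_{s-\frac12}(2k\nu_j)$$ and $$c^s\Gamma(s)\mathcal Z_2(s;Q;a_1,a_2;\lambda,\lambda')=-8k'^{\frac12-s}\sum_{j=1}^\infty\sigma_{2s-1}(\nu_j';b_2,a_1;\mu',\lambda)\sin\left(\frac{b\nu_j'}{c}\right)\nu_j'^{\frac12-s}K_{s-\frac12}(2k'\nu_j').$$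
   Context: Bochner pair of parity $\delta\in\{0,1\}$: $(\lambda_n)_{n\ge1}$, $(\mu_n)_{n\ge1}$ are sequences of positive numbers strictly increasing to $\infty$; $(a(n))_{n\ge1}$, $(b(n))_{n\ge1}$ are complex sequences, not identically zero; $\phi(s)=\sum_{n\ge1}a(n)\lambda_n^{-s}$ and $\psi(s)=\sum_{n\ge1}b(n)\mu_n^{-s}$ have finite abscissas of absolute convergence $\sigma_a$, $\sigma_b$; and, with $\Delta(s)=\Gamma\left(\frac{s+\delta}{2}\right)$, there is a meromorphic function $\chi$ on $\mathbb C$ such that (1) $\chi(s)=\Delta(s)\phi(s)$ for $\mathrm{Re}(s)>\sigma_a$ and $\chi(s)=\Delta(1-s)\psi(1-s)$ for $\mathrm{Re}(s)<1-\sigma_b$; (2) $\lim_{|\mathrm{Im}(s)|\to\infty}\chi(s)=0$ uniformly in every strip $\sigma_1\le\mathrm{Re}(s)\le\sigma_2$; (3) the singularities of $\chi$ are at most poles and are confined to some compact set. Class $\mathcal B$: $\phi$ belongs to $\mathcal B$ (with parity $\delta$ and dual series $\psi$) if $(\phi,\psi)$ is a Bochner pair of parity $\delta$ and: for $\delta=0$, $\phi$ and $\psi$ continue analytically to $\mathbb C$ except for possible simple poles at $s=1$ with residues $\rho$ and $\rho^\star$ respectively (residue $0$ if no pole); for $\delta=1$, $\phi$ and $\psi$ continue to entire functions. The sequences are extended to $\mathbb Z$ by $a(0):=-2\phi(-\delta)$, $b(0):=-2\psi(-\delta)$, $a(-n)=(-1)^\delta a(n)$, $b(-n)=(-1)^\delta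 b(n)$, $\lambda_0=\mu_0=0$, $\lambda_{-n}=-\lambda_n$, $\mu_{-n}=-\mu_n$. Non-diagonal Epstein zeta function: for $\mathrm{Re}(s)>\sigma_a$, $$\mathcal Z_2(s;Q;a_1,a_2;\lambda,\lambda')=\sum_{(m,n)\in\mathbb Z^2\setminus\{(0,0)\}}\frac{a_1(m)a_2(n)}{(a\lambda_m^2+b\lambda_m\lambda_n'+c\lambda_n'^2)^s}.$$ Generalized divisor function: $\sigma_z(\nu_j;b_1,a_2;\mu,\lambda')=\sum_{(m,n)\in\mathbb N^2:\ \mu_m\lambda_n'=\nu_j}b_1(m)a_2(n)\mu_m^z$, and likewise $\sigma_z(\nu_j';b_2,a_1;\mu',\lambda)=\sum_{(m,n)\in\mathbb N^2:\ \mu_m'\lambda_n=\nu_j'}b_2(m)a_1(n)\mu_m'^z$, where $\mathbb N=\{1,2,\dots\}$. $K_\nu$ is the modified Bessel function of the second kind. *)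

theory Defs
  imports "HOL-Complex_Analysis.Complex_Analysis"
begin

(* Sequences indexed by n >= 1 are functions on nat whose value at 0 is never used;
   sums over n >= 1 are therefore written with Suc. *)

definition dirichlet_series :: "(nat \<Rightarrow> complex) \<Rightarrow> (nat \<Rightarrow> real) \<Rightarrow> complex \<Rightarrow> complex" where
  "dirichlet_series a lam s =
     (\<Sum>n. a (Suc n) * complex_of_real (lam (Suc n)) powr (- s))"

definition abs_abscissa :: "(nat \<Rightarrow> complex) \<Rightarrow> (nat \<Rightarrow> real) \<Rightarrow> ereal" where
  "abs_abscissa a lam =
     Inf {ereal (Re s) | s::complex.
       summable (\<lambda>n. norm (a (Suc n) * complex_of_real (lam (Suc n)) powr (- s)))}"

definition frequencies :: "(nat \<Rightarrow> real) \<Rightarrow> bool" where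
  "frequencies lam \<longleftrightarrow>
     (\<forall>n\<ge>1. lam n > 0) \<and> strict_mono_on {1..} lam \<and> filterlim lam at_top sequentially"

(* Gamma takes the value 0 at its poles in the library, so the two formulas for X are required
   away from the poles of the Gamma factor only. Being meromorphic_on UNIV does not constrain
   values at isolated points; holomorphy off K does. *)
definition bochner_pair ::
  "nat \<Rightarrow> (nat \<Rightarrow> complex) \<Rightarrow> (nat \<Rightarrow> real) \<Rightarrow> (nat \<Rightarrow> complex) \<Rightarrow> (nat \<Rightarrow> real) \<Rightarrow> bool" where
  "bochner_pair \<delta> a lam b mu \<longleftrightarrow>
     \<delta> \<in> {0, 1} \<and> frequencies lam \<and> frequencies mu \<and>
     (\<exists>n\<ge>1. a n \<noteq> 0) \<and> (\<exists>n\<ge>1. b n \<noteq> 0) \<and>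
     \<bar>abs_abscissa a lam\<bar> \<noteq> \<infinity> \<and> \<bar>abs_abscissa b mu\<bar> \<noteq> \<infinity> \<and>
     (\<exists>X::complex \<Rightarrow> complex.
        X meromorphic_on UNIV \<and>
        (\<forall>s. ereal (Re s) > abs_abscissa a lam \<and> (s + of_nat \<delta>) / 2 \<notin> \<int>\<^sub>\<le>\<^sub>0 \<longrightarrow>
             X s = Gamma ((s + of_nat \<delta>) / 2) * dirichlet_series a lam s) \<and>
        (\<forall>s. ereal (Re s) < 1 - abs_abscissa b mu \<and> (1 - s + of_nat \<delta>) / 2 \<notin> \<int>\<^sub>\<le>\<^sub>0 \<longrightarrow>
             X s = Gamma ((1 - s + of_nat \<delta>) / 2) * dirichlet_series b mu (1 - s)) \<and>
        (\<forall>\<sigma>1 \<sigma>2::real. \<forall>\<epsilon>>0. \<exists>T. \<forall>s.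
             \<sigma>1 \<le> Re s \<and> Re s \<le> \<sigma>2 \<and> \<bar>Im s\<bar> \<ge> T \<longrightarrow> norm (X s) < \<epsilon>) \<and>
        (\<exists>K. compact K \<and> X holomorphic_on - K))"

(* f continues the Dirichlet series of (a, lam); the continuation is unique except for its
   irrelevant value at a pole s = 1. *)
definition continues_series ::
  "(complex \<Rightarrow> complex) \<Rightarrow> (nat \<Rightarrow> complex) \<Rightarrow> (nat \<Rightarrow> real) \<Rightarrow> bool" where
  "continues_series f a lam \<longleftrightarrow>
     (\<forall>s. ereal (Re s) > abs_abscissa a lam \<longrightarrow> f s = dirichlet_series a lam s)"

definition entire_but_simple_pole_at_1 :: "(complex \<Rightarrow> complex) \<Rightarrow> bool" where
  "entire_but_simple_pole_at_1 f \<longleftrightarrow>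
     f holomorphic_on UNIV \<or> (f holomorphic_on - {1} \<and> is_pole f 1 \<and> zorder f 1 = - 1)"

definition class_B ::
  "nat \<Rightarrow> (nat \<Rightarrow> complex) \<Rightarrow> (nat \<Rightarrow> real) \<Rightarrow> (nat \<Rightarrow> complex) \<Rightarrow> (nat \<Rightarrow> real) \<Rightarrow>
     (complex \<Rightarrow> complex) \<Rightarrow> (complex \<Rightarrow> complex) \<Rightarrow> bool" where
  "class_B \<delta> a lam b mu \<phi> \<psi> \<longleftrightarrow>
     bochner_pair \<delta> a lam b mu \<and> continues_series \<phi> a lam \<and> continues_series \<psi> b mu \<and>
     (if \<delta> = 0 then entire_but_simple_pole_at_1 \<phi> \<and> entire_but_simple_pole_at_1 \<psi>
      else \<phi> holomorphic_on UNIV \<and> \<psi> holomorphic_on UNIV)"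

definition extend_coeff ::
  "nat \<Rightarrow> (nat \<Rightarrow> complex) \<Rightarrow> (complex \<Rightarrow> complex) \<Rightarrow> int \<Rightarrow> complex" where
  "extend_coeff \<delta> a \<phi> n =
     (if n = 0 then - 2 * \<phi> (- of_nat \<delta>)
      else if n > 0 then a (nat n)
      else (- 1) ^ \<delta> * a (nat (- n)))"

definition extend_freq :: "(nat \<Rightarrow> real) \<Rightarrow> int \<Rightarrow> real" where
  "extend_freq lam n = (if n = 0 then 0 else if n > 0 then lam (nat n) else - lam (nat (- n)))"

definition pos_def_form :: "real \<Rightarrow> real \<Rightarrow> real \<Rightarrow> bool" where
  "pos_def_form a b c \<longleftrightarrow> (\<forall>x y. (x, y) \<noteq> (0, 0) \<longrightarrow> a * x\<^sup>2 + b * x * y + c * y\<^sup>2 > 0)"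

definition epstein_term ::
  "complex \<Rightarrow> real \<Rightarrow> real \<Rightarrow> real \<Rightarrow> (int \<Rightarrow> complex) \<Rightarrow> (int \<Rightarrow> complex) \<Rightarrow>
     (int \<Rightarrow> real) \<Rightarrow> (int \<Rightarrow> real) \<Rightarrow> int \<times> int \<Rightarrow> complex" where
  "epstein_term s a b c A1 A2 L L' = (\<lambda>(m, n).
     A1 m * A2 n /
       complex_of_real (a * (L m)\<^sup>2 + b * L m * L' n + c * (L' n)\<^sup>2) powr s)"

definition epstein_Z2 ::
  "complex \<Rightarrow> real \<Rightarrow> real \<Rightarrow> real \<Rightarrow> (int \<Rightarrow> complex) \<Rightarrow> (int \<Rightarrow> complex) \<Rightarrow>
     (int \<Rightarrow> real) \<Rightarrow> (int \<Rightarrow> real) \<Rightarrow> complex" where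
  "epstein_Z2 s a b c A1 A2 L L' =
     infsum (epstein_term s a b c A1 A2 L L') (UNIV - {(0, 0)})"

(* For frequency sequences the index set of the sum is finite. *)
definition gen_divisor ::
  "complex \<Rightarrow> real \<Rightarrow> (nat \<Rightarrow> complex) \<Rightarrow> (nat \<Rightarrow> complex) \<Rightarrow>
     (nat \<Rightarrow> real) \<Rightarrow> (nat \<Rightarrow> real) \<Rightarrow> complex" where
  "gen_divisor z x b a mu lam =
     (\<Sum>(m, n) \<in> {(m, n). m \<ge> 1 \<and> n \<ge> 1 \<and> mu m * lam n = x}.
        b m * a n * complex_of_real (mu m) powr z)"

definition product_values :: "(nat \<Rightarrow> real) \<Rightarrow> (nat \<Rightarrow> real) \<Rightarrow> real set" where
  "product_values mu lam = {mu m * lam n | m n. m \<ge> 1 \<and> n \<ge> 1}"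

definition increasing_enumeration :: "(nat \<Rightarrow> real) \<Rightarrow> real set \<Rightarrow> bool" where
  "increasing_enumeration nu A \<longleftrightarrow> strict_mono_on {1..} nu \<and> nu ` {1..} = A"

(* Modified Bessel function of the second kind, complex order, argument x > 0, by its standard
   integral K_w(x) = int_0^oo exp(- x cosh t) cosh(w t) dt, absolutely convergent for all w. *)
definition bessel_K :: "complex \<Rightarrow> real \<Rightarrow> complex" where
  "bessel_K w x =
     integral {0..} (\<lambda>t::real. complex_of_real (exp (- x * cosh t)) * cosh (w * complex_of_real t))"

end

theory Submission
  imports Defs "HOL-Probability.Probability" "HOL-Real_Asymp.Real_Asymp"
begin

text \<open>
  Write Q(u,v) = a ((u + bv/(2a))^2 + (kv)^2), so that the row of the double series belonging to a
  fixed frequency v is a sum over the frequencies of \<open>\<phi>\<^sub>1\<close> of shifted powers. By the Gamma integral such a row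
  is an integral over t of a theta series with Gaussians centred at the shift instead of the origin.
  The functional equation, by Mellin inversion and a contour shift, gives the inversion formula of the
  unshifted theta series; it extends to complex \<open>\<tau>\<close> in the right half-plane. A fixed linear
  functional on functions holomorphic near t (integration over a circle against a kernel)
  maps exp(-x^2 \<open>\<tau>\<close>) to exp(-t x^2) cosh(2xz), and applying it to both sides moves the centre of the
  Gaussians. Integrating over t turns the dual side into Bessel functions, and summing over the rows
  and collecting equal products \<open>\<nu>\<close> gives the expansion. The second formula is the first one
  for the form with a and c exchanged.
\<close>

section \<open>Contour shifts and Mellin inversion of the Gamma function\<close>

text \<open>General frequencies form no lattice, so the shifted Gaussians cannot be reached by
  Poisson summation; everything has to come out of the unshifted functional equation. The shift is
  possible because cosh(2xz), and sinh(2xz) divided by x, are entire functions of x^2: they arise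
  from exp(-x^2 \<tau>) by reweighting its Taylor coefficients at t. Up to a geometric factor the
  weights decay like 1/l!, whatever the radius, so the functional has a bounded kernel and acts
  termwise on both sides, on a circle of radius t/2 inside the right half-plane. Convergence rests
  on product majorants: Q(u,v) >= \<kappa> |u| |v| for the double series, and a multiple of (K
  m)^(-\<sigma>) for the Bessel integrals. They reduce double sums to products of single Dirichlet
  series at \<sigma> = Re s, which is why it suffices that Re s exceeds the separate abscissas. For
  \<delta> = 0 the value -2 \<phi>(0) at index 0 is what makes one axis sum of the double series
  cancel against the constant term of the theta inversion.\<close>

lemma vertical_line_integral_limit:
  fixes f :: "real \<Rightarrow> complex"
  assumes "integrable lborel f"
  shows "(\<lambda>n. integral {-real n..real n} f) \<longlonglongrightarrow> (\<integral>y. f y \<partial>lborel)"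
proof -
  have "(\<lambda>n. \<integral>y. indicator {-real n..real n} y *\<^sub>R f y \<partial>lborel) \<longlonglongrightarrow> (\<integral>y. f y \<partial>lborel)"
  proof (rule integral_dominated_convergence[where w="\<lambda>y. norm (f y)"])
    show "AE y in lborel. (\<lambda>n. indicator {-real n..real n} y *\<^sub>R f y) \<longlonglongrightarrow> f y"
    proof (rule AE_I2)
      fix y :: real
      obtain N where N: "\<bar>y\<bar> \<le> real N" using real_arch_simple by blast
      have "\<forall>\<^sub>F n in sequentially. indicator {-real n..real n} y *\<^sub>R f y = f y"
        using eventually_ge_at_top[of N]
        by eventually_elim (use N in \<open>auto simp: indicator_def\<close>)
      then show "(\<lambda>n. indicator {-real n..real n} y *\<^sub>R f y) \<longlonglongrightarrow> f y"
        by (rule tendsto_eventually)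
    qed
  qed (use assms in \<open>auto simp: indicator_def\<close>)
  moreover have "(\<integral>y. indicator {-real n..real n} y *\<^sub>R f y \<partial>lborel) = integral {-real n..real n} f" for n
  proof -
    have "set_integrable lborel {-real n..real n} f"
      unfolding set_integrable_def by (intro integrable_mult_indicator assms) auto
    from set_borel_integral_eq_integral(2)[OF this] show ?thesis
      unfolding set_lebesgue_integral_def .
  qed
  ultimately show ?thesis by simp
qed

text \<open>The residue theorem on rectangles of height 2n: the horizontal sides vanish by the
  uniform decay, and the vertical sides converge by absolute integrability. Integrating in y instead
  of z = c + iy removes a factor i, which leaves 2 pi in front of the residues.\<close>

lemma vertical_strip_residues:
  fixes f :: "complex \<Rightarrow> complex"
  assumes c: "c1 < c2" and S: "open S" "convex S" and P: "finite P" and hol: "f holomorphic_on S - P"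
    and sub: "\<And>z. c1 \<le> Re z \<Longrightarrow> Re z \<le> c2 \<Longrightarrow> z \<in> S"
    and PS: "\<And>p. p \<in> P \<Longrightarrow> c1 < Re p \<and> Re p < c2"
    and i1: "integrable lborel (\<lambda>y. f (Complex c1 y))"
    and i2: "integrable lborel (\<lambda>y. f (Complex c2 y))"
    and decay: "\<And>\<epsilon>. \<epsilon> > 0 \<Longrightarrow> \<exists>T. \<forall>z. c1 \<le> Re z \<and> Re z \<le> c2 \<and> \<bar>Im z\<bar> \<ge> T \<longrightarrow> norm (f z) < \<epsilon>"
  shows "(\<integral>y. f (Complex c2 y) \<partial>lborel) - (\<integral>y. f (Complex c1 y) \<partial>lborel)
           = 2 * pi * (\<Sum>p\<in>P. residue f p)"
proof -
  define h where "h = (\<lambda>x::real. contour_integral (linepath (Complex c1 x) (Complex c2 x)) f)"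
  have contf: "continuous_on A f" if "A \<subseteq> S - P" for A
    using holomorphic_on_imp_continuous_on[OF hol] that continuous_on_subset by blast
  obtain N0 :: nat where N0: "\<And>p. p \<in> P \<Longrightarrow> \<bar>Im p\<bar> < real N0" "N0 > 0"
  proof -
    obtain B where B: "\<forall>x\<in>(\<lambda>p. \<bar>Im p\<bar>) ` P. x \<le> B"
      using P by (meson bdd_above_def bdd_above_finite finite_imageI)
    obtain N :: nat where "B < real N" using reals_Archimedean2 by blast
    then show ?thesis using that[of "Suc N"] B by force
  qed
  have notP: "z \<notin> P" if "Re z = c1 \<or> Re z = c2 \<or> \<bar>Im z\<bar> \<ge> real N0" for z
    using PS[of z] N0(1)[of z] that by auto
  have key: "integral {-real n..real n} (\<lambda>y. f (Complex c2 y)) - integral {-real n..real n} (\<lambda>y. f (Complex c1 y))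
       = 2 * pi * (\<Sum>p\<in>P. residue f p) + \<i> * (h (- real n) - h (real n))" if n: "n \<ge> N0" for n
  proof -
    define a1 a2 a3 a4 where "a1 = Complex c1 (-real n)" and "a2 = Complex c2 (-real n)"
      and "a3 = Complex c2 (real n)" and "a4 = Complex c1 (real n)"
    have npos: "real n > 0" using n N0 by auto
    let ?g = "rectpath a1 a3"
    have inS: "z \<in> S" if "z \<in> cbox a1 a3" for z
      using that sub[of z] by (auto simp: in_cbox_complex_iff a1_def a3_def)
    have img: "path_image ?g \<subseteq> S - P"
    proof
      fix z assume "z \<in> path_image ?g"
      then have "z \<in> cbox a1 a3 - box a1 a3"
        by (subst (asm) path_image_rectpath_cbox_minus_box) (use c npos in \<open>auto simp: a1_def a3_def\<close>)
      then show "z \<in> S - P"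
        using inS[of z] notP[of z] n
        by (force simp: in_cbox_complex_iff in_box_complex_iff a1_def a3_def)
    qed
    have wn: "winding_number ?g p = 1" if "p \<in> P" for p
      by (rule winding_number_rectpath)
        (use PS[OF that] N0(1)[OF that] n in \<open>auto simp: in_box_complex_iff a1_def a3_def\<close>)
    have "contour_integral ?g f = 2 * pi * \<i> * (\<Sum>p\<in>P. winding_number ?g p * residue f p)"
    proof (rule Residue_theorem)
      show "connected S" using S convex_connected by blast
      show "\<forall>z. z \<notin> S \<longrightarrow> winding_number ?g z = 0"
        using img by (auto intro!: winding_number_zero_outside[of _ S] S(2))
    qed (use S P hol img in auto)
    then have res: "contour_integral ?g f = 2 * pi * \<i> * (\<Sum>p\<in>P. residue f p)"
      using wn by simp
    have rp: "?g = linepath a1 a2 +++ linepath a2 a3 +++ linepath a3 a4 +++ linepath a4 a1"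
      by (simp add: rectpath_def Let_def a1_def a2_def a3_def a4_def)
    have im: "path_image (linepath a1 a2) \<subseteq> S - P" "path_image (linepath a2 a3) \<subseteq> S - P"
       "path_image (linepath a3 a4) \<subseteq> S - P" "path_image (linepath a4 a1) \<subseteq> S - P"
      using img unfolding rp by (auto simp: path_image_join)
    have ci: "f contour_integrable_on linepath u v" if "path_image (linepath u v) \<subseteq> S - P" for u v
      using contf[OF that] by (intro contour_integrable_continuous_linepath) auto
    have sum4: "contour_integral ?g f = contour_integral (linepath a1 a2) f + contour_integral (linepath a2 a3) f
        + contour_integral (linepath a3 a4) f + contour_integral (linepath a4 a1) f"
      unfolding rp using im by (simp add: ci contour_integrable_joinI)
    have vert: "contour_integral (linepath (Complex x (-real n)) (Complex x (real n))) f
        = \<i> * integral {-real n..real n} (\<lambda>y. f (Complex x y))"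
      if "path_image (linepath (Complex x (-real n)) (Complex x (real n))) \<subseteq> S - P" for x
    proof -
      have "(f has_contour_integral contour_integral (linepath (Complex x (-real n)) (Complex x (real n))) f)
           (linepath (Complex x (-real n)) (Complex x (real n)))"
        using ci[OF that] has_contour_integral_integral by blast
      then have "((\<lambda>y. f (Complex x y)) has_integral 
          - \<i> * contour_integral (linepath (Complex x (-real n)) (Complex x (real n))) f) {-real n..real n}"
        by (subst (asm) has_contour_integral_linepath_same_Re_iff) (use npos in auto)
      then have "integral {-real n..real n} (\<lambda>y. f (Complex x y)) = 
            - \<i> * contour_integral (linepath (Complex x (-real n)) (Complex x (real n))) f"
        by (simp add: integral_unique)
      then show ?thesis by simp
    qed
    have r34: "contour_integral (linepath a3 a4) f = - h (real n)"
      unfolding h_def a3_def a4_def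
      using contour_integral_reverse_linepath[of "Complex c1 (real n)" "Complex c2 (real n)" f] contf[OF im(3)]
      by (simp add: a3_def a4_def closed_segment_commute)
    have r41: "contour_integral (linepath a4 a1) f = - contour_integral (linepath a1 a4) f"
      using contour_integral_reverse_linepath[of a1 a4 f] contf[OF im(4)]
      by (simp add: closed_segment_commute)
    have "path_image (linepath a1 a4) \<subseteq> S - P" using im(4) by (simp add: closed_segment_commute)
    then have v1: "contour_integral (linepath a1 a4) f = \<i> * integral {-real n..real n} (\<lambda>y. f (Complex c1 y))"
      using vert[of c1] unfolding a1_def a4_def by simp
    have v2: "contour_integral (linepath a2 a3) f = \<i> * integral {-real n..real n} (\<lambda>y. f (Complex c2 y))"
      using vert[of c2] im(2) unfolding a2_def a3_def by simp
    have h1: "contour_integral (linepath a1 a2) f = h (- real n)" by (simp add: h_def a1_def a2_def)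
    let ?I2 = "integral {-real n..real n} (\<lambda>y. f (Complex c2 y))"
    let ?I1 = "integral {-real n..real n} (\<lambda>y. f (Complex c1 y))"
    have "2 * pi * \<i> * (\<Sum>p\<in>P. residue f p) = h (- real n) + \<i> * ?I2 - h (real n) - \<i> * ?I1"
      using res sum4 r34 r41 v1 v2 h1 by simp
    then have "\<i> * (?I2 - ?I1) = \<i> * (2 * pi * (\<Sum>p\<in>P. residue f p) + \<i> * (h (- real n) - h (real n)))"
      by (simp add: algebra_simps) 
    then show ?thesis by simp
  qed
  \<comment> \<open>One argument for the top and the bottom side, \<open>g n\<close> being n or -n:
    a side has fixed length c2 - c1 and the integrand tends to 0 on it.\<close>
  have hlim: "((\<lambda>n. h (g n)) \<longlonglongrightarrow> 0)" if g: "\<And>n. \<bar>g n\<bar> = real n" for g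
  proof (rule LIMSEQ_I)
    fix e :: real assume e: "e > 0"
    define e' where "e' = e / (2 * (c2 - c1))"
    have e': "e' > 0" using e c by (simp add: e'_def)
    obtain T where T: "\<And>z. c1 \<le> Re z \<Longrightarrow> Re z \<le> c2 \<Longrightarrow> \<bar>Im z\<bar> \<ge> T \<Longrightarrow> norm (f z) < e'"
      using decay[OF e'] by blast
    obtain M where M: "T \<le> real M" using real_arch_simple by blast
    show "\<exists>no. \<forall>n\<ge>no. norm (h (g n) - 0) < e"
    proof (intro exI[of _ "max M N0"] allI impI)
      fix n assume n: "n \<ge> max M N0"
      have seg: "Im z = g n \<and> c1 \<le> Re z \<and> Re z \<le> c2"
        if "z \<in> closed_segment (Complex c1 (g n)) (Complex c2 (g n))" for z
      proof -
        have "closed_segment (Complex c1 (g n)) (Complex c2 (g n)) = {z. Im z = g n \<and> Re z \<in> closed_segment c1 c2}"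
          using closed_segment_same_Im[of "Complex c1 (g n)" "Complex c2 (g n)"] by auto
        then show ?thesis using that c by (auto simp: closed_segment_eq_real_ivl)
      qed
      have "closed_segment (Complex c1 (g n)) (Complex c2 (g n)) \<subseteq> S - P"
      proof
        fix z assume "z \<in> closed_segment (Complex c1 (g n)) (Complex c2 (g n))"
        with seg[OF this] show "z \<in> S - P" using sub[of z] notP[of z] g[of n] n by auto
      qed
      then have ci: "f contour_integrable_on linepath (Complex c1 (g n)) (Complex c2 (g n))"
        using contf by (intro contour_integrable_continuous_linepath) auto
      have "norm (h (g n)) \<le> e' * norm (Complex c2 (g n) - Complex c1 (g n))"
        unfolding h_def
      proof (rule contour_integral_bound_linepath[OF ci])
        fix z assume "z \<in> closed_segment (Complex c1 (g n)) (Complex c2 (g n))"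
        with seg[OF this] show "norm (f z) \<le> e'" using T[of z] g[of n] n M by force
      qed (use e' in auto)
      also have "norm (Complex c2 (g n) - Complex c1 (g n)) = c2 - c1"
        using c by (simp add: cmod_def)
      also have "e' * (c2 - c1) < e" using e c by (simp add: e'_def field_simps)
      finally show "norm (h (g n) - 0) < e" by simp
    qed
  qed
  have "(\<lambda>n. 2 * pi * (\<Sum>p\<in>P. residue f p) + \<i> * (h (- real n) - h (real n)))
      \<longlonglongrightarrow> 2 * pi * (\<Sum>p\<in>P. residue f p) + \<i> * (0 - 0)"
    by (intro tendsto_intros hlim) auto
  then have "(\<lambda>n. integral {-real n..real n} (\<lambda>y. f (Complex c2 y)) - integral {-real n..real n} (\<lambda>y. f (Complex c1 y)))
     \<longlonglongrightarrow> 2 * pi * (\<Sum>p\<in>P. residue f p)"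
    by (subst tendsto_cong[OF eventually_mono[OF eventually_ge_at_top[of N0] key]]) (simp_all only: diff_0_right mult_zero_right add_0_right)
  moreover have "(\<lambda>n. integral {-real n..real n} (\<lambda>y. f (Complex c2 y)) - integral {-real n..real n} (\<lambda>y. f (Complex c1 y)))
     \<longlonglongrightarrow> (\<integral>y. f (Complex c2 y) \<partial>lborel) - (\<integral>y. f (Complex c1 y) \<partial>lborel)"
    by (intro tendsto_intros vertical_line_integral_limit i1 i2)
  ultimately show ?thesis using LIMSEQ_unique by blast
qed

section \<open>Decay of the Gamma function along vertical lines\<close>

lemma pochhammer_norm_ge: "\<bar>Im w\<bar> ^ n \<le> norm (pochhammer w n)"
proof (induction n)
  case (Suc n)
  have "\<bar>Im w\<bar> \<le> norm (w + of_nat n)" using abs_Im_le_cmod[of "w + of_nat n"] by simp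
  with Suc have "\<bar>Im w\<bar> * \<bar>Im w\<bar> ^ n \<le> norm (w + of_nat n) * norm (pochhammer w n)"
    by (intro mult_mono) auto
  then show ?case by (simp add: pochhammer_Suc norm_mult mult.commute)
qed auto

lemma norm_Gamma_le:
  assumes "Re w > 0"
  shows "norm (Gamma w) \<le> Gamma (Re w)"
proof -
  have "norm (Gamma w) = norm (integral {0<..} (\<lambda>t. of_real t powr (w - 1) / of_real (exp t)))"
    using integral_unique[OF Gamma_integral_complex'[OF assms]] by simp
  also have "\<dots> \<le> integral {0<..} (\<lambda>t. t powr (Re w - 1) / exp t)"
  proof (rule integral_norm_bound_integral)
    show "(\<lambda>t. complex_of_real t powr (w - 1) / of_real (exp t)) integrable_on {0<..}"
      using Gamma_integral_complex'[OF assms] by blast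
    show "(\<lambda>t. t powr (Re w - 1) / exp t) integrable_on {0<..}"
    proof (rule integrable_spike_set[of _ "{0..}"])
      show "(\<lambda>t. t powr (Re w - 1) / exp t) integrable_on {0..}"
        using Gamma_integral_real[OF assms] by blast
      show "negligible {x \<in> {0..} - {0<..}. x powr (Re w - 1) / exp x \<noteq> 0}"
        by (rule negligible_subset[of "{0}"]) auto
      show "negligible {x \<in> {0<..} - {0..}. x powr (Re w - 1) / exp x \<noteq> 0}"
        by (rule negligible_subset[of "{0}"]) auto
    qed
  qed (auto simp: norm_divide norm_powr_real_powr)
  also have "\<dots> = integral {0..} (\<lambda>t. t powr (Re w - 1) / exp t)"
    by (rule integral_spike_set) (rule negligible_subset[of "{0}"], auto)+
  also have "\<dots> = Gamma (Re w)" using Gamma_integral_real[OF assms] by blast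
  finally show ?thesis .
qed

text \<open>Decay of every polynomial order is enough here, and it needs no Stirling formula:
  Gamma(w) is Gamma(w + N) divided by a Pochhammer product of N factors, each of size at least |Im
  w|, while Gamma(w + N) is bounded on the strip by its values on a compact real interval.\<close>

lemma Gamma_decay:
  fixes c1 c2 :: real
  shows "\<exists>M. M \<ge> 0 \<and> (\<forall>w. c1 \<le> Re w \<and> Re w \<le> c2 \<and> \<bar>Im w\<bar> \<ge> 1 \<longrightarrow> norm (Gamma w) \<le> M / \<bar>Im w\<bar> ^ n)"
proof -
  \<comment> \<open>This N serves twice: N >= n gives the order of decay, and c1 + N > 0 moves the
    whole strip into the right half-plane.\<close>
  obtain N :: nat where N: "real N > real n + \<bar>c1\<bar>" using reals_Archimedean2 by blast
  have "continuous_on {c1 + N..c2 + N} (Gamma :: real \<Rightarrow> real)"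
    using N by (intro continuous_on_Gamma continuous_intros) (auto elim!: nonpos_Ints_cases)
  then have "bounded (Gamma ` {c1 + N..c2 + N})"
    by (intro compact_imp_bounded compact_continuous_image) auto
  then obtain M where M: "\<And>x. x \<in> {c1 + N..c2 + N} \<Longrightarrow> \<bar>Gamma x\<bar> \<le> M"
    unfolding bounded_iff by fastforce
  show ?thesis
  proof (intro exI[of _ "\<bar>M\<bar>"] conjI allI impI)
    fix w assume w: "c1 \<le> Re w \<and> Re w \<le> c2 \<and> \<bar>Im w\<bar> \<ge> 1"
    have nz: "w \<notin> \<int>\<^sub>\<le>\<^sub>0" using w by (auto elim!: nonpos_Ints_cases)
    have p: "\<bar>Im w\<bar> ^ n \<le> norm (pochhammer w N)"
    proof -
      have "\<bar>Im w\<bar> ^ n \<le> \<bar>Im w\<bar> ^ N" using w N by (intro power_increasing) auto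
      then show ?thesis using pochhammer_norm_ge[of w N] by linarith
    qed
    have pos: "\<bar>Im w\<bar> ^ n > 0" using w by (intro zero_less_power) linarith
    have "pochhammer w N = Gamma (w + of_nat N) / Gamma w"
      using pochhammer_Gamma[OF nz] by simp
    moreover have "Gamma w \<noteq> 0" using nz by (simp add: Gamma_eq_zero_iff)
    ultimately have "Gamma w * pochhammer w N = Gamma (w + of_nat N)" by simp
    then have "norm (Gamma w) * norm (pochhammer w N) = norm (Gamma (w + of_nat N))"
      by (metis norm_mult)
    also have "\<dots> \<le> Gamma (Re w + N)"
    proof -
      have "Re w + real N > 0" using w N by linarith
      then show ?thesis using norm_Gamma_le[of "w + of_nat N"] by simp
    qed
    also have "\<dots> \<le> \<bar>M\<bar>" using M[of "Re w + N"] w by auto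
    finally have "norm (Gamma w) * norm (pochhammer w N) \<le> \<bar>M\<bar>" .
    then have "norm (Gamma w) * \<bar>Im w\<bar> ^ n \<le> \<bar>M\<bar>"
      using p mult_left_mono[OF p, of "norm (Gamma w)"] by simp
    then show "norm (Gamma w) \<le> \<bar>M\<bar> / \<bar>Im w\<bar> ^ n" using pos by (simp add: field_simps)
  qed auto
qed

lemma integrable_inverse_1_plus_square_real: "integrable lborel (\<lambda>y::real. C / (1 + y\<^sup>2))"
proof -
  have "integrable lborel (\<lambda>y::real. inverse (1 + y\<^sup>2))"
    using integrable_inverse_1_plus_square unfolding set_integrable_def by simp
  then show ?thesis using integrable_mult_right[of C lborel "\<lambda>y::real. inverse (1 + y\<^sup>2)"]
    by (simp add: divide_inverse)
qed

lemma Gamma_vertical_integrable: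
  fixes c :: real
  assumes c: "complex_of_real c \<notin> \<int>\<^sub>\<le>\<^sub>0"
  shows "integrable lborel (\<lambda>y. Gamma (Complex c y))"
proof -
  have nz: "Complex c y \<notin> \<int>\<^sub>\<le>\<^sub>0" for y
  proof
    assume *: "Complex c y \<in> \<int>\<^sub>\<le>\<^sub>0"
    then have "y = 0" by (auto elim!: nonpos_Ints_cases simp: complex_eq_iff)
    with * c show False by (simp add: complex_of_real_def)
  qed
  have cont: "continuous_on UNIV (\<lambda>y. Gamma (Complex c y))"
    using nz by (intro continuous_on_compose2[OF continuous_on_Gamma[of "range (Complex c)"], of UNIV "Complex c"])
      (auto intro!: continuous_intros simp: Complex_eq)
  obtain M where M: "M \<ge> 0" "\<And>w. c \<le> Re w \<Longrightarrow> Re w \<le> c \<Longrightarrow> \<bar>Im w\<bar> \<ge> 1 \<Longrightarrow> norm (Gamma w) \<le> M / \<bar>Im w\<bar> ^ 2"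
    using Gamma_decay[of c c 2] by blast
  have "bounded ((\<lambda>y. Gamma (Complex c y)) ` {-1..1})"
    using continuous_on_subset[OF cont] by (intro compact_imp_bounded compact_continuous_image) auto
  then obtain B where B: "\<And>y. y \<in> {-1..1} \<Longrightarrow> norm (Gamma (Complex c y)) \<le> B"
    unfolding bounded_iff by fastforce
  show ?thesis
  \<comment> \<open>The factor 2 covers both ranges: 1 + y^2 <= 2 where |y| <= 1, and 1/y^2 <= 2/(1
    + y^2) where |y| >= 1.\<close>
  proof (rule Bochner_Integration.integrable_bound[OF integrable_inverse_1_plus_square_real[of "2 * (\<bar>B\<bar> + M)"]])
    show "(\<lambda>y. Gamma (Complex c y)) \<in> borel_measurable lborel"
      using cont by (simp add: borel_measurable_continuous_onI)
    show "AE y in lborel. norm (Gamma (Complex c y)) \<le> norm (2 * (\<bar>B\<bar> + M) / (1 + y\<^sup>2))"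
    proof (rule AE_I2)
      fix y :: real
      have "norm (Gamma (Complex c y)) \<le> 2 * (\<bar>B\<bar> + M) / (1 + y\<^sup>2)"
      proof (cases "\<bar>y\<bar> \<le> 1")
        case True
        then have "y\<^sup>2 \<le> 1" by (simp add: abs_square_le_1)
        then have "(\<bar>B\<bar> + M) * (1 + y\<^sup>2) \<le> (\<bar>B\<bar> + M) * 2"
          using M(1) by (intro mult_left_mono) auto
        then have "\<bar>B\<bar> + M \<le> 2 * (\<bar>B\<bar> + M) / (1 + y\<^sup>2)" 
          by (subst pos_le_divide_eq) (auto simp: add_pos_nonneg)
        moreover have "norm (Gamma (Complex c y)) \<le> \<bar>B\<bar> + M" using B[of y] True M(1) by (smt (verit) atLeastAtMost_iff)
        ultimately show ?thesis by linarith
      next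
        case False
        then have y2: "y\<^sup>2 \<ge> 1" by (metis abs_le_square_iff abs_one linear one_power2)
        have "norm (Gamma (Complex c y)) \<le> M / y\<^sup>2" using M(2)[of "Complex c y"] False by simp
        also have "\<dots> \<le> 2 * M / (1 + y\<^sup>2)"
        proof -
          have "M * (1 + y\<^sup>2) \<le> M * (2 * y\<^sup>2)" using y2 M(1) by (intro mult_left_mono) auto
          then have "M \<le> (2 * M) * y\<^sup>2 / (1 + y\<^sup>2)"
            by (intro mult_imp_le_div_pos) (auto simp: add_pos_nonneg mult_ac)
          then show ?thesis using y2 by (intro mult_imp_div_pos_le) auto
        qed
        also have "\<dots> \<le> 2 * (\<bar>B\<bar> + M) / (1 + y\<^sup>2)" by (intro divide_right_mono) auto
        finally show ?thesis .
      qed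
      then show "norm (Gamma (Complex c y)) \<le> norm (2 * (\<bar>B\<bar> + M) / (1 + y\<^sup>2))" by (simp add: M(1))
    qed
  qed
qed

section \<open>Mellin inversion: exp(-x) as a vertical integral of Gamma\<close>

lemma powr_of_real_square:
  assumes "x > 0"
  shows "complex_of_real (x\<^sup>2) powr w = of_real x powr (2 * w)"
  using assms by (simp add: powr_def Ln_of_real ln_realpow mult_ac flip: of_real_power)

lemma norm_powr_Complex:
  "x > 0 \<Longrightarrow> norm (complex_of_real x powr (- Complex c y)) = x powr (- c)"
  by (simp add: norm_powr_real_powr)

lemma Gamma_mellin_integrable:
  fixes c x :: real
  assumes c: "complex_of_real c \<notin> \<int>\<^sub>\<le>\<^sub>0" and x: "x > 0"
  shows "integrable lborel (\<lambda>y. Gamma (Complex c y) * of_real x powr (- Complex c y))"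
proof (rule Bochner_Integration.integrable_bound)
  show "integrable lborel (\<lambda>y. Gamma (Complex c y) * of_real (x powr (- c)))"
    by (intro integrable_mult_left Gamma_vertical_integrable c)
  have "continuous_on UNIV (\<lambda>y. complex_of_real x powr (- Complex c y))"
    using x by (auto intro!: continuous_intros simp: Complex_eq)
  then show "(\<lambda>y. Gamma (Complex c y) * of_real x powr (- Complex c y)) \<in> borel_measurable lborel"
    using Gamma_vertical_integrable[OF c]
    by (intro borel_measurable_times) (auto simp: borel_measurable_continuous_onI)
qed (use x in \<open>simp add: norm_mult norm_powr_Complex\<close>)

lemma half_integer_notin_nonpos_Ints: "complex_of_real (- real N - 1/2) \<notin> \<int>\<^sub>\<le>\<^sub>0"
proof
  assume "complex_of_real (- real N - 1/2) \<in> \<int>\<^sub>\<le>\<^sub>0"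
  then obtain n where "complex_of_real (- real N - 1/2) = - of_nat n" by (auto elim: nonpos_Ints_cases')
  then have "complex_of_real (- real N - 1/2) = complex_of_real (- real n)" by simp
  then have "- real N - 1/2 = - real n" by (simp only: of_real_eq_iff)
  then have "2 * real n = 2 * real N + 1" by simp
  then have "2 * n = 2 * N + 1" by linarith
  then show False by presburger
qed

lemma powr_strip_bound:
  fixes x :: real
  assumes x: "x > 0"
  obtains X where "X > 0" "\<And>u. l \<le> u \<Longrightarrow> u \<le> c \<Longrightarrow> x powr (- u) \<le> X"
proof
  show "x powr (- l) + x powr (- c) > 0" using x by (simp add: add_pos_pos)
  fix u assume u: "l \<le> u" "u \<le> c"
  show "x powr (- u) \<le> x powr (- l) + x powr (- c)"
  proof (cases "x \<ge> 1")
    case True then have "x powr (- u) \<le> x powr (- l)" using u by (intro powr_mono) auto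
    then show ?thesis by (simp add: add_increasing2)
  next
    case False then have "x powr (- u) \<le> x powr (- c)" using u x by (intro powr_mono') auto
    then show ?thesis by (simp add: add_increasing)
  qed
qed

text \<open>The residue of Gamma(w) x^(-w) at w = -n is (-x)^n / n!, so moving the line past the
  poles 0, ..., -N collects a partial sum of the exponential series. The new line runs midway
  between two consecutive poles.\<close>

lemma Gamma_mellin_partial:
  fixes c x :: real
  assumes c: "c > 0" and x: "x > 0"
  shows "(\<integral>y. Gamma (Complex c y) * of_real x powr (- Complex c y) \<partial>lborel)
     - (\<integral>y. Gamma (Complex (- real N - 1/2) y) * of_real x powr (- Complex (- real N - 1/2) y) \<partial>lborel)
     = 2 * pi * (\<Sum>n\<le>N. (- complex_of_real x) ^ n / fact n)"
proof -
  define f :: "complex \<Rightarrow> complex" where "f = (\<lambda>w. Gamma w * of_real x powr (- w))"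
  \<comment> \<open>The bound -N - 1 is the first pole that is not crossed, so the poles of Gamma in
    \<open>S\<close> are exactly those in \<open>P\<close>.\<close>
  define S where "S = {w. Re w > - real N - 1}"
  define P where "P = (\<lambda>n. - of_nat n :: complex) ` {..N}"
  have inj: "inj_on (\<lambda>n. - of_nat n :: complex) {..N}" by (auto simp: inj_on_def)
  have nonpos: "w \<in> P" if "w \<in> S" "w \<in> \<int>\<^sub>\<le>\<^sub>0" for w
    using that(2)
  proof (cases rule: nonpos_Ints_cases')
    case (1 n)
    with that(1) have "real n < real N + 1" by (simp add: S_def)
    then have "n \<le> N" by linarith
    then show ?thesis using 1 by (auto simp: P_def)
  qed
  have cn: "complex_of_real c \<notin> \<int>\<^sub>\<le>\<^sub>0" using c by (auto elim!: nonpos_Ints_cases' simp: complex_eq_iff)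
  have res: "residue f (- of_nat n) = (- of_real x) ^ n / fact n" for n
  proof (rule residue_simple')
    show "open (- (\<int>\<^sub>\<le>\<^sub>0 - {- of_nat n}) :: complex set)"
      by (intro open_Compl closed_subset_Ints) auto
    show "f holomorphic_on (- (\<int>\<^sub>\<le>\<^sub>0 - {- of_nat n}) - {- of_nat n})"
      unfolding f_def by (intro holomorphic_intros) (use x in auto)
    have "((\<lambda>w. (Gamma w * (w + of_nat n)) * of_real x powr (- w)) \<longlongrightarrow> 
        ((-1) ^ n / fact n) * of_real x powr (- (- of_nat n))) (at (- of_nat n :: complex))"
      using x by (intro tendsto_intros Gamma_residues) auto
    also have "((-1) ^ n / fact n) * complex_of_real x powr (- (- of_nat n)) = (- of_real x) ^ n / fact n"
      using x by (simp add: powr_nat' power_minus[of "complex_of_real x"])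
    finally show "((\<lambda>w. f w * (w - - of_nat n)) \<longlongrightarrow> (- of_real x) ^ n / fact n) (at (- of_nat n))"
      by (simp add: f_def mult_ac)
  qed auto
  have "(\<integral>y. f (Complex c y) \<partial>lborel) - (\<integral>y. f (Complex (- real N - 1/2) y) \<partial>lborel)
     = 2 * pi * (\<Sum>p\<in>P. residue f p)"
  proof (rule vertical_strip_residues)
    show "open S" unfolding S_def by (rule open_halfspace_Re_gt)
    show "convex S" unfolding S_def by (rule convex_halfspace_Re_gt)
    show "f holomorphic_on S - P"
      unfolding f_def using nonpos x by (intro holomorphic_intros) auto
    show "integrable lborel (\<lambda>y. f (Complex (- real N - 1/2) y))"
      unfolding f_def by (rule Gamma_mellin_integrable[OF half_integer_notin_nonpos_Ints x])
    show "integrable lborel (\<lambda>y. f (Complex c y))"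
      unfolding f_def by (rule Gamma_mellin_integrable[OF cn x])
    fix e :: real assume e: "e > 0"
    let ?l = "- real N - 1/2"
    obtain M where M: "M \<ge> 0" "\<And>w. ?l \<le> Re w \<Longrightarrow> Re w \<le> c \<Longrightarrow> \<bar>Im w\<bar> \<ge> 1 \<Longrightarrow> norm (Gamma w) \<le> M / \<bar>Im w\<bar> ^ 1"
      using Gamma_decay[of ?l c 1] by blast
    obtain X where X: "X > 0" and xX: "\<And>u. ?l \<le> u \<Longrightarrow> u \<le> c \<Longrightarrow> x powr (- u) \<le> X"
      using powr_strip_bound[OF x] by blast
    show "\<exists>T. \<forall>z. ?l \<le> Re z \<and> Re z \<le> c \<and> T \<le> \<bar>Im z\<bar> \<longrightarrow> norm (f z) < e"
    proof (intro exI[of _ "1 + (M * X) / e"] allI impI)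
      fix z assume z: "?l \<le> Re z \<and> Re z \<le> c \<and> 1 + (M * X) / e \<le> \<bar>Im z\<bar>"
      have z1: "\<bar>Im z\<bar> \<ge> 1" using z e X M(1) by (smt (verit) divide_nonneg_pos mult_nonneg_nonneg)
      have "norm (f z) = norm (Gamma z) * x powr (- Re z)"
        using x by (simp add: f_def norm_mult norm_powr_real_powr)
      also have "\<dots> \<le> (M / \<bar>Im z\<bar> ^ 1) * X"
        using M(2)[of z] xX[of "Re z"] z z1 M(1) by (intro mult_mono) auto
      also have "\<dots> < e"
      proof -
        have "M * X / e < \<bar>Im z\<bar>" using z by linarith
        then show ?thesis using z1 e by (simp add: field_simps)
      qed
      finally show "norm (f z) < e" .
    qed
  qed (use c in \<open>auto simp: P_def S_def\<close>)
  also have "(\<Sum>p\<in>P. residue f p) = (\<Sum>n\<le>N. (- of_real x) ^ n / fact n)"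
    unfolding P_def by (subst sum.reindex[OF inj]) (simp add: res)
  finally show ?thesis unfolding f_def .
qed

text \<open>The remainder after N poles is an integral over Re w = -N - 1/2. There Gamma(w) equals
  Gamma(1/2 + iy) over a Pochhammer product of size at least N!/2, so the remainder is O(x^N / N!)
  and tends to 0.\<close>

theorem Gamma_mellin_inversion:
  fixes c x :: real
  assumes c: "c > 0" and x: "x > 0"
  shows "(\<integral>y. Gamma (Complex c y) * of_real x powr (- Complex c y) \<partial>lborel) = 2 * pi * of_real (exp (- x))"
proof -
  define G where "G = (\<integral>y. norm (Gamma (Complex (1/2) y)) \<partial>lborel)"
  define J where "J = (\<lambda>N. \<integral>y. Gamma (Complex (- real N - 1/2) y) * of_real x powr (- Complex (- real N - 1/2) y) \<partial>lborel)"
  have half: "complex_of_real (1/2) \<notin> \<int>\<^sub>\<le>\<^sub>0" by (auto elim!: nonpos_Ints_cases' simp: complex_eq_iff)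
  have ig: "integrable lborel (\<lambda>y. norm (Gamma (Complex (1/2) y)))"
    by (intro integrable_norm Gamma_vertical_integrable half)
  \<comment> \<open>Each factor is at least the absolute value of its real part, N - i + 1/2. In
    reversed order the product is 1/2 times the factors i + 1/2 for i = 1, ..., N, hence at least
    N!/2.\<close>
  have ph: "fact N / 2 \<le> norm (pochhammer (Complex (- real N - 1/2) y) (Suc N))" for N y
  proof -
    have "norm (pochhammer (Complex (- real N - 1/2) y) (Suc N)) 
        = (\<Prod>i=0..N. norm (Complex (- real N - 1/2) y + of_nat i))"
      by (simp add: pochhammer_prod prod_norm[symmetric] atLeast0LessThan lessThan_Suc_atMost atLeast0AtMost del: prod.atMost_Suc)
    also have "\<dots> \<ge> (\<Prod>i=0..N. real (N - i) + 1/2)"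
    proof (rule prod_mono, safe)
      fix i assume i: "i \<in> {0..N}"
      have "real (N - i) + 1/2 = \<bar>Re (Complex (- real N - 1/2) y + of_nat i)\<bar>"
        using i by (simp add: of_nat_diff)
      also have "\<dots> \<le> norm (Complex (- real N - 1/2) y + of_nat i)" by (rule abs_Re_le_cmod)
      finally show "real (N - i) + 1/2 \<le> norm (Complex (- real N - 1/2) y + of_nat i)" .
    qed auto
    also have "(\<Prod>i=0..N. real (N - i) + 1/2) = (\<Prod>i=0..N. real i + 1/2)"
      by (subst prod.atLeastAtMost_rev) simp
    also have "\<dots> = (1/2) * (\<Prod>i=1..N. real i + 1/2)"
      by (simp add: prod.atLeast_Suc_atMost[of 0 N])
    finally have "(1/2) * (\<Prod>i=1..N. real i + 1/2) \<le> norm (pochhammer (Complex (- real N - 1/2) y) (Suc N))" .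
    moreover have "(\<Prod>i=1..N. real i) \<le> (\<Prod>i=1..N. real i + 1/2)" by (intro prod_mono) auto
    moreover have "(\<Prod>i=1..N. real i) = fact N" by (simp add: fact_prod)
    ultimately show ?thesis by simp
  qed
  have bnd: "norm (J N) \<le> (2 * x powr (1/2) * G) * (x ^ N / fact N)" for N
  proof -
    let ?l = "- real N - 1/2"
    have "norm (J N) \<le> (\<integral>y. (2 * x powr (real N + 1/2) / fact N) * norm (Gamma (Complex (1/2) y)) \<partial>lborel)"
      unfolding J_def
    proof (rule order_trans[OF integral_norm_bound integral_mono_AE])
      show "integrable lborel (\<lambda>y. norm (Gamma (Complex ?l y) * of_real x powr (- Complex ?l y)))"
        by (intro integrable_norm Gamma_mellin_integrable half_integer_notin_nonpos_Ints x)
      show "integrable lborel (\<lambda>y. (2 * x powr (real N + 1/2) / fact N) * norm (Gamma (Complex (1/2) y)))"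
        by (intro integrable_mult_right ig)
      show "AE y in lborel. norm (Gamma (Complex ?l y) * of_real x powr (- Complex ?l y))
             \<le> (2 * x powr (real N + 1/2) / fact N) * norm (Gamma (Complex (1/2) y))"
      proof (rule AE_I2)
        fix y
        have nz: "Complex ?l y \<notin> \<int>\<^sub>\<le>\<^sub>0"
        proof
          assume "Complex ?l y \<in> \<int>\<^sub>\<le>\<^sub>0"
          then obtain n where "Complex ?l y = - of_nat n" by (auto elim: nonpos_Ints_cases')
          then have "2 * real n = 2 * real N + 1" by (simp add: complex_eq_iff)
          then have "2 * n = 2 * N + 1" by linarith
          then show False by presburger
        qed
        have "pochhammer (Complex ?l y) (Suc N) = Gamma (Complex ?l y + of_nat (Suc N)) / Gamma (Complex ?l y)"
          by (rule pochhammer_Gamma[OF nz])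
        also have "Complex ?l y + of_nat (Suc N) = Complex (1/2) y" by (simp add: complex_eq_iff)
        finally have "Gamma (Complex ?l y) * pochhammer (Complex ?l y) (Suc N) = Gamma (Complex (1/2) y)"
          using nz by (simp add: Gamma_eq_zero_iff)
        then have "norm (Gamma (Complex (1/2) y)) = norm (Gamma (Complex ?l y)) * norm (pochhammer (Complex ?l y) (Suc N))"
          by (metis norm_mult)
        also have "\<dots> \<ge> norm (Gamma (Complex ?l y)) * (fact N / 2)"
          by (intro mult_left_mono ph) auto
        finally have g: "norm (Gamma (Complex ?l y)) \<le> 2 / fact N * norm (Gamma (Complex (1/2) y))"
          by (simp add: field_simps)
        have "norm (Gamma (Complex ?l y) * of_real x powr (- Complex ?l y)) 
              = norm (Gamma (Complex ?l y)) * x powr (real N + 1/2)"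
          using x by (simp add: norm_mult norm_powr_Complex add.commute)
        also have "\<dots> \<le> (2 / fact N * norm (Gamma (Complex (1/2) y))) * x powr (real N + 1/2)"
          by (intro mult_right_mono g) auto
        finally show "norm (Gamma (Complex ?l y) * of_real x powr (- Complex ?l y))
             \<le> (2 * x powr (real N + 1/2) / fact N) * norm (Gamma (Complex (1/2) y))"
          by (simp add: field_simps)
      qed
    qed
    also have "\<dots> = (2 * x powr (real N + 1/2) / fact N) * G" by (simp add: G_def)
    also have "x powr (real N + 1/2) = x ^ N * x powr (1/2)" using x by (simp add: powr_add powr_realpow)
    finally show ?thesis by (simp add: field_simps)
  qed
  have "(\<lambda>N. (2 * x powr (1/2) * G) * (x ^ N / fact N)) \<longlonglongrightarrow> (2 * x powr (1/2) * G) * 0"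
    by (intro tendsto_intros) (use summable_LIMSEQ_zero[OF summable_exp[of x]] in \<open>simp add: field_simps\<close>)
  then have J0: "J \<longlonglongrightarrow> 0"
    using bnd by (intro Lim_null_comparison[of J]) (auto intro: always_eventually)
  have "(\<lambda>N. (\<Sum>n\<le>N. (- complex_of_real x) ^ n / fact n)) \<longlonglongrightarrow> exp (- complex_of_real x)"
    using exp_converges[of "- complex_of_real x"]
    by (simp add: sums_def_le scaleR_conv_of_real field_simps)
  then have "(\<lambda>N. J N + 2 * pi * (\<Sum>n\<le>N. (- complex_of_real x) ^ n / fact n)) \<longlonglongrightarrow> 0 + 2 * pi * exp (- complex_of_real x)"
    by (intro tendsto_intros J0)
  moreover have "J N + 2 * pi * (\<Sum>n\<le>N. (- complex_of_real x) ^ n / fact n) = 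
     (\<integral>y. Gamma (Complex c y) * of_real x powr (- Complex c y) \<partial>lborel)" for N
    using Gamma_mellin_partial[OF c x, of N] by (simp add: J_def algebra_simps)
  ultimately have "(\<lambda>N::nat. (\<integral>y. Gamma (Complex c y) * of_real x powr (- Complex c y) \<partial>lborel))
      \<longlonglongrightarrow> 0 + 2 * pi * exp (- complex_of_real x)"
    by (simp only:)
  from LIMSEQ_unique[OF tendsto_const this] show ?thesis by (simp flip: exp_of_real)
qed

section \<open>Theta series\<close>

text \<open>The factor \<open>lam (Suc n) ^ \<delta>\<close> is forced by the Gamma factor of the
  functional equation: with it the Mellin transform in w is Gamma(w) times the Dirichlet series at
  2w - \<delta>, for both parities. There is no pi in the exponent because the functional equation
  has no power of pi.\<close>

definition theta_series :: "nat \<Rightarrow> (nat \<Rightarrow> complex) \<Rightarrow> (nat \<Rightarrow> real) \<Rightarrow> complex \<Rightarrow> complex" where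
  "theta_series \<delta> a lam \<tau> =
     (\<Sum>n. a (Suc n) * of_real (lam (Suc n)) ^ \<delta> * exp (- of_real ((lam (Suc n))\<^sup>2) * \<tau>))"

lemma frequencies_pos: "frequencies lam \<Longrightarrow> lam (Suc n) > 0"
  by (simp add: frequencies_def)

lemma frequencies_Suc_at_top: "frequencies lam \<Longrightarrow> filterlim (\<lambda>n. lam (Suc n)) at_top sequentially"
  unfolding frequencies_def using filterlim_compose[OF _ filterlim_Suc] by blast

lemma frequencies_mono:
  assumes "frequencies lam" "m \<le> n" shows "lam (Suc m) \<le> lam (Suc n)"
proof (cases "m = n")
  case False
  then have "Suc m < Suc n" using assms(2) by simp
  moreover have "strict_mono_on {1..} lam" using assms(1) by (simp add: frequencies_def)
  ultimately have "lam (Suc m) < lam (Suc n)" by (auto simp: strict_mono_on_def)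
  then show ?thesis by simp
qed simp

text \<open>Frequencies may start below 1, so the comparison with a point of absolute convergence
  further left holds only for the tail, where \<open>lam (Suc n)\<close> is at least 1.\<close>

lemma summable_above_abscissa:
  assumes fr: "frequencies lam" and s: "ereal \<sigma> > abs_abscissa a lam"
  shows "summable (\<lambda>n. norm (a (Suc n)) * lam (Suc n) powr (- \<sigma>))"
proof -
  obtain w :: complex where w: "ereal (Re w) < ereal \<sigma>"
      "summable (\<lambda>n. norm (a (Suc n) * complex_of_real (lam (Suc n)) powr (- w)))"
    using s unfolding abs_abscissa_def Inf_less_iff by auto
  show ?thesis
  proof (rule summable_comparison_test_ev[OF _ w(2)])
    have "eventually (\<lambda>n. lam (Suc n) \<ge> 1) sequentially"
      using frequencies_Suc_at_top[OF fr] by (simp add: filterlim_at_top)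
    then show "\<forall>\<^sub>F n in sequentially. norm (norm (a (Suc n)) * lam (Suc n) powr (- \<sigma>))
         \<le> norm (a (Suc n) * complex_of_real (lam (Suc n)) powr (- w))"
    proof eventually_elim
      case (elim n)
      have "lam (Suc n) powr (- \<sigma>) \<le> lam (Suc n) powr (- Re w)"
        using elim w(1) by (intro powr_mono) auto
      then show ?case using elim
        by (simp add: norm_mult norm_powr_real_powr mult_left_mono)
    qed
  qed
qed

lemma ereal_above_finite: "x < \<infinity> \<Longrightarrow> \<exists>r::real. x < ereal r \<and> r > B"
proof (cases x)
  case (real r)
  then show ?thesis by (intro exI[of _ "max r B + 1"]) auto
next
  case MInf
  then show ?thesis by (intro exI[of _ "B + 1"]) auto
qed auto

text \<open>A Gaussian beats any power of the frequency, so the terms are eventually below those of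
  an absolutely convergent Dirichlet series. The exponent \<open>p\<close> is kept free because the
  theta series itself needs p = \<delta> and the later majorants need p = 0.\<close>

lemma theta_terms_summable:
  assumes fr: "frequencies lam" and fin: "abs_abscissa a lam < \<infinity>" and t: "t > 0"
  shows "summable (\<lambda>n. norm (a (Suc n)) * lam (Suc n) ^ p * exp (- (lam (Suc n))\<^sup>2 * t))"
proof -
  obtain \<sigma> where \<sigma>: "abs_abscissa a lam < ereal \<sigma>" using ereal_above_finite[OF fin] by blast
  have "((\<lambda>u. u powr (real p + \<sigma>) * exp (- u\<^sup>2 * t)) \<longlongrightarrow> 0) at_top"
    using t by real_asymp
  then have "eventually (\<lambda>u. u powr (real p + \<sigma>) * exp (- u\<^sup>2 * t) < 1) at_top"
    by (rule order_tendstoD) simp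
  then have "eventually (\<lambda>n. lam (Suc n) powr (real p + \<sigma>) * exp (- (lam (Suc n))\<^sup>2 * t) < 1) sequentially"
    using frequencies_Suc_at_top[OF fr] by (rule eventually_compose_filterlim)
  then have "\<forall>\<^sub>F n in sequentially. norm (norm (a (Suc n)) * lam (Suc n) ^ p * exp (- (lam (Suc n))\<^sup>2 * t))
      \<le> norm (a (Suc n)) * lam (Suc n) powr (- \<sigma>)"
  proof eventually_elim
    case (elim n)
    have pos: "lam (Suc n) > 0" using fr by (rule frequencies_pos)
    have "lam (Suc n) ^ p * exp (- (lam (Suc n))\<^sup>2 * t) 
        = (lam (Suc n) powr (real p + \<sigma>) * exp (- (lam (Suc n))\<^sup>2 * t)) * lam (Suc n) powr (- \<sigma>)"
      using pos by (simp add: powr_add powr_realpow powr_minus field_simps)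
    also have "\<dots> \<le> 1 * lam (Suc n) powr (- \<sigma>)" using elim by (intro mult_right_mono) auto
    finally have "lam (Suc n) ^ p * exp (- (lam (Suc n))\<^sup>2 * t) \<le> lam (Suc n) powr (- \<sigma>)" by simp
    from mult_left_mono[OF this norm_ge_zero[of "a (Suc n)"]] show ?case using pos by (simp add: mult.assoc)
  qed
  then show ?thesis by (rule summable_comparison_test_ev[OF _ summable_above_abscissa[OF fr \<sigma>]])
qed

lemma norm_theta_term:
  assumes "frequencies lam"
  shows "norm (a (Suc n) * of_real (lam (Suc n)) ^ \<delta> * exp (- of_real ((lam (Suc n))\<^sup>2) * \<tau>))
     = norm (a (Suc n)) * lam (Suc n) ^ \<delta> * exp (- (lam (Suc n))\<^sup>2 * Re \<tau>)"
  using frequencies_pos[OF assms, of n] by (simp add: norm_mult norm_power abs_of_pos)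

lemma theta_series_sums:
  assumes fr: "frequencies lam" and fin: "abs_abscissa a lam < \<infinity>" and t: "Re \<tau> > 0"
  shows "(\<lambda>n. a (Suc n) * of_real (lam (Suc n)) ^ \<delta> * exp (- of_real ((lam (Suc n))\<^sup>2) * \<tau>)) 
      sums theta_series \<delta> a lam \<tau>"
  unfolding theta_series_def
proof (rule summable_sums[OF summable_norm_cancel])
  have "norm (a (Suc n) * of_real (lam (Suc n)) ^ \<delta> * exp (- of_real ((lam (Suc n))\<^sup>2) * \<tau>))
     = norm (a (Suc n)) * lam (Suc n) ^ \<delta> * exp (- (lam (Suc n))\<^sup>2 * Re \<tau>)" for n
    by (rule norm_theta_term[OF fr])
  then show "summable (\<lambda>n. norm (a (Suc n) * of_real (lam (Suc n)) ^ \<delta> * exp (- of_real ((lam (Suc n))\<^sup>2) * \<tau>)))"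
    using theta_terms_summable[OF fr fin t, of \<delta>] by presburger
qed

lemma holomorphic_on_suminf:
  fixes f :: "nat \<Rightarrow> complex \<Rightarrow> complex"
  assumes S: "open S" and hol: "\<And>n. f n holomorphic_on S"
    and bnd: "\<And>z. z \<in> S \<Longrightarrow> \<exists>d M. d > 0 \<and> cball z d \<subseteq> S \<and> summable M \<and> (\<forall>n. \<forall>w\<in>cball z d. norm (f n w) \<le> M n)"
  shows "(\<lambda>z. \<Sum>n. f n z) holomorphic_on S"
proof (rule holomorphic_uniform_sequence[OF S])
  show "(\<lambda>z. \<Sum>i<n. f i z) holomorphic_on S" for n
    by (intro holomorphic_on_sum hol)
  fix z assume "z \<in> S"
  from bnd[OF this] obtain d M where dM: "d > 0" "cball z d \<subseteq> S" "summable M" "\<forall>n. \<forall>w\<in>cball z d. norm (f n w) \<le> M n"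
    by blast
  have "uniform_limit (cball z d) (\<lambda>n z. \<Sum>i<n. f i z) (\<lambda>z. \<Sum>n. f n z) sequentially"
    by (rule Weierstrass_m_test[OF _ dM(3)]) (use dM(4) in auto)
  with dM show "\<exists>d>0. cball z d \<subseteq> S \<and> uniform_limit (cball z d) (\<lambda>n z. \<Sum>i<n. f i z) (\<lambda>z. \<Sum>n. f n z) sequentially"
    by blast
qed

lemma theta_series_holomorphic:
  assumes fr: "frequencies lam" and fin: "abs_abscissa a lam < \<infinity>"
  shows "theta_series \<delta> a lam holomorphic_on {\<tau>. Re \<tau> > 0}"
  unfolding theta_series_def
proof (rule holomorphic_on_suminf)
  show "open {\<tau>. Re \<tau> > 0}" by (rule open_halfspace_Re_gt)
  fix z assume z: "z \<in> {\<tau>. Re \<tau> > 0}"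
  define d where "d = Re z / 2"
  have d: "d > 0" using z by (simp add: d_def)
  have re: "Re w \<ge> d" if "w \<in> cball z d" for w
    using that abs_Re_le_cmod[of "z - w"] by (auto simp: dist_norm d_def)
  show "\<exists>d M. 0 < d \<and> cball z d \<subseteq> {\<tau>. 0 < Re \<tau>} \<and> summable M \<and>
      (\<forall>n. \<forall>w\<in>cball z d. norm (a (Suc n) * of_real (lam (Suc n)) ^ \<delta> * exp (- of_real ((lam (Suc n))\<^sup>2) * w)) \<le> M n)"
  proof (intro exI conjI allI ballI)
    show "summable (\<lambda>n. norm (a (Suc n)) * lam (Suc n) ^ \<delta> * exp (- (lam (Suc n))\<^sup>2 * d))"
      by (rule theta_terms_summable[OF fr fin d])
    fix n w assume "w \<in> cball z d"
    then show "norm (a (Suc n) * of_real (lam (Suc n)) ^ \<delta> * exp (- of_real ((lam (Suc n))\<^sup>2) * w))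
       \<le> norm (a (Suc n)) * lam (Suc n) ^ \<delta> * exp (- (lam (Suc n))\<^sup>2 * d)"
      using frequencies_pos[OF fr, of n] re[of w]
      by (subst norm_theta_term[OF fr]) (intro mult_left_mono, auto intro!: mult_nonneg_nonneg)
  qed (use d re in force)+
qed (intro holomorphic_intros)

text \<open>The first nonvanishing term dominates uniformly on a vertical line far to the right.\<close>

lemma exponential_sum_bounded_below:
  fixes c :: "nat \<Rightarrow> complex" and \<omega> :: "nat \<Rightarrow> real"
  assumes om: "strict_mono \<omega>" and sm: "summable (\<lambda>n. norm (c n) * exp (- \<omega> n))" and nz: "c m \<noteq> 0"
  shows "\<exists>R \<epsilon>. R \<ge> 1 \<and> \<epsilon> > 0 \<and> (\<forall>\<tau>. Re \<tau> = R \<longrightarrow> norm (\<Sum>n. c n * exp (- of_real (\<omega> n) * \<tau>)) \<ge> \<epsilon>)"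
proof -
  define N where "N = (LEAST n. c n \<noteq> 0)"
  have N: "c N \<noteq> 0" "\<And>n. n < N \<Longrightarrow> c n = 0"
    unfolding N_def using LeastI[of "\<lambda>n. c n \<noteq> 0", OF nz] not_less_Least by auto
  define M where "M = (\<Sum>n. norm (c (n + Suc N)) * exp (- \<omega> (n + Suc N)))"
  have sm': "summable (\<lambda>n. norm (c (n + Suc N)) * exp (- \<omega> (n + Suc N)))"
    using sm by (subst summable_iff_shift)
  define D where "D = \<omega> (Suc N) - \<omega> N"
  have D: "D > 0" using om by (simp add: D_def strict_mono_def)
  have "((\<lambda>R. M * exp (\<omega> (Suc N)) * exp (- D * R)) \<longlongrightarrow> 0) at_top" using D by real_asymp
  then have "eventually (\<lambda>R. M * exp (\<omega> (Suc N)) * exp (- D * R) < norm (c N)) at_top"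
    by (rule order_tendstoD) (use N in auto)
  then have "eventually (\<lambda>R. M * exp (\<omega> (Suc N)) * exp (- D * R) < norm (c N) \<and> R \<ge> 1) at_top"
    using eventually_ge_at_top[of "1::real"] by eventually_elim auto
  then obtain R where R: "M * exp (\<omega> (Suc N)) * exp (- D * R) < norm (c N)" "R \<ge> 1"
    using eventually_happens'[OF trivial_limit_at_top_linorder] by blast
  define \<epsilon> where "\<epsilon> = exp (- \<omega> N * R) * (norm (c N) - M * exp (\<omega> (Suc N)) * exp (- D * R))"
  have \<epsilon>: "\<epsilon> > 0" unfolding \<epsilon>_def using R by simp
  have "norm (\<Sum>n. c n * exp (- of_real (\<omega> n) * \<tau>)) \<ge> \<epsilon>" if \<tau>: "Re \<tau> = R" for \<tau>
  proof -
    define f where "f = (\<lambda>n. c n * exp (- of_real (\<omega> n) * \<tau>))"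
    have nf: "norm (f n) = norm (c n) * exp (- \<omega> n * R)" for n
      using \<tau> by (simp add: f_def norm_mult)
    \<comment> \<open>The exponent R is split as (R - 1) + 1: the part R - 1 is estimated by the
      smallest remaining frequency, and the part 1 leaves the convergent majorant
      \<open>M\<close>.\<close>
    have fb: "norm (f (n + Suc N)) \<le> exp (- \<omega> (Suc N) * (R - 1)) * (norm (c (n + Suc N)) * exp (- \<omega> (n + Suc N)))" for n
    proof -
      have "\<omega> (Suc N) \<le> \<omega> (n + Suc N)" using om by (simp add: strict_mono_less_eq)
      then have "\<omega> (Suc N) * (R - 1) \<le> \<omega> (n + Suc N) * (R - 1)" using R(2) by (intro mult_right_mono) auto
      then have "exp (- \<omega> (n + Suc N) * R) \<le> exp (- \<omega> (Suc N) * (R - 1)) * exp (- \<omega> (n + Suc N))"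
        by (simp add: exp_add[symmetric] algebra_simps)
      from mult_left_mono[OF this norm_ge_zero[of "c (n + Suc N)"]] show ?thesis
        unfolding nf by (simp only: mult_ac)
    qed
    have sf': "summable (\<lambda>n. norm (f (n + Suc N)))"
      by (rule summable_comparison_test'[OF summable_mult[OF sm'], of 0]) (use fb in auto)
    then have sf: "summable f" using summable_iff_shift[of f "Suc N"] summable_norm_cancel[OF sf'] by simp
    have "(\<Sum>n. f n) = (\<Sum>n. f (n + Suc N)) + (\<Sum>n<Suc N. f n)"
      by (rule suminf_split_initial_segment[OF sf])
    also have "(\<Sum>n<Suc N. f n) = f N" using N(2) by (simp add: f_def)
    finally have e: "(\<Sum>n. f n) = (\<Sum>n. f (n + Suc N)) + f N" .
    have "norm (\<Sum>n. f (n + Suc N)) \<le> (\<Sum>n. norm (f (n + Suc N)))" by (rule summable_norm[OF sf'])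
    also have "\<dots> \<le> (\<Sum>n. exp (- \<omega> (Suc N) * (R - 1)) * (norm (c (n + Suc N)) * exp (- \<omega> (n + Suc N))))"
      by (intro suminf_le fb sf' summable_mult sm')
    also have "\<dots> = exp (- \<omega> (Suc N) * (R - 1)) * M" unfolding M_def by (rule suminf_mult[OF sm'])
    also have "\<dots> = exp (- \<omega> N * R) * (M * exp (\<omega> (Suc N)) * exp (- D * R))"
      by (simp add: D_def exp_add[symmetric] algebra_simps)
    finally have t: "norm (\<Sum>n. f (n + Suc N)) \<le> exp (- \<omega> N * R) * (M * exp (\<omega> (Suc N)) * exp (- D * R))" .
    have "norm (f N) - norm (\<Sum>n. f (n + Suc N)) \<le> norm (\<Sum>n. f n)"
      unfolding e using norm_diff_ineq[of "f N" "\<Sum>n. f (n + Suc N)"] by (simp add: add.commute)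
    then have "\<epsilon> \<le> norm (\<Sum>n. f n)" using t nf[of N] by (simp add: \<epsilon>_def algebra_simps)
    then show ?thesis by (simp add: f_def)
  qed
  with R(2) \<epsilon> show ?thesis by (intro exI[of _ R] exI[of _ \<epsilon>]) simp
qed

text \<open>The constant is treated as a term of frequency 0 in front of the series, so the case
  where it vanishes and the case where it dominates are covered by the same estimate.\<close>

lemma theta_plus_constant_bounded_below:
  assumes fr: "frequencies lam" and fin: "abs_abscissa a lam < \<infinity>" and nz: "n \<ge> 1" "a n \<noteq> 0"
  shows "\<exists>R \<epsilon>. R \<ge> 1 \<and> \<epsilon> > 0 \<and> (\<forall>\<tau>. Re \<tau> = R \<longrightarrow> norm (theta_series \<delta> a lam \<tau> + C) \<ge> \<epsilon>)"
proof -
  define c where "c = (\<lambda>n. if n = 0 then C else a n * of_real (lam n) ^ \<delta>)"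
  define \<omega> where "\<omega> = (\<lambda>n. if n = 0 then 0 else (lam n)\<^sup>2)"
  have om: "strict_mono \<omega>"
  proof (rule strict_mono_Suc_iff[THEN iffD2], rule allI)
    fix n
    show "\<omega> n < \<omega> (Suc n)"
    proof (cases n)
      case 0 then show ?thesis using frequencies_pos[OF fr, of 0] by (simp add: \<omega>_def)
    next
      case (Suc m)
      have "strict_mono_on {1..} lam" using fr by (simp add: frequencies_def)
      then have "lam (Suc m) < lam (Suc (Suc m))" by (auto simp: strict_mono_on_def)
      then show ?thesis using frequencies_pos[OF fr, of m] Suc by (simp add: \<omega>_def power_strict_mono)
    qed
  qed
  have "summable (\<lambda>n. norm (c (Suc n)) * exp (- \<omega> (Suc n)))"
    using theta_terms_summable[OF fr fin zero_less_one, of \<delta>] frequencies_pos[OF fr]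
    by (simp add: c_def \<omega>_def norm_mult norm_power abs_of_pos)
  then have sm: "summable (\<lambda>n. norm (c n) * exp (- \<omega> n))" by (subst (asm) summable_Suc_iff)
  have cn: "c n \<noteq> 0" using nz frequencies_pos[OF fr, of "n - 1"] by (auto simp: c_def)
  obtain R \<epsilon> where R: "R \<ge> 1" "\<epsilon> > 0" "\<And>\<tau>. Re \<tau> = R \<Longrightarrow> norm (\<Sum>n. c n * exp (- of_real (\<omega> n) * \<tau>)) \<ge> \<epsilon>"
    using exponential_sum_bounded_below[where c=c and \<omega>=\<omega>, OF om sm cn] by blast
  have "(\<Sum>n. c n * exp (- of_real (\<omega> n) * \<tau>)) = theta_series \<delta> a lam \<tau> + C" if "Re \<tau> = R" for \<tau>
  proof -
    have t: "Re \<tau> > 0" using that R by simp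
    have "(\<lambda>n. c (Suc n) * exp (- of_real (\<omega> (Suc n)) * \<tau>)) sums theta_series \<delta> a lam \<tau>"
      using theta_series_sums[OF fr fin t, of \<delta>] by (simp add: c_def \<omega>_def)
    then have "(\<lambda>n. c n * exp (- of_real (\<omega> n) * \<tau>)) sums (theta_series \<delta> a lam \<tau> + c 0 * exp (- of_real (\<omega> 0) * \<tau>))"
      by (subst (asm) sums_Suc_iff) simp
    then show ?thesis by (simp add: sums_iff c_def \<omega>_def)
  qed
  with R show ?thesis by (intro exI[of _ R] exI[of _ \<epsilon>]) simp
qed

text \<open>Each term is the Mellin inversion of the exponential at lam^2 t. The interchange with
  the sum is free, since on Re w = C the terms have a norm that splits into an integrable function
  of y and the terms of the absolutely convergent series at 2C - \<delta>.\<close>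

lemma theta_series_mellin:
  fixes C t :: real
  assumes fr: "frequencies lam" and C: "C > 0" "ereal (2 * C - \<delta>) > abs_abscissa a lam" and t: "t > 0"
  shows "integrable lborel (\<lambda>y. Gamma (Complex C y) * dirichlet_series a lam (2 * Complex C y - \<delta>) * of_real t powr (- Complex C y))"
    and "(\<integral>y. Gamma (Complex C y) * dirichlet_series a lam (2 * Complex C y - \<delta>) * of_real t powr (- Complex C y) \<partial>lborel)
      = 2 * pi * theta_series \<delta> a lam (of_real t)"
proof -
  define F where "F = (\<lambda>n y. a (Suc n) * of_real (lam (Suc n)) ^ \<delta> *
       (Gamma (Complex C y) * of_real ((lam (Suc n))\<^sup>2 * t) powr (- Complex C y)))"
  define G where "G = (\<integral>y. norm (Gamma (Complex C y)) \<partial>lborel)"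
  have CC: "complex_of_real C \<notin> \<int>\<^sub>\<le>\<^sub>0" using C by (auto elim!: nonpos_Ints_cases' simp: complex_eq_iff)
  have pos: "lam (Suc n) > 0" for n using fr by (rule frequencies_pos)
  have sq: "of_real ((lam (Suc n))\<^sup>2 * t) powr (- w) = of_real (lam (Suc n)) powr (- (2 * w)) * complex_of_real t powr (- w)" for n w
  proof -
    have "complex_of_real ((lam (Suc n))\<^sup>2 * t) powr (- w) = of_real ((lam (Suc n))\<^sup>2) powr (- w) * of_real t powr (- w)"
      using t pos[of n] by (simp only: of_real_mult, subst powr_times_real) auto
    also have "complex_of_real ((lam (Suc n))\<^sup>2) powr (- w) = of_real (lam (Suc n)) powr (- (2 * w))"
      using powr_of_real_square[OF pos[of n], of "- w"] by simp
    finally show ?thesis .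
  qed
  have dt: "of_real (lam (Suc n)) ^ \<delta> * complex_of_real (lam (Suc n)) powr (- (2 * w)) = of_real (lam (Suc n)) powr (- (2 * w - \<delta>))" for n w
  proof -
    have "complex_of_real (lam (Suc n)) powr (- (2 * w - \<delta>)) = of_real (lam (Suc n)) powr (of_nat \<delta> + - (2 * w))" by simp
    also have "\<dots> = complex_of_real (lam (Suc n)) powr of_nat \<delta> * of_real (lam (Suc n)) powr (- (2 * w))"
      by (rule powr_add)
    also have "complex_of_real (lam (Suc n)) powr of_nat \<delta> = of_real (lam (Suc n)) ^ \<delta>"
      using pos[of n] by (simp add: powr_nat')
    finally show ?thesis by simp
  qed
  have F_eq: "F n y = Gamma (Complex C y) * of_real t powr (- Complex C y) *
      (a (Suc n) * of_real (lam (Suc n)) powr (- (2 * Complex C y - \<delta>)))" for n y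
    unfolding F_def sq dt[symmetric] by (simp only: mult_ac)
  have nF: "norm (F n y) = (norm (a (Suc n)) * lam (Suc n) powr (- (2 * C - \<delta>))) * (t powr (- C) * norm (Gamma (Complex C y)))" for n y
    unfolding F_eq using t pos[of n] by (simp add: norm_mult norm_powr_real_powr mult_ac)
  have sm: "summable (\<lambda>n. norm (a (Suc n)) * lam (Suc n) powr (- (2 * C - \<delta>)))"
    by (rule summable_above_abscissa[OF fr C(2)])
  have intF: "integrable lborel (F n)" for n
    unfolding F_def using t pos[of n] by (intro integrable_mult_right Gamma_mellin_integrable CC) auto
  have sF: "AE y in lborel. summable (\<lambda>n. norm (F n y))"
    unfolding nF by (intro AE_I2 summable_mult2 sm)
  have sIF: "summable (\<lambda>n. \<integral>y. norm (F n y) \<partial>lborel)"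
    unfolding nF integral_mult_right_zero by (intro summable_mult2 sm)
  have sumF: "(\<Sum>n. F n y) = Gamma (Complex C y) * dirichlet_series a lam (2 * Complex C y - \<delta>) * of_real t powr (- Complex C y)" for y
  proof -
    have "summable (\<lambda>n. norm (a (Suc n) * of_real (lam (Suc n)) powr (- (2 * Complex C y - \<delta>))))"
      using sm by (simp add: norm_mult norm_powr_real_powr less_imp_le[OF pos])
    then have "summable (\<lambda>n. a (Suc n) * of_real (lam (Suc n)) powr (- (2 * Complex C y - \<delta>)))"
      by (rule summable_norm_cancel)
    from suminf_mult[OF this, of "Gamma (Complex C y) * of_real t powr (- Complex C y)"] show ?thesis
      unfolding F_eq dirichlet_series_def by (simp only: mult_ac)
  qed
  show "integrable lborel (\<lambda>y. Gamma (Complex C y) * dirichlet_series a lam (2 * Complex C y - \<delta>) * of_real t powr (- Complex C y))"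
    using integrable_suminf[OF intF sF sIF] unfolding sumF .
  have IF: "integral\<^sup>L lborel (F n) = 2 * pi * (a (Suc n) * of_real (lam (Suc n)) ^ \<delta> * exp (- of_real ((lam (Suc n))\<^sup>2) * of_real t))" for n
  proof -
    have "integral\<^sup>L lborel (F n) = a (Suc n) * of_real (lam (Suc n)) ^ \<delta> * (2 * pi * of_real (exp (- ((lam (Suc n))\<^sup>2 * t))))"
      unfolding F_def using t pos[of n] C(1) by (subst integral_mult_right_zero, subst Gamma_mellin_inversion) auto
    then show ?thesis by (simp add: exp_of_real[symmetric] mult_ac)
  qed
  have "(\<lambda>n. integral\<^sup>L lborel (F n)) sums (\<integral>y. (\<Sum>n. F n y) \<partial>lborel)"
    by (rule sums_integral[OF intF sF sIF])
  moreover have "(\<lambda>n. integral\<^sup>L lborel (F n)) sums (2 * pi * theta_series \<delta> a lam (of_real t))"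
    unfolding IF using C t by (intro sums_mult theta_series_sums[OF fr]) auto
  ultimately show "(\<integral>y. Gamma (Complex C y) * dirichlet_series a lam (2 * Complex C y - \<delta>) * of_real t powr (- Complex C y) \<partial>lborel)
      = 2 * pi * theta_series \<delta> a lam (of_real t)"
    unfolding sumF using sums_unique2 by blast
qed

section \<open>The functional equation\<close>

text \<open>
  In the variable w = (s + \<open>\<delta>\<close>)/2 the Gamma factor is Gamma(w) and the reflection s to 1 - s becomes
  w to 1/2 + \<open>\<delta>\<close> - w. The two branches avoid the junk value 0 of Gamma at its poles.
\<close>

definition completed :: "nat \<Rightarrow> (complex \<Rightarrow> complex) \<Rightarrow> (complex \<Rightarrow> complex) \<Rightarrow> complex \<Rightarrow> complex" where
  "completed \<delta> \<phi> \<psi> w = (if Re w > 1/4 + \<delta>/2 then Gamma w * \<phi> (2 * w - of_nat \<delta>)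
     else Gamma (1/2 + of_nat \<delta> - w) * \<psi> (1 + of_nat \<delta> - 2 * w))"

text \<open>In the variable s these are, for even parity, the possible pole of \<phi>(s) at 1 and
  that of \<psi>(1 - s) at 0; for odd parity both functions are entire.\<close>

definition exceptional_points :: "nat \<Rightarrow> complex set" where
  "exceptional_points \<delta> = (if \<delta> = 0 then {0, 1} else {})"

lemma finite_exceptional_points [simp]: "finite (exceptional_points \<delta>)"
  by (simp add: exceptional_points_def)

lemma class_B_holomorphic:
  assumes "class_B \<delta> a lam b mu \<phi> \<psi>"
  shows "\<phi> holomorphic_on - exceptional_points \<delta>"
    and "(\<lambda>s. \<psi> (1 - s)) holomorphic_on - exceptional_points \<delta>"
proof -
  have *: "f holomorphic_on - exceptional_points \<delta> \<and> (\<lambda>s. f (1 - s)) holomorphic_on - exceptional_points \<delta>"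
    if "(if \<delta> = 0 then entire_but_simple_pole_at_1 f else f holomorphic_on UNIV)" for f
  proof -
    define Q :: "complex set" where "Q = (if \<delta> = 0 then {1} else {})"
    have hol: "f holomorphic_on - Q"
      using that by (auto simp: Q_def entire_but_simple_pole_at_1_def intro: holomorphic_on_subset split: if_splits)
    have "(f \<circ> (\<lambda>s. 1 - s)) holomorphic_on - exceptional_points \<delta>"
      by (intro holomorphic_on_compose_gen[OF _ hol] holomorphic_intros)
        (auto simp: Q_def exceptional_points_def)
    moreover have "f holomorphic_on - exceptional_points \<delta>"
      by (rule holomorphic_on_subset[OF hol]) (auto simp: Q_def exceptional_points_def)
    ultimately show ?thesis by (simp add: o_def)
  qed
  show "\<phi> holomorphic_on - exceptional_points \<delta>"
    and "(\<lambda>s. \<psi> (1 - s)) holomorphic_on - exceptional_points \<delta>"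
    using assms *[of \<phi>] *[of \<psi>] by (auto simp: class_B_def split: if_splits)
qed

text \<open>The Bochner pair fixes X only in two half-planes and away from Gamma poles. Multiplying
  by the entire function \<open>rGamma\<close> gives identities without exceptions there, and these
  continue to the whole set where X is analytic, which is connected because only a sparse set is
  removed from the plane. Eliminating X yields the third identity, which then extends across the
  compact set of singularities as well.\<close>

lemma class_B_completion:
  assumes B: "class_B \<delta> a lam b mu \<phi> \<psi>"
  obtains X K where "compact K"
    "\<And>s. s \<notin> K \<Longrightarrow> s \<notin> exceptional_points \<delta> \<Longrightarrow> X s * rGamma ((s + of_nat \<delta>) / 2) = \<phi> s"
    "\<And>s. s \<notin> K \<Longrightarrow> s \<notin> exceptional_points \<delta> \<Longrightarrow> X s * rGamma ((1 - s + of_nat \<delta>) / 2) = \<psi> (1 - s)"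
    "\<And>s. s \<notin> exceptional_points \<delta> \<Longrightarrow> \<phi> s * rGamma ((1 - s + of_nat \<delta>) / 2) = \<psi> (1 - s) * rGamma ((s + of_nat \<delta>) / 2)"
    "\<And>\<sigma>1 \<sigma>2 \<epsilon>. \<epsilon> > 0 \<Longrightarrow> \<exists>T. \<forall>s. \<sigma>1 \<le> Re s \<and> Re s \<le> \<sigma>2 \<and> \<bar>Im s\<bar> \<ge> T \<longrightarrow> norm (X s) < \<epsilon>"
proof -
  have bp: "bochner_pair \<delta> a lam b mu" and c\<phi>: "continues_series \<phi> a lam" and c\<psi>: "continues_series \<psi> b mu"
    using B by (auto simp: class_B_def)
  obtain X K where mer: "X meromorphic_on UNIV"
    and X1: "\<And>s. ereal (Re s) > abs_abscissa a lam \<Longrightarrow> (s + of_nat \<delta>) / 2 \<notin> \<int>\<^sub>\<le>\<^sub>0 \<Longrightarrow>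
             X s = Gamma ((s + of_nat \<delta>) / 2) * dirichlet_series a lam s"
    and X2: "\<And>s. ereal (Re s) < 1 - abs_abscissa b mu \<Longrightarrow> (1 - s + of_nat \<delta>) / 2 \<notin> \<int>\<^sub>\<le>\<^sub>0 \<Longrightarrow>
             X s = Gamma ((1 - s + of_nat \<delta>) / 2) * dirichlet_series b mu (1 - s)"
    and dec: "\<And>\<sigma>1 \<sigma>2 \<epsilon>. \<epsilon> > 0 \<Longrightarrow> \<exists>T. \<forall>s. \<sigma>1 \<le> Re s \<and> Re s \<le> \<sigma>2 \<and> \<bar>Im s\<bar> \<ge> T \<longrightarrow> norm (X s) < \<epsilon>"
    and K: "compact K" "X holomorphic_on - K"
    using bp unfolding bochner_pair_def by blast
  have fina: "\<bar>abs_abscissa a lam\<bar> \<noteq> \<infinity>" and finb: "\<bar>abs_abscissa b mu\<bar> \<noteq> \<infinity>"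
    using bp by (auto simp: bochner_pair_def)
  \<comment> \<open>This set also contains removable singularities at which X happens to have a
    wrong value, since meromorphy does not control values at isolated points.\<close>
  define pts where "pts = {z. \<not> X analytic_on {z}}"
  define S where "S = UNIV - (pts \<union> exceptional_points \<delta>)"
  have sp: "pts \<union> exceptional_points \<delta> sparse_in UNIV"
    unfolding pts_def by (intro sparse_in_union' meromorphic_on_imp_sparse_singularities[OF mer] finite_imp_sparse) auto
  have oS: "open S" unfolding S_def by (rule open_diff_sparse_pts[OF _ sp]) auto
  have cS: "connected S" unfolding S_def by (rule sparse_imp_connected[OF _ _ _ sp]) auto
  have Xhol: "X holomorphic_on S"
    by (rule analytic_imp_holomorphic, subst analytic_on_analytic_at) (auto simp: S_def pts_def)
  have ptsK: "s \<in> S" if "s \<notin> K" "s \<notin> exceptional_points \<delta>" for s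
  proof -
    have "X analytic_on - K" using K compact_imp_closed by (subst analytic_on_open) auto
    then have "X analytic_on {s}" using that by (elim analytic_on_subset) auto
    then show ?thesis using that by (auto simp: S_def pts_def)
  qed
  have ne: "U \<inter> S \<noteq> {}" if U: "open U" "U \<noteq> {}" for U
  proof -
    obtain z where z: "z \<in> U" using U by blast
    have "eventually (\<lambda>w. w \<notin> pts \<union> exceptional_points \<delta>) (at z)"
      using sp by (simp add: sparse_in_eventually_iff eventually_cosparse_imp_eventually_at)
    moreover have "eventually (\<lambda>w. w \<in> U) (at z)" using U z by (rule_tac eventually_at_in_open') auto
    ultimately have "eventually (\<lambda>w. w \<in> U \<inter> S) (at z)" by eventually_elim (auto simp: S_def)
    then show ?thesis using eventually_happens by fastforce
  qed
  obtain ra where ra: "abs_abscissa a lam = ereal ra" using fina by auto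
  obtain rb where rb: "abs_abscissa b mu = ereal rb" using finb by auto
  \<comment> \<open>The starting half-plane is cut at max(ra, 0) so that the Dirichlet series
    converges and the Gamma argument has positive real part, away from the poles.\<close>
  have E1: "X s * rGamma ((s + of_nat \<delta>) / 2) = \<phi> s" if "s \<in> S" for s
  proof (rule analytic_continuation_open[where s = "{z. Re z > max ra 0} \<inter> S" and s' = S
        and f = "\<lambda>s. X s * rGamma ((s + of_nat \<delta>) / 2)" and g = \<phi>])
    show "open ({z. Re z > max ra 0} \<inter> S)" by (intro open_Int oS open_halfspace_Re_gt)
    have "{z. Re z > max ra 0} \<noteq> {}" by (auto intro: exI[of _ "of_real (max ra 0 + 1)"])
    then show "{z. Re z > max ra 0} \<inter> S \<noteq> {}" by (intro ne open_halfspace_Re_gt)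
    show "(\<lambda>s. X s * rGamma ((s + of_nat \<delta>) / 2)) holomorphic_on S"
      by (auto intro!: holomorphic_intros Xhol)
    show "\<phi> holomorphic_on S"
      by (rule holomorphic_on_subset[OF class_B_holomorphic(1)[OF B]]) (auto simp: S_def)
    fix z assume z: "z \<in> {z. Re z > max ra 0} \<inter> S"
    have np: "(z + of_nat \<delta>) / 2 \<notin> \<int>\<^sub>\<le>\<^sub>0"
    proof
      assume "(z + of_nat \<delta>) / 2 \<in> \<int>\<^sub>\<le>\<^sub>0"
      then obtain n where "(z + of_nat \<delta>) / 2 = - of_nat n" by (auto elim: nonpos_Ints_cases')
      then have "Re ((z + of_nat \<delta>) / 2) = - real n" by simp
      then show False using z by (simp)
    qed
    have "X z = Gamma ((z + of_nat \<delta>) / 2) * \<phi> z"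
      using X1[of z] np z c\<phi> ra by (simp add: continues_series_def)
    then show "X z * rGamma ((z + of_nat \<delta>) / 2) = \<phi> z"
      using np by (simp add: Gamma_def rGamma_eq_zero_iff)
  qed (use oS cS that in auto)
  have E2: "X s * rGamma ((1 - s + of_nat \<delta>) / 2) = \<psi> (1 - s)" if "s \<in> S" for s
  proof (rule analytic_continuation_open[where s = "{z. Re z < min (1 - rb) 1} \<inter> S" and s' = S
        and f = "\<lambda>s. X s * rGamma ((1 - s + of_nat \<delta>) / 2)" and g = "\<lambda>s. \<psi> (1 - s)"])
    show "open ({z. Re z < min (1 - rb) 1} \<inter> S)" by (intro open_Int oS open_halfspace_Re_lt)
    have "{z. Re z < min (1 - rb) 1} \<noteq> {}" by (auto intro: exI[of _ "of_real (min (1 - rb) 1 - 1)"])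
    then show "{z. Re z < min (1 - rb) 1} \<inter> S \<noteq> {}" by (intro ne open_halfspace_Re_lt)
    show "(\<lambda>s. X s * rGamma ((1 - s + of_nat \<delta>) / 2)) holomorphic_on S"
      by (auto intro!: holomorphic_intros Xhol)
    show "(\<lambda>s. \<psi> (1 - s)) holomorphic_on S"
      by (rule holomorphic_on_subset[OF class_B_holomorphic(2)[OF B]]) (auto simp: S_def)
    fix z assume z: "z \<in> {z. Re z < min (1 - rb) 1} \<inter> S"
    have np: "(1 - z + of_nat \<delta>) / 2 \<notin> \<int>\<^sub>\<le>\<^sub>0"
    proof
      assume "(1 - z + of_nat \<delta>) / 2 \<in> \<int>\<^sub>\<le>\<^sub>0"
      then obtain n where "(1 - z + of_nat \<delta>) / 2 = - of_nat n" by (auto elim: nonpos_Ints_cases')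
      then have "Re ((1 - z + of_nat \<delta>) / 2) = - real n" by simp
      then show False using z by (simp)
    qed
    have "X z = Gamma ((1 - z + of_nat \<delta>) / 2) * \<psi> (1 - z)"
      using X2[of z] np z c\<psi> rb by (simp add: continues_series_def one_ereal_def)
    then show "X z * rGamma ((1 - z + of_nat \<delta>) / 2) = \<psi> (1 - z)"
      using np by (simp add: Gamma_def rGamma_eq_zero_iff)
  qed (use oS cS that in auto)
  \<comment> \<open>X has disappeared from this identity, so it continues from \<open>S\<close> to
    everything except the poles of \<phi>(s) and \<psi>(1 - s).\<close>
  have E3: "\<phi> s * rGamma ((1 - s + of_nat \<delta>) / 2) = \<psi> (1 - s) * rGamma ((s + of_nat \<delta>) / 2)" 
    if "s \<notin> exceptional_points \<delta>" for s
  proof (rule analytic_continuation_open[where s = S and s' = "- exceptional_points \<delta>"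
        and f = "\<lambda>s. \<phi> s * rGamma ((1 - s + of_nat \<delta>) / 2)"
        and g = "\<lambda>s. \<psi> (1 - s) * rGamma ((s + of_nat \<delta>) / 2)"])
    show "S \<noteq> {}" using ne[of UNIV] by auto
    show "open (- exceptional_points \<delta>)" by (simp add: finite_imp_closed open_Compl)
    show "connected (- exceptional_points \<delta>)"
      unfolding Compl_eq_Diff_UNIV by (rule connected_open_delete_finite) auto
    show "(\<lambda>s. \<phi> s * rGamma ((1 - s + of_nat \<delta>) / 2)) holomorphic_on - exceptional_points \<delta>"
      "(\<lambda>s. \<psi> (1 - s) * rGamma ((s + of_nat \<delta>) / 2)) holomorphic_on - exceptional_points \<delta>"
      by (auto intro!: holomorphic_intros class_B_holomorphic[OF B])
    fix z assume "z \<in> S"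
    then show "\<phi> z * rGamma ((1 - z + of_nat \<delta>) / 2) = \<psi> (1 - z) * rGamma ((z + of_nat \<delta>) / 2)"
      using E1[of z] E2[of z] by (metis mult.commute mult.left_commute)
  qed (use oS that in \<open>auto simp: S_def\<close>)
  show thesis
    by (rule that[of K X]) (use K E1 E2 E3 dec ptsK in auto)
qed

lemma mult_Gamma_of_mult_rGamma:
  assumes "x * rGamma w = y" "w \<notin> \<int>\<^sub>\<le>\<^sub>0"
  shows "x = Gamma w * (y :: complex)"
  using assms by (auto simp: Gamma_def rGamma_eq_zero_iff)

lemma notin_nonpos_Ints_Re: "Re w > 0 \<Longrightarrow> w \<notin> \<int>\<^sub>\<le>\<^sub>0"
  by (auto elim!: nonpos_Ints_cases')

lemma notin_nonpos_Ints_Im: "Im w \<noteq> 0 \<Longrightarrow> w \<notin> \<int>\<^sub>\<le>\<^sub>0"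
  by (auto elim!: nonpos_Ints_cases')

lemma class_B_reflection:
  assumes B: "class_B \<delta> a lam b mu \<phi> \<psi>" and ex: "2 * w - of_nat \<delta> \<notin> exceptional_points \<delta>"
    and w: "w \<notin> \<int>\<^sub>\<le>\<^sub>0" "1/2 + of_nat \<delta> - w \<notin> \<int>\<^sub>\<le>\<^sub>0"
  shows "Gamma w * \<phi> (2 * w - of_nat \<delta>) = Gamma (1/2 + of_nat \<delta> - w) * \<psi> (1 + of_nat \<delta> - 2 * w)"
proof -
  from B obtain X K where "\<And>s. s \<notin> exceptional_points \<delta> \<Longrightarrow> 
      \<phi> s * rGamma ((1 - s + of_nat \<delta>) / 2) = \<psi> (1 - s) * rGamma ((s + of_nat \<delta>) / 2)"
    by (rule class_B_completion) blast
  from this[OF ex] have "\<phi> (2 * w - of_nat \<delta>) * rGamma (1/2 + of_nat \<delta> - w) = \<psi> (1 + of_nat \<delta> - 2 * w) * rGamma w"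
    by (simp add: field_simps)
  then show ?thesis using w by (auto simp: Gamma_def rGamma_eq_zero_iff field_simps)
qed

lemma completed_eq:
  assumes B: "class_B \<delta> a lam b mu \<phi> \<psi>" and ex: "2 * w - of_nat \<delta> \<notin> exceptional_points \<delta>"
    and w: "w \<notin> \<int>\<^sub>\<le>\<^sub>0" "1/2 + of_nat \<delta> - w \<notin> \<int>\<^sub>\<le>\<^sub>0"
  shows "completed \<delta> \<phi> \<psi> w = Gamma w * \<phi> (2 * w - of_nat \<delta>)"
    and "completed \<delta> \<phi> \<psi> w = Gamma (1/2 + of_nat \<delta> - w) * \<psi> (1 + of_nat \<delta> - 2 * w)"
  using class_B_reflection[OF assms] by (auto simp: completed_def)

text \<open>The branches are cut along the fixed line Re w = 1/4 + \<delta>/2 of the reflection.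
  Each is holomorphic off the exceptional points even 1/8 beyond the cut, because its Gamma argument
  still has positive real part there, and the reflection formula makes them agree on the overlap.
  Hence the cut leaves no discontinuity.\<close>

lemma completed_holomorphic:
  assumes B: "class_B \<delta> a lam b mu \<phi> \<psi>"
  shows "completed \<delta> \<phi> \<psi> holomorphic_on {w. 2 * w - of_nat \<delta> \<notin> exceptional_points \<delta>}"
proof -
  define E where "E = {w. 2 * w - complex_of_nat \<delta> \<notin> exceptional_points \<delta>}"
  define U1 where "U1 = {w. Re w > 1/8 + \<delta>/2} \<inter> E"
  define U2 where "U2 = {w. Re w < 3/8 + \<delta>/2} \<inter> E"
  have "open ((\<lambda>w. 2 * w - complex_of_nat \<delta>) -` (- exceptional_points \<delta>))"
    by (intro open_vimage continuous_intros) (simp add: finite_imp_closed open_Compl)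
  then have oE: "open E" by (simp add: E_def vimage_def)
  have o: "open U1" "open U2" unfolding U1_def U2_def
    by (intro open_Int oE open_halfspace_Re_gt open_halfspace_Re_lt)+
  have E12: "E = U1 \<union> U2" by (auto simp: U1_def U2_def)
  have h1: "(\<lambda>w. \<phi> (2 * w - of_nat \<delta>)) holomorphic_on E"
    by (rule holomorphic_on_compose_gen[OF _ class_B_holomorphic(1)[OF B], unfolded o_def])
      (auto intro!: holomorphic_intros simp: E_def)
  have "(\<lambda>w. \<psi> (1 - (2 * w - of_nat \<delta>))) holomorphic_on E"
    by (rule holomorphic_on_compose_gen[OF _ class_B_holomorphic(2)[OF B], unfolded o_def])
      (auto intro!: holomorphic_intros simp: E_def)
  then have h2: "(\<lambda>w. \<psi> (1 + of_nat \<delta> - 2 * w)) holomorphic_on E" by (simp add: algebra_simps)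
  have "(\<lambda>w. Gamma w * \<phi> (2 * w - of_nat \<delta>)) holomorphic_on U1"
    using notin_nonpos_Ints_Re by (intro holomorphic_intros holomorphic_on_subset[OF h1]) (auto simp: U1_def)
  then have "completed \<delta> \<phi> \<psi> holomorphic_on U1"
  proof (rule holomorphic_transform)
    fix w assume w: "w \<in> U1"
    show "Gamma w * \<phi> (2 * w - of_nat \<delta>) = completed \<delta> \<phi> \<psi> w"
    proof (cases "Re w > 1/4 + \<delta>/2")
      case False
      then show ?thesis using w
        by (intro completed_eq(1)[OF B, symmetric] notin_nonpos_Ints_Re) (auto simp: U1_def E_def)
    qed (simp add: completed_def)
  qed
  moreover have "(\<lambda>w. Gamma (1/2 + of_nat \<delta> - w) * \<psi> (1 + of_nat \<delta> - 2 * w)) holomorphic_on U2"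
  proof (intro holomorphic_intros holomorphic_on_subset[OF h2])
    fix w assume "w \<in> U2"
    then show "1/2 + of_nat \<delta> - w \<notin> \<int>\<^sub>\<le>\<^sub>0" by (intro notin_nonpos_Ints_Re) (auto simp: U2_def)
  qed (auto simp: U2_def)
  then have "completed \<delta> \<phi> \<psi> holomorphic_on U2"
  proof (rule holomorphic_transform)
    fix w assume w: "w \<in> U2"
    show "Gamma (1/2 + of_nat \<delta> - w) * \<psi> (1 + of_nat \<delta> - 2 * w) = completed \<delta> \<phi> \<psi> w"
    proof (cases "Re w > 1/4 + \<delta>/2")
      case True
      then have "0 < real \<delta> + Re w" by linarith
      then show ?thesis using w True
        by (intro completed_eq(2)[OF B, symmetric] notin_nonpos_Ints_Re) (auto simp: U2_def E_def)
    qed (simp add: completed_def)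
  qed
  ultimately have "completed \<delta> \<phi> \<psi> holomorphic_on E"
    unfolding E12 using o by (intro holomorphic_on_Un)
  then show ?thesis by (simp add: E_def)
qed

text \<open>At large height the point s = 2w - \<delta> has left the compact set of singularities
  and the real axis, so X(s) can be solved for and equals the completed function; the decay is then
  inherited.\<close>

lemma completed_decay:
  assumes B: "class_B \<delta> a lam b mu \<phi> \<psi>" and e: "\<epsilon> > 0"
  shows "\<exists>T. \<forall>w. c1 \<le> Re w \<and> Re w \<le> c2 \<and> \<bar>Im w\<bar> \<ge> T \<longrightarrow> norm (completed \<delta> \<phi> \<psi> w) < \<epsilon>"
proof -
  from B obtain X K where K: "compact K"
    and X1: "\<And>s. s \<notin> K \<Longrightarrow> s \<notin> exceptional_points \<delta> \<Longrightarrow> X s * rGamma ((s + of_nat \<delta>) / 2) = \<phi> s"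
    and X2: "\<And>s. s \<notin> K \<Longrightarrow> s \<notin> exceptional_points \<delta> \<Longrightarrow> X s * rGamma ((1 - s + of_nat \<delta>) / 2) = \<psi> (1 - s)"
    and dec: "\<And>\<sigma>1 \<sigma>2 \<epsilon>. \<epsilon> > 0 \<Longrightarrow> \<exists>T. \<forall>s. \<sigma>1 \<le> Re s \<and> Re s \<le> \<sigma>2 \<and> \<bar>Im s\<bar> \<ge> T \<longrightarrow> norm (X s) < \<epsilon>"
    by (rule class_B_completion) blast
  obtain R where R: "\<And>z. z \<in> K \<Longrightarrow> norm z \<le> R"
    using compact_imp_bounded[OF K] unfolding bounded_iff by blast
  obtain T where T: "\<And>s. 2 * c1 - \<delta> \<le> Re s \<Longrightarrow> Re s \<le> 2 * c2 - \<delta> \<Longrightarrow> \<bar>Im s\<bar> \<ge> T \<Longrightarrow> norm (X s) < \<epsilon>"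
    using dec[OF e] by blast
  show ?thesis
  proof (intro exI[of _ "\<bar>R\<bar> + \<bar>T\<bar> + 1"] allI impI)
    fix w assume w: "c1 \<le> Re w \<and> Re w \<le> c2 \<and> \<bar>R\<bar> + \<bar>T\<bar> + 1 \<le> \<bar>Im w\<bar>"
    define s where "s = 2 * w - complex_of_nat \<delta>"
    have im: "\<bar>Im s\<bar> = 2 * \<bar>Im w\<bar>" by (simp add: s_def abs_mult)
    have ns: "norm s > R" using abs_Im_le_cmod[of s] im w by linarith
    have sK: "s \<notin> K" using R[of s] ns by auto
    have se: "s \<notin> exceptional_points \<delta>" using im w by (auto simp: exceptional_points_def)
    have "norm (X s) < \<epsilon>" using T[of s] w im by (auto simp: s_def)
    moreover have "X s = completed \<delta> \<phi> \<psi> w"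
    proof (cases "Re w > 1/4 + \<delta>/2")
      case True
      have "X s = Gamma ((s + of_nat \<delta>) / 2) * \<phi> s"
        by (rule mult_Gamma_of_mult_rGamma[OF X1[OF sK se]]) (use w im in \<open>auto intro!: notin_nonpos_Ints_Im\<close>)
      then show ?thesis using True by (simp add: completed_def s_def)
    next
      case False
      have "X s = Gamma ((1 - s + of_nat \<delta>) / 2) * \<psi> (1 - s)"
        by (rule mult_Gamma_of_mult_rGamma[OF X2[OF sK se]]) (use w im in \<open>auto intro!: notin_nonpos_Ints_Im\<close>)
      moreover have "(1 - s + of_nat \<delta>) / 2 = 1/2 + of_nat \<delta> - w" "1 - s = 1 + of_nat \<delta> - 2 * w"
        by (simp_all add: s_def field_simps)
      ultimately show ?thesis using False by (simp only: completed_def if_False)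
    qed
    ultimately show "norm (completed \<delta> \<phi> \<psi> w) < \<epsilon>" by simp
  qed
qed

section \<open>Transformation of theta series\<close>

lemma class_BD:
  assumes "class_B \<delta> a lam b mu \<phi> \<psi>"
  shows "\<delta> = 0 \<or> \<delta> = 1" "frequencies lam" "frequencies mu"
    "abs_abscissa a lam < \<infinity>" "abs_abscissa b mu < \<infinity>"
    "\<exists>n\<ge>1. a n \<noteq> 0" "\<exists>n\<ge>1. b n \<noteq> 0"
    "continues_series \<phi> a lam" "continues_series \<psi> b mu"
  using assms unfolding class_B_def bochner_pair_def by auto

text \<open>The residues at w = 0 and w = 1/2 crossed by the contour shift.\<close>

definition theta_correction :: "nat \<Rightarrow> (complex \<Rightarrow> complex) \<Rightarrow> complex \<Rightarrow> complex" where
  "theta_correction \<delta> \<phi> \<tau> =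
     (if \<delta> = 0 then \<phi> 0 + of_real (sqrt pi) / 2 * residue \<phi> 1 * \<tau> powr (- 1/2) else 0)"

text \<open>This form covers both alternatives of the class at once: without a pole both sides are
  0, with a simple pole the limit is the leading coefficient.\<close>

lemma simple_pole_residue_limit:
  assumes "entire_but_simple_pole_at_1 f"
  shows "((\<lambda>s. f s * (s - 1)) \<longlongrightarrow> residue f 1) (at 1)"
  using assms unfolding entire_but_simple_pole_at_1_def
proof
  assume h: "f holomorphic_on UNIV"
  then have "residue f 1 = 0" by (intro residue_holo[of UNIV]) auto
  moreover have "isCont f 1" using holomorphic_on_imp_continuous_on[OF h]
    by (simp add: continuous_on_eq_continuous_at)
  then have "((\<lambda>s. f s * (s - 1)) \<longlongrightarrow> f 1 * (1 - 1)) (at 1)"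
    by (intro tendsto_intros) (simp add: isCont_def)
  ultimately show ?thesis by simp
next
  assume h: "f holomorphic_on - {1} \<and> is_pole f 1 \<and> zorder f 1 = - 1"
  have iso: "isolated_singularity_at f 1"
    using h by (intro isolated_singularity_at_holomorphic[of _ UNIV]) (auto simp: Compl_eq_Diff_UNIV)
  have res: "residue f 1 = zor_poly f 1 1"
    using h by (intro residue_simple_pole iso) auto
  obtain r where r: "zor_poly f 1 1 \<noteq> 0" "r > 0" "zor_poly f 1 holomorphic_on cball 1 r"
     "\<forall>w\<in>cball 1 r - {1}. f w = zor_poly f 1 w / (w - 1) ^ nat (- zorder f 1) \<and> zor_poly f 1 w \<noteq> 0"
    using zorder_exist_pole[of f UNIV 1] h by (auto simp: Compl_eq_Diff_UNIV)
  have "isCont (zor_poly f 1) 1"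
    using holomorphic_on_imp_continuous_on[OF r(3)] r(2) by (simp add: continuous_on_interior)
  then have "(zor_poly f 1 \<longlongrightarrow> residue f 1) (at 1)" unfolding res by (simp add: isCont_def)
  moreover have "eventually (\<lambda>w. zor_poly f 1 w = f w * (w - 1)) (at 1)"
  proof -
    have "eventually (\<lambda>w. w \<in> ball 1 r - {1}) (at (1::complex))"
      using r(2) by (intro eventually_at_in_open) auto
    then show ?thesis
    proof eventually_elim
      case (elim w)
      then show ?case using r(4) h by auto
    qed
  qed
  ultimately show ?thesis using tendsto_cong by fast
qed

text \<open>At w = 0 the pole of Gamma leaves \<phi>(0). At w = 1/2 the pole of \<phi> at s = 2w = 1
  contributes: its residue is halved by the change of variable and multiplied by Gamma(1/2), the
  square root of pi.\<close>

lemma theta_residues: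
  assumes B: "class_B \<delta> a lam b mu \<phi> \<psi>" and t: "t > 0"
  shows "(\<Sum>p\<in>(if \<delta> = 0 then {0, 1/2} else {}). residue (\<lambda>w. completed \<delta> \<phi> \<psi> w * of_real t powr (- w)) p)
     = theta_correction \<delta> \<phi> (of_real t)"
proof (cases "\<delta> = 0")
  case True
  define f where "f = (\<lambda>w. completed \<delta> \<phi> \<psi> w * of_real t powr (- w))"
  have EB: "entire_but_simple_pole_at_1 \<phi>" using B True by (simp add: class_B_def)
  have hol: "f holomorphic_on - {0, 1/2}"
  proof -
    have "completed \<delta> \<phi> \<psi> holomorphic_on - {0, 1/2}"
      by (rule holomorphic_on_subset[OF completed_holomorphic[OF B]]) (auto simp: exceptional_points_def True field_simps)
    then show ?thesis unfolding f_def using t by (auto intro!: holomorphic_intros)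
  qed
  \<comment> \<open>Near 0 the function is defined by its \<psi> branch; the reflection formula
    replaces it by the \<phi> branch. Radius 1/4 keeps every other pole of both Gamma factors out of
    the disc.\<close>
  have ev: "eventually (\<lambda>w. f w = Gamma w * \<phi> (2 * w) * of_real t powr (- w)) (at p)"
    if p: "p = 0 \<or> p = 1/2" for p
  proof -
    have "eventually (\<lambda>w. w \<in> ball p (1/4) - {p}) (at p)"
      by (intro eventually_at_in_open) auto
    then show ?thesis
    proof eventually_elim
      case (elim w)
      have d: "norm (p - w) < 1/4" "w \<noteq> p" using elim by (auto simp: dist_norm)
      have re: "\<bar>Re p - Re w\<bar> < 1/4" using abs_Re_le_cmod[of "p - w"] d by simp
      have rp: "0 \<le> Re p \<and> Re p \<le> 1/2" using p by (elim disjE; simp only:; simp)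
      have w0: "w \<noteq> 0 \<and> w \<noteq> 1/2"
      proof (rule ccontr)
        assume "\<not> (w \<noteq> 0 \<and> w \<noteq> 1/2)"
        then consider "w = 0" | "w = 1/2" by blast
        then have "p = w \<or> \<bar>Re p - Re w\<bar> = 1/2" using p by cases (elim disjE; simp only:; simp)+
        then show False using d(2) re by auto
      qed
      have i1: "w \<notin> \<int>\<^sub>\<le>\<^sub>0"
      proof
        assume "w \<in> \<int>\<^sub>\<le>\<^sub>0"
        then obtain n where n: "w = - of_nat n" by (auto elim: nonpos_Ints_cases')
        then have "n > 0" using w0 by (cases n) auto
        then have "Re w \<le> -1" using n by simp
        then show False using re rp by linarith
      qed
      have i2: "1/2 - w \<notin> \<int>\<^sub>\<le>\<^sub>0"
      proof
        assume "1/2 - w \<in> \<int>\<^sub>\<le>\<^sub>0"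
        then obtain n where n: "1/2 - w = - of_nat n" by (auto elim: nonpos_Ints_cases')
        then have "n > 0" using w0 by (cases n) auto
        moreover have "Re (1/2 - w) = - real n" using n by simp
        ultimately have "Re w \<ge> 3/2" by simp
        then show False using re rp by linarith
      qed
      have "2 * w - of_nat \<delta> \<notin> exceptional_points \<delta>" using w0 True by (auto simp: exceptional_points_def field_simps)
      from completed_eq(1)[OF B this i1] i2 True show ?case by (simp add: f_def)
    qed
  qed
  have "residue f 0 = \<phi> 0"
  proof (rule residue_simple')
    show "open (- {1/2} :: complex set)" by auto
    show "f holomorphic_on - {1/2} - {0}" by (rule holomorphic_on_subset[OF hol]) auto
    have c: "isCont \<phi> 0"
    proof -
      have "\<phi> holomorphic_on - {1}" using EB by (auto simp: entire_but_simple_pole_at_1_def intro: holomorphic_on_subset)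
      then have "\<phi> analytic_on - {1}" by (subst analytic_on_open) auto
      then have "\<phi> analytic_on {0}" by (rule analytic_on_subset) auto
      then show ?thesis by (rule analytic_at_imp_isCont)
    qed
    have "((\<lambda>w. \<phi> (2 * w)) \<longlongrightarrow> \<phi> (2 * 0)) (at 0)"
      using c by (intro isContD isCont_o2[of 0 "\<lambda>w. 2 * w" \<phi>]) (auto intro!: continuous_intros)
    then have "((\<lambda>w. (Gamma w * (w + of_nat 0)) * \<phi> (2 * w) * of_real t powr (- w)) \<longlongrightarrow> ((-1) ^ 0 / fact 0) * \<phi> 0 * of_real t powr (- 0)) (at 0)"
      using t Gamma_residues[of 0, where ?'a = complex] by (intro tendsto_intros) auto
    then have "((\<lambda>w. (Gamma w * \<phi> (2 * w) * of_real t powr (- w)) * (w - 0)) \<longlongrightarrow> \<phi> 0) (at 0)"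
      using t by (simp add: mult_ac)
    then show "((\<lambda>w. f w * (w - 0)) \<longlongrightarrow> \<phi> 0) (at 0)"
      by (rule Lim_transform_eventually) (use ev[of 0] in \<open>auto elim!: eventually_mono\<close>)
  qed auto
  moreover have "residue f (1/2) = of_real (sqrt pi) / 2 * residue \<phi> 1 * of_real t powr (- 1/2)"
  proof (rule residue_simple')
    show "open (- {0} :: complex set)" by auto
    show "f holomorphic_on - {0} - {1/2}" by (rule holomorphic_on_subset[OF hol]) auto
    have "filterlim (\<lambda>w::complex. 2 * w) (at 1) (at (1/2))"
    proof -
      have "((\<lambda>w::complex. 2 * w) \<longlongrightarrow> 2 * (1/2)) (at (1/2))" by (intro tendsto_intros)
      moreover have "eventually (\<lambda>w::complex. 2 * w \<noteq> 1) (at (1/2))"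
        by (rule eventually_mono[OF eventually_neq_at_within[of "1/2"]]) (auto simp: field_simps)
      ultimately show ?thesis by (simp add: filterlim_at)
    qed
    from filterlim_compose[OF simple_pole_residue_limit[OF EB] this]
    have "((\<lambda>w. \<phi> (2 * w) * (2 * w - 1)) \<longlongrightarrow> residue \<phi> 1) (at (1/2))" .
    moreover have "isCont (Gamma :: complex \<Rightarrow> complex) (1/2)"
      by (intro continuous_intros) (auto elim!: nonpos_Ints_cases' simp: complex_eq_iff)
    then have "((Gamma :: complex \<Rightarrow> complex) \<longlongrightarrow> Gamma (1/2)) (at (1/2))" by (simp add: isCont_def)
    ultimately have "((\<lambda>w. Gamma w * (\<phi> (2 * w) * (2 * w - 1)) * of_real t powr (- w) / 2) \<longlongrightarrow>
        Gamma (1/2) * residue \<phi> 1 * of_real t powr (- (1/2)) / 2) (at (1/2))"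
      using t by (intro tendsto_intros) auto
    then have "((\<lambda>w. (Gamma w * \<phi> (2 * w) * of_real t powr (- w)) * (w - 1/2)) \<longlongrightarrow>
        of_real (sqrt pi) / 2 * residue \<phi> 1 * of_real t powr (- 1/2)) (at (1/2))"
      by (simp add: Gamma_one_half_complex field_simps)
    then show "((\<lambda>w. f w * (w - 1/2)) \<longlongrightarrow> of_real (sqrt pi) / 2 * residue \<phi> 1 * of_real t powr (- 1/2)) (at (1/2))"
      by (rule Lim_transform_eventually) (use ev[of "1/2"] in \<open>auto elim!: eventually_mono\<close>)
  qed auto
  ultimately show ?thesis using True unfolding f_def[symmetric] by (simp add: theta_correction_def)
qed (simp add: theta_correction_def)

text \<open>The contour moves from Re w = C to the mirror line Re w = 1/2 + \<delta> - C. On the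
  first line the \<phi> branch inverts to the theta series of (a, lam) at t, on the second the
  \<psi> branch inverts to that of (b, mu) at 1/t, and the substitution w to 1/2 + \<delta> - w
  produces the power of t.\<close>

lemma theta_transformation_real:
  assumes B: "class_B \<delta> a lam b mu \<phi> \<psi>" and t: "t > 0"
  shows "theta_series \<delta> a lam (of_real t) =
     of_real (t powr (- 1/2 - real \<delta>)) * theta_series \<delta> b mu (of_real (1 / t)) + theta_correction \<delta> \<phi> (of_real t)"
proof -
  note c\<phi> = class_BD(8)[OF B] and c\<psi> = class_BD(9)[OF B] and d01 = class_BD(1)[OF B]
    and fra = class_BD(2)[OF B] and frb = class_BD(3)[OF B]
  have "max (abs_abscissa a lam) (abs_abscissa b mu) < \<infinity>"
    using class_BD(4,5)[OF B] by (simp add: max_def)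
  \<comment> \<open>With r above both abscissas, both Dirichlet series converge absolutely on their
    lines. The bound 4 gives C > 2 and c1 < 0, so that the possible poles 0 and 1/2 lie strictly
    between the lines.\<close>
  from ereal_above_finite[OF this, of 4] obtain r where
    r: "abs_abscissa a lam < ereal r" "abs_abscissa b mu < ereal r" "r > 4" by auto
  define C where "C = (r + \<delta>) / 2"
  define c1 where "c1 = 1/2 + \<delta> - C"
  have rC: "r = 2 * C - \<delta>" by (simp add: C_def add_divide_distrib)
  have Cp: "C > 0" "C > 1/4 + \<delta>/2" "c1 < 0" using r(3) d01 by (auto simp: C_def c1_def)
  define f where "f = (\<lambda>w. completed \<delta> \<phi> \<psi> w * complex_of_real t powr (- w))"
  define P :: "complex set" where "P = (if \<delta> = 0 then {0, 1/2} else {})"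
  have right: "f (Complex C y) = Gamma (Complex C y) * dirichlet_series a lam (2 * Complex C y - \<delta>) * of_real t powr (- Complex C y)" for y
  proof -
    have "\<phi> (2 * Complex C y - \<delta>) = dirichlet_series a lam (2 * Complex C y - \<delta>)"
      using c\<phi> r(1) by (simp add: continues_series_def rC)
    then show ?thesis using Cp by (simp add: f_def completed_def)
  qed
  define g where "g = (\<lambda>y. Gamma (Complex C y) * dirichlet_series b mu (2 * Complex C y - \<delta>) * of_real (1 / t) powr (- Complex C y))"
  \<comment> \<open>The reflection reverses the direction of the line. The argument is written
    \<open>0 + (-1) * y\<close> to fit the affine substitution rule for
    \<open>lborel\<close>.\<close>
  have left: "f (Complex c1 y) = of_real (t powr (- 1/2 - real \<delta>)) * g (0 + (-1) * y)" for y
  proof -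
    have e1: "1/2 + of_nat \<delta> - Complex c1 y = Complex C (- y)"
      by (simp add: c1_def complex_eq_iff)
    have e2: "1 + of_nat \<delta> - 2 * Complex c1 y = 2 * Complex C (- y) - of_nat \<delta>"
      by (simp add: c1_def complex_eq_iff)
    have p: "\<psi> (2 * Complex C (-y) - \<delta>) = dirichlet_series b mu (2 * Complex C (-y) - \<delta>)"
      using c\<psi> r(2) by (simp add: continues_series_def rC)
    have "- Complex c1 y = of_real (- 1/2 - real \<delta>) + Complex C (- y)" 
      by (simp add: c1_def complex_eq_iff)
    then have "complex_of_real t powr (- Complex c1 y) = of_real t powr (of_real (- 1/2 - real \<delta>)) * of_real t powr (Complex C (- y))"
      by (simp only: powr_add)
    also have "complex_of_real t powr (of_real (- 1/2 - real \<delta>)) = of_real (t powr (- 1/2 - real \<delta>))"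
      using t by (intro powr_of_real) auto
    also have "complex_of_real t powr (Complex C (- y)) = of_real (1 / t) powr (- Complex C (- y))"
    proof -
      have "Ln (complex_of_real (1 / t)) = - of_real (ln t)"
        using t by (subst Ln_of_real) (auto simp: ln_div)
      then show ?thesis using t by (simp add: powr_def Ln_of_real del: of_real_divide)
    qed
    finally have e3: "complex_of_real t powr (- Complex c1 y) = of_real (t powr (- 1/2 - real \<delta>)) * of_real (1 / t) powr (- Complex C (- y))" .
    have "\<not> (Re (Complex c1 y) > 1/4 + \<delta>/2)" using Cp by (simp add: c1_def)
    then have "f (Complex c1 y) = Gamma (1/2 + of_nat \<delta> - Complex c1 y) * \<psi> (1 + of_nat \<delta> - 2 * Complex c1 y) * complex_of_real t powr (- Complex c1 y)"
      by (simp only: f_def completed_def if_False)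
    then show ?thesis unfolding e1 e2 e3 p g_def by (simp add: mult_ac)
  qed
  have t': "1 / t > 0" using t by simp
  have Ca: "ereal (2 * C - \<delta>) > abs_abscissa a lam" and Cb: "ereal (2 * C - \<delta>) > abs_abscissa b mu"
    using r rC by auto
  note ma = theta_series_mellin[OF fra Cp(1) Ca t] and mb = theta_series_mellin[OF frb Cp(1) Cb t']
  have ig: "integrable lborel g" unfolding g_def by (rule mb(1))
  have ig': "integrable lborel (\<lambda>y. g (0 + (-1) * y))"
    by (rule lborel_integrable_real_affine[OF ig]) simp
  have Ig: "(\<integral>y. g (0 + (-1) * y) \<partial>lborel) = 2 * pi * theta_series \<delta> b mu (of_real (1 / t))"
    using lborel_integral_real_affine[of "-1" g 0] mb(2) unfolding g_def by simp
  have E: "(\<integral>y. f (Complex C y) \<partial>lborel) - (\<integral>y. f (Complex c1 y) \<partial>lborel) = 2 * pi * (\<Sum>p\<in>P. residue f p)"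
  proof (rule vertical_strip_residues[where S = UNIV])
    show "c1 < C" using Cp by linarith
    have "completed \<delta> \<phi> \<psi> holomorphic_on UNIV - P"
      by (rule holomorphic_on_subset[OF completed_holomorphic[OF B]]) (use d01 in \<open>auto simp: exceptional_points_def P_def field_simps\<close>)
    then show "f holomorphic_on UNIV - P" unfolding f_def using t by (auto intro!: holomorphic_intros)
    show "c1 < Re p \<and> Re p < C" if "p \<in> P" for p
    proof -
      have "p = 0 \<or> p = 1/2" using that by (simp add: P_def split: if_splits)
      then have "0 \<le> Re p \<and> Re p \<le> 1/2" by (elim disjE; simp only:; simp)
      moreover have "C \<ge> 2" using r(3) by (simp add: C_def)
      ultimately show ?thesis using Cp by linarith
    qed
    show "integrable lborel (\<lambda>y. f (Complex c1 y))"
      unfolding left by (intro integrable_mult_right ig')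
    show "integrable lborel (\<lambda>y. f (Complex C y))"
      unfolding right by (rule ma(1))
    fix e :: real assume e: "e > 0"
    obtain X where X: "X > 0" "\<And>u. c1 \<le> u \<Longrightarrow> u \<le> C \<Longrightarrow> t powr (- u) \<le> X"
      using powr_strip_bound[OF t] by blast
    have "e / X > 0" using e X by simp
    from completed_decay[OF B this] obtain T where 
      T: "\<And>w. c1 \<le> Re w \<Longrightarrow> Re w \<le> C \<Longrightarrow> \<bar>Im w\<bar> \<ge> T \<Longrightarrow> norm (completed \<delta> \<phi> \<psi> w) < e / X" by blast
    show "\<exists>T. \<forall>z. c1 \<le> Re z \<and> Re z \<le> C \<and> T \<le> \<bar>Im z\<bar> \<longrightarrow> norm (f z) < e"
    proof (intro exI[of _ T] allI impI)
      fix z assume z: "c1 \<le> Re z \<and> Re z \<le> C \<and> T \<le> \<bar>Im z\<bar>"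
      have "norm (f z) = norm (completed \<delta> \<phi> \<psi> z) * t powr (- Re z)"
        using t by (simp add: f_def norm_mult norm_powr_real_powr)
      also have "\<dots> \<le> norm (completed \<delta> \<phi> \<psi> z) * X" using X z by (intro mult_left_mono) auto
      also have "\<dots> < e" using T[of z] z X(1) by (simp add: field_simps)
      finally show "norm (f z) < e" .
    qed
  qed (auto simp: P_def)
  have "(\<Sum>p\<in>P. residue f p) = theta_correction \<delta> \<phi> (of_real t)"
    unfolding P_def f_def by (rule theta_residues[OF B t])
  with E have "2 * pi * theta_series \<delta> a lam (of_real t) 
      - of_real (t powr (- 1/2 - real \<delta>)) * (2 * pi * theta_series \<delta> b mu (of_real (1 / t)))
      = 2 * pi * theta_correction \<delta> \<phi> (of_real t)"
    unfolding right left integral_mult_right_zero Ig ma(2) by simp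
  then have "complex_of_real (2 * pi) * (theta_series \<delta> a lam (of_real t)) = of_real (2 * pi) * 
     (of_real (t powr (- 1/2 - real \<delta>)) * theta_series \<delta> b mu (of_real (1 / t)) + theta_correction \<delta> \<phi> (of_real t))"
    by (simp add: algebra_simps)
  then show ?thesis by simp
qed

lemma holomorphic_eq_of_eq_on_reals:
  assumes S: "open S" "convex S" and hol: "f holomorphic_on S" "g holomorphic_on S"
    and p: "of_real p \<in> S" and eq: "\<And>x. of_real x \<in> S \<Longrightarrow> f (of_real x) = g (of_real x)" and z: "z \<in> S"
  shows "f z = g z"
proof -
  have "(\<lambda>z. f z - g z) z = 0"
  proof (rule analytic_continuation[where S = S and U = "S \<inter> range complex_of_real" and \<xi> = "of_real p" and f = "\<lambda>z. f z - g z"])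
    show "(\<lambda>z. f z - g z) holomorphic_on S" by (intro holomorphic_intros hol)
    show "connected S" by (rule convex_connected[OF S(2)])
    show "of_real p islimpt S \<inter> range complex_of_real"
    proof (rule islimptI)
      fix T :: "complex set" assume T: "of_real p \<in> T" "open T"
      then obtain e where e: "e > 0" "ball (of_real p) e \<subseteq> S \<inter> T"
        using S(1) p by (meson IntI open_Int openE)
      have "complex_of_real (p + e/2) \<in> ball (of_real p) e" using e by (simp add: dist_norm flip: of_real_diff)
      then show "\<exists>y\<in>S \<inter> range complex_of_real. y \<in> T \<and> y \<noteq> of_real p"
        using e rangeI[of complex_of_real "p + e/2"] by (intro bexI[of _ "complex_of_real (p + e/2)"]) auto
    qed
  qed (use S p eq z in auto)
  then show ?thesis by simp
qed

lemma Re_inverse_pos: "Re \<tau> > 0 \<Longrightarrow> Re (1 / \<tau>) > 0"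
  by (simp add: Re_divide sum_power2_gt_zero_iff)

text \<open>Real arguments would not be enough for the shift of the centre: the functional samples
  both sides on a circle around t. Both sides are holomorphic in the half-plane for the principal
  branch of the powers, so the identity theorem applies.\<close>

theorem theta_transformation:
  assumes B: "class_B \<delta> a lam b mu \<phi> \<psi>" and \<tau>: "Re \<tau> > 0"
  shows "theta_series \<delta> a lam \<tau> = \<tau> powr (of_real (- 1/2 - real \<delta>)) * theta_series \<delta> b mu (1 / \<tau>) + theta_correction \<delta> \<phi> \<tau>"
proof -
  note fra = class_BD(2)[OF B] and frb = class_BD(3)[OF B] and fin = class_BD(4,5)[OF B]
  define H where "H = {\<tau>. Re \<tau> > 0}"
  define L where "L = theta_series \<delta> a lam"
  define R where "R = (\<lambda>\<tau>. \<tau> powr (of_real (- 1/2 - real \<delta>)) * theta_series \<delta> b mu (1 / \<tau>) + theta_correction \<delta> \<phi> \<tau>)"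
  have nr: "\<tau> \<notin> \<real>\<^sub>\<le>\<^sub>0" if "\<tau> \<in> H" for \<tau> using that by (auto simp: H_def complex_nonpos_Reals_iff)
  have n0: "\<tau> \<noteq> 0" if "\<tau> \<in> H" for \<tau> using that by (auto simp: H_def)
  have hL: "L holomorphic_on H" unfolding L_def H_def by (rule theta_series_holomorphic[OF fra fin(1)])
  have "(theta_series \<delta> b mu \<circ> (\<lambda>\<tau>. 1 / \<tau>)) holomorphic_on H"
    using Re_inverse_pos n0 by (intro holomorphic_on_compose_gen[OF _ theta_series_holomorphic[OF frb fin(2)]])
      (auto intro!: holomorphic_intros simp: H_def)
  then have hb: "(\<lambda>\<tau>. theta_series \<delta> b mu (1 / \<tau>)) holomorphic_on H" by (simp add: o_def)
  have hp: "(\<lambda>\<tau>. \<tau> powr c) holomorphic_on H" for c using nr by (intro holomorphic_intros) auto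
  have "theta_correction \<delta> \<phi> holomorphic_on H"
    unfolding theta_correction_def by (cases "\<delta> = 0") (auto intro!: holomorphic_intros hp)
  then have hR: "R holomorphic_on H" unfolding R_def by (intro holomorphic_intros hb hp)
  have eq: "L (of_real t) = R (of_real t)" if "t > 0" for t
    using theta_transformation_real[OF B that] that
    by (simp add: L_def R_def powr_of_real[symmetric])
  have "L \<tau> = R \<tau>"
  proof (rule holomorphic_eq_of_eq_on_reals[where S = H and p = 1 and f = L and g = R])
    show "open H" unfolding H_def by (rule open_halfspace_Re_gt)
    show "convex H" unfolding H_def by (rule convex_halfspace_Re_gt)
  qed (use hL hR \<tau> eq in \<open>auto simp: H_def\<close>)
  then show ?thesis by (simp add: L_def R_def)
qed

text \<open>
  With a nonpositive abscissa the dual theta series is small enough near the imaginary axis for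
  the transformation formula to make the theta series tend to its constant term along vertical
  lines, which the dominance of its first term excludes. Hence Re s > 0 in the main theorem,
  which the convergence of the double series and of the Gamma integrals requires.
\<close>

lemma abscissa_dual_positive:
  assumes B: "class_B \<delta> a lam b mu \<phi> \<psi>" and \<sigma>: "ereal \<sigma> > abs_abscissa b mu"
  shows "\<sigma> > 0"
proof (rule ccontr)
  assume "\<not> \<sigma> > 0"
  then have "abs_abscissa b mu < ereal 0" using \<sigma> by (meson ereal_less_eq(3) less_le_trans not_le)
  note frb = class_BD(3)[OF B] and d01 = class_BD(1)[OF B]
  have sb: "summable (\<lambda>n. norm (b (Suc n)))"
    using summable_above_abscissa[OF frb \<open>abs_abscissa b mu < ereal 0\<close>] frequencies_pos[OF frb]
    by (simp add: less_imp_neq[symmetric])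
  define S where "S = (\<Sum>n. norm (b (Suc n)))"
  \<comment> \<open>This constant cancels the constant part of the theta correction. What remains on
    the right of the transformation formula is of order |\<tau>|^(-1/2), which contradicts the lower
    bound \<open>\<epsilon>\<close> far up the line.\<close>
  define C where "C = (if \<delta> = 0 then - \<phi> 0 else 0)"
  define \<kappa> where "\<kappa> = (if \<delta> = 0 then of_real (sqrt pi) / 2 * residue \<phi> 1 else 0)"
  obtain n where n: "n \<ge> 1" "a n \<noteq> 0" using class_BD(6)[OF B] by blast
  obtain R \<epsilon> where R: "R \<ge> 1" "\<epsilon> > 0" and lower: "\<And>\<tau>. Re \<tau> = R \<Longrightarrow> norm (theta_series \<delta> a lam \<tau> + C) \<ge> \<epsilon>"
    using theta_plus_constant_bounded_below[OF class_BD(2)[OF B] class_BD(4)[OF B] n, of \<delta> C] by blast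
  have upper: "norm (theta_series \<delta> a lam \<tau> + C) \<le> (S + norm \<kappa>) * norm \<tau> powr (- 1/2)" if \<tau>: "Re \<tau> = R" for \<tau>
  proof -
    have tp: "Re \<tau> > 0" using \<tau> R by simp
    have n0: "norm \<tau> > 0" using tp by auto
    have nt: "norm (\<tau> powr of_real p) = norm \<tau> powr p" for p
      using n0 by (simp add: norm_powr_real_powr')
    define u where "u = Re (1 / \<tau>)"
    have u: "u = R / (norm \<tau>)\<^sup>2"
      using \<tau> by (simp add: u_def Re_divide cmod_power2)
    have up: "u > 0" using u R n0 by simp
    have bterm: "norm (b (Suc m) * of_real (mu (Suc m)) ^ \<delta> * exp (- of_real ((mu (Suc m))\<^sup>2) * (1 / \<tau>)))
       \<le> norm (b (Suc m)) * norm \<tau> ^ \<delta>" for m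
    proof -
      have "mu (Suc m) ^ \<delta> * exp (- (mu (Suc m))\<^sup>2 * u) \<le> norm \<tau> ^ \<delta>"
        using d01
      proof
        assume "\<delta> = 0"
        then show ?thesis using up by simp
      next
        assume d: "\<delta> = 1"
        \<comment> \<open>With u = Re(1/\<tau>) = R/|\<tau>|^2, the estimate v exp(-v^2) <= 1 bounds
          the extra factor mu by |\<tau>|. That is exactly what the power |\<tau>|^(-1/2 - \<delta>)
          absorbs for \<delta> = 1.\<close>
        define v where "v = mu (Suc m) * sqrt u"
        have v: "v\<^sup>2 = (mu (Suc m))\<^sup>2 * u" using up by (simp add: v_def power_mult_distrib)
        have "v \<le> 1 + v\<^sup>2" using sum_power2_ge_zero[of "v - 1" v] by (simp add: power2_eq_square algebra_simps)
        also have "\<dots> \<le> exp (v\<^sup>2)" by (rule exp_ge_add_one_self)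
        finally have "v * exp (- v\<^sup>2) \<le> 1" by (simp add: exp_minus field_simps)
        then have "mu (Suc m) * exp (- (mu (Suc m))\<^sup>2 * u) * sqrt u \<le> 1" by (simp add: v[symmetric]) (simp add: v_def mult_ac)
        then have "mu (Suc m) * exp (- (mu (Suc m))\<^sup>2 * u) \<le> 1 / sqrt u" using up by (simp add: field_simps)
        also have "\<dots> = norm \<tau> / sqrt R" using u n0 by (simp add: real_sqrt_divide)
        also have "\<dots> \<le> norm \<tau> / 1" using R n0 by (intro divide_left_mono) auto
        finally show ?thesis using d by simp
      qed
      from mult_left_mono[OF this norm_ge_zero[of "b (Suc m)"]]
      show ?thesis unfolding u_def by (subst norm_theta_term[OF frb]) (simp only: mult.assoc)
    qed
    have s1: "summable (\<lambda>m. norm (b (Suc m)) * norm \<tau> ^ \<delta>)" by (intro summable_mult2 sb)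
    have "norm (theta_series \<delta> b mu (1 / \<tau>)) \<le> (\<Sum>m. norm (b (Suc m)) * norm \<tau> ^ \<delta>)"
      unfolding theta_series_def by (rule norm_suminf_le[OF bterm s1])
    also have "\<dots> = S * norm \<tau> ^ \<delta>" unfolding S_def by (rule suminf_mult2[OF sb, symmetric])
    finally have "norm (\<tau> powr (of_real (- 1/2 - real \<delta>)) * theta_series \<delta> b mu (1 / \<tau>))
        \<le> norm \<tau> powr (- 1/2 - real \<delta>) * (S * norm \<tau> ^ \<delta>)"
      unfolding norm_mult nt by (rule mult_left_mono) auto
    also have "\<dots> = S * norm \<tau> powr (- 1/2)"
    proof -
      have "norm \<tau> powr (- 1/2 - real \<delta>) * norm \<tau> ^ \<delta> = norm \<tau> powr (- 1/2 - real \<delta> + real \<delta>)"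
        using n0 by (simp only: powr_add powr_realpow)
      then show ?thesis by (simp add: mult_ac)
    qed
    finally have 1: "norm (\<tau> powr (of_real (- 1/2 - real \<delta>)) * theta_series \<delta> b mu (1 / \<tau>)) \<le> S * norm \<tau> powr (- 1/2)" .
    have "theta_series \<delta> a lam \<tau> + C = \<tau> powr (of_real (- 1/2 - real \<delta>)) * theta_series \<delta> b mu (1 / \<tau>) + \<kappa> * \<tau> powr of_real (- 1/2)"
      unfolding theta_transformation[OF B tp] by (simp add: theta_correction_def C_def \<kappa>_def)
    also have "norm \<dots> \<le> S * norm \<tau> powr (- 1/2) + norm \<kappa> * norm \<tau> powr (- 1/2)"
      by (rule order_trans[OF norm_triangle_ineq add_mono]) (use 1 in \<open>simp_all only: norm_mult nt order_refl\<close>)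
    finally show ?thesis by (simp add: algebra_simps)
  qed
  have "((\<lambda>y::real. (S + norm \<kappa>) * y powr (- 1/2)) \<longlongrightarrow> 0) at_top" by real_asymp
  then have "eventually (\<lambda>y. (S + norm \<kappa>) * y powr (- 1/2) < \<epsilon>) at_top" using R by (intro order_tendstoD) auto
  then have "eventually (\<lambda>y. (S + norm \<kappa>) * y powr (- 1/2) < \<epsilon> \<and> y \<ge> 1) at_top"
    using eventually_ge_at_top[of "1::real"] by eventually_elim auto
  then obtain y where y: "(S + norm \<kappa>) * y powr (- 1/2) < \<epsilon>" "y \<ge> 1"
    using eventually_happens'[OF trivial_limit_at_top_linorder] by blast
  have S0: "S \<ge> 0" unfolding S_def by (intro suminf_nonneg sb) auto
  have "y \<le> norm (Complex R y)" using abs_Im_le_cmod[of "Complex R y"] by simp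
  then have "norm (Complex R y) powr (- 1/2) \<le> y powr (- 1/2)" using y by (intro powr_mono2') auto
  then have "(S + norm \<kappa>) * norm (Complex R y) powr (- 1/2) \<le> (S + norm \<kappa>) * y powr (- 1/2)"
    using S0 by (intro mult_left_mono) auto
  then show False using upper[of "Complex R y"] lower[of "Complex R y"] y by simp
qed

section \<open>Shifting the centre of the Gaussians\<close>

lemma sums_integral_dominated:
  fixes f :: "nat \<Rightarrow> 'a \<Rightarrow> complex"
  assumes m: "\<And>l. f l \<in> borel_measurable M" and g: "integrable M g"
    and s: "\<And>x. x \<in> space M \<Longrightarrow> summable (\<lambda>l. norm (f l x))"
    and le: "\<And>x. x \<in> space M \<Longrightarrow> (\<Sum>l. norm (f l x)) \<le> g x"
  shows "integrable M (f l)" "summable (\<lambda>l. \<integral>x. norm (f l x) \<partial>M)"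
    "integrable M (\<lambda>x. \<Sum>l. f l x)"
    "(\<lambda>l. integral\<^sup>L M (f l)) sums (\<integral>x. (\<Sum>l. f l x) \<partial>M)"
proof -
  have part: "(\<Sum>l<n. norm (f l x)) \<le> g x" if "x \<in> space M" for n x
    by (rule order_trans[OF sum_le_suminf[OF s[OF that]] le[OF that]]) auto
  have int: "integrable M (f l)" for l
  proof (rule Bochner_Integration.integrable_bound[OF g m AE_I2])
    fix x assume x: "x \<in> space M"
    have "norm (f l x) \<le> (\<Sum>l<Suc l. norm (f l x))" by (simp add: sum_nonneg)
    also have "\<dots> \<le> g x" by (rule part[OF x])
    finally show "norm (f l x) \<le> norm (g x)" by simp
  qed
  then show "integrable M (f l)" .
  show sI: "summable (\<lambda>l. \<integral>x. norm (f l x) \<partial>M)"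
  proof (rule summableI_nonneg_bounded)
    fix n
    have "(\<Sum>l<n. \<integral>x. norm (f l x) \<partial>M) = (\<integral>x. (\<Sum>l<n. norm (f l x)) \<partial>M)"
      by (rule Bochner_Integration.integral_sum[symmetric]) (intro integrable_norm int)
    also have "\<dots> \<le> integral\<^sup>L M g"
      by (intro integral_mono g Bochner_Integration.integrable_sum integrable_norm int part)
    finally show "(\<Sum>l<n. \<integral>x. norm (f l x) \<partial>M) \<le> integral\<^sup>L M g" .
  qed simp
  have ae: "AE x in M. summable (\<lambda>l. norm (f l x))" using s by (rule AE_I2)
  show "integrable M (\<lambda>x. \<Sum>l. f l x)" by (rule integrable_suminf[OF int ae sI])
  show "(\<lambda>l. integral\<^sup>L M (f l)) sums (\<integral>x. (\<Sum>l. f l x) \<partial>M)" by (rule sums_integral[OF int ae sI])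
qed

text \<open>The angle is not normalized: the total mass is 2 pi, which is the origin of the factor 2
  pi in all pairing formulas below. As a measure of its own it lets the general theorems on
  integrals of series apply directly.\<close>

definition circle_measure :: "real measure" where
  "circle_measure = restrict_space lborel {0..2 * pi}"

lemma space_circle_measure [simp]: "space circle_measure = {0..2 * pi}"
  by (simp add: circle_measure_def space_restrict_space)

lemma measurable_circle_measure:
  "f \<in> borel_measurable borel \<Longrightarrow> f \<in> borel_measurable circle_measure"
  unfolding circle_measure_def by (intro measurable_restrict_space1) simp

lemma finite_circle_measure: "finite_measure circle_measure"
  by (intro finite_measureI) (simp add: circle_measure_def space_restrict_space emeasure_restrict_space emeasure_lborel_Icc_eq)

lemma integrable_circle_bounded:
  fixes f :: "real \<Rightarrow> complex"
  assumes "f \<in> borel_measurable circle_measure" "\<And>x. x \<in> {0..2 * pi} \<Longrightarrow> norm (f x) \<le> K"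
  shows "integrable circle_measure f"
  by (rule finite_measure.integrable_const_bound[OF finite_circle_measure AE_I2 assms(1), of K]) (use assms(2) in auto)

lemma integral_circle_cis:
  "(\<integral>\<theta>. cis (real_of_int n * \<theta>) \<partial>circle_measure) = (if n = 0 then 2 * pi else 0)"
proof -
  have "integrable lborel (\<lambda>\<theta>. indicator {0..2*pi} \<theta> *\<^sub>R cis (real_of_int n * \<theta>))"
    by (intro borel_integrable_compact[unfolded set_integrable_def] continuous_intros) auto
  then have si: "set_integrable lborel {0..2*pi} (\<lambda>\<theta>. cis (real_of_int n * \<theta>))"
    by (simp add: set_integrable_def)
  have "(\<integral>\<theta>. cis (real_of_int n * \<theta>) \<partial>circle_measure) = (LINT \<theta>:{0..2*pi}|lborel. cis (real_of_int n * \<theta>))"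
    unfolding circle_measure_def set_lebesgue_integral_def by (subst integral_restrict_space) auto
  also have "\<dots> = integral {0..2*pi} (\<lambda>\<theta>. cis (real_of_int n * \<theta>))"
    by (rule set_borel_integral_eq_integral(2)[OF si])
  also have "\<dots> = (if n = 0 then 2 * pi else 0)"
  proof (cases "n = 0")
    case False
    have "((\<lambda>\<theta>. cis (real_of_int n * \<theta>)) has_integral 
        (cis (real_of_int n * (2 * pi)) / (\<i> * n) - cis (real_of_int n * 0) / (\<i> * n))) {0..2*pi}"
    proof (rule fundamental_theorem_of_calculus)
      fix x assume "x \<in> {0..2*pi}"
      have "((\<lambda>\<theta>. exp (\<i> * of_real (real_of_int n * \<theta>)) / (\<i> * n)) has_vector_derivative exp (\<i> * of_real (real_of_int n * x))) (at x within {0..2*pi})"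
      proof -
        have "((\<lambda>z. exp (\<i> * (of_int n * z)) / (\<i> * n)) has_field_derivative exp (\<i> * (of_int n * of_real x))) (at (of_real x))"
          using False by (auto intro!: derivative_eq_intros simp: mult_ac)
        from has_vector_derivative_real_field[OF this] show ?thesis by simp
      qed
      then show "((\<lambda>\<theta>. cis (real_of_int n * \<theta>) / (\<i> * n)) has_vector_derivative cis (real_of_int n * x)) (at x within {0..2*pi})"
        by (simp add: cis_conv_exp)
    qed auto
    moreover have "cis (real_of_int n * (2 * pi)) = 1" using cis_multiple_2pi[of "real_of_int n"] by (simp add: mult_ac)
    ultimately show ?thesis using False by (simp add: integral_unique)
  qed (simp add: scaleR_conv_of_real)
  finally show ?thesis .
qed

text \<open>Orthogonality of the exponentials leaves only the diagonal j = l. This represents the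
  functional that weights the l-th coefficient by w(l) as an integral against a bounded
  function.\<close>

lemma circle_pairing:
  fixes f w :: "nat \<Rightarrow> complex"
  assumes f: "summable (\<lambda>l. norm (f l))" and w: "summable (\<lambda>j. norm (w j))"
  shows "(\<lambda>l. 2 * pi * (f l * w l)) sums
    (\<integral>\<theta>. (\<Sum>l. f l * cis (real l * \<theta>)) * (\<Sum>j. w j * cis (- real j * \<theta>)) \<partial>circle_measure)"
proof -
  define W where "W = (\<lambda>\<theta>. \<Sum>j. w j * cis (- real j * \<theta>))"
  have mc: "(\<lambda>\<theta>. cis (c * \<theta>)) \<in> borel_measurable circle_measure" for c
    by (intro measurable_circle_measure borel_measurable_continuous_onI continuous_intros)
  have mW: "W \<in> borel_measurable circle_measure"
    unfolding W_def by (intro borel_measurable_suminf borel_measurable_times borel_measurable_const mc)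
  have bW: "norm (W \<theta>) \<le> (\<Sum>j. norm (w j))" for \<theta>
    unfolding W_def by (rule norm_suminf_le[OF _ w]) (simp add: norm_mult)
  have int1: "(\<integral>\<theta>. cis (real l * \<theta>) * W \<theta> \<partial>circle_measure) = 2 * pi * w l" for l
  proof -
    define F where "F = (\<lambda>j \<theta>. w j * cis (real_of_int (int l - int j) * \<theta>))"
    have s: "summable (\<lambda>j. norm (F j \<theta>))" for \<theta> using w by (simp add: F_def norm_mult)
    have "(\<lambda>j. integral\<^sup>L circle_measure (F j)) sums (\<integral>\<theta>. (\<Sum>j. F j \<theta>) \<partial>circle_measure)"
    proof (rule sums_integral_dominated)
      show "F j \<in> borel_measurable circle_measure" for j
        unfolding F_def by (intro borel_measurable_times borel_measurable_const mc)
      show "integrable circle_measure (\<lambda>_. \<Sum>j. norm (w j))"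
        using finite_circle_measure by (simp add: finite_measure.integrable_const)
    qed (use s in \<open>auto simp: F_def norm_mult\<close>)
    moreover have "integral\<^sup>L circle_measure (F j) = (if j = l then 2 * pi * w l else 0)" for j
      unfolding F_def integral_mult_right_zero integral_circle_cis by auto
    then have "(\<lambda>j. integral\<^sup>L circle_measure (F j)) sums (2 * pi * w l)"
      using sums_single[of l "\<lambda>j. complex_of_real (2 * pi) * w l"] by simp
    moreover have "(\<Sum>j. F j \<theta>) = cis (real l * \<theta>) * W \<theta>" for \<theta>
    proof -
      have "F j \<theta> = cis (real l * \<theta>) * (w j * cis (- real j * \<theta>))" for j
        by (simp add: F_def cis_mult algebra_simps)
      moreover have "summable (\<lambda>j. w j * cis (- real j * \<theta>))"
        by (rule summable_norm_cancel) (use w in \<open>simp add: norm_mult\<close>)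
      ultimately show ?thesis unfolding W_def by (simp only: suminf_mult)
    qed
    ultimately show ?thesis by (simp only: sums_unique2)
  qed
  define G where "G = (\<lambda>l \<theta>. f l * (cis (real l * \<theta>) * W \<theta>))"
  have nG: "norm (G l \<theta>) \<le> norm (f l) * (\<Sum>j. norm (w j))" for l \<theta>
    unfolding G_def by (simp add: norm_mult mult_left_mono bW)
  have sG: "summable (\<lambda>l. norm (G l \<theta>))" for \<theta>
    by (rule summable_comparison_test'[OF summable_mult2[OF f, of "\<Sum>j. norm (w j)"], of 0]) (use nG in auto)
  have "(\<lambda>l. integral\<^sup>L circle_measure (G l)) sums (\<integral>\<theta>. (\<Sum>l. G l \<theta>) \<partial>circle_measure)"
  proof (rule sums_integral_dominated)
    show "G l \<in> borel_measurable circle_measure" for l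
      unfolding G_def by (intro borel_measurable_times borel_measurable_const mc mW)
    show "integrable circle_measure (\<lambda>_. \<Sum>l. norm (f l) * (\<Sum>j. norm (w j)))"
      using finite_circle_measure by (simp add: finite_measure.integrable_const)
    show "(\<Sum>l. norm (G l \<theta>)) \<le> (\<Sum>l. norm (f l) * (\<Sum>j. norm (w j)))" for \<theta>
      by (intro suminf_le nG sG summable_mult2 f)
  qed (rule sG)
  moreover have "integral\<^sup>L circle_measure (G l) = 2 * pi * (f l * w l)" for l
    unfolding G_def integral_mult_right_zero int1 by simp
  moreover have "(\<Sum>l. G l \<theta>) = (\<Sum>l. f l * cis (real l * \<theta>)) * W \<theta>" for \<theta>
  proof -
    have "summable (\<lambda>l. f l * cis (real l * \<theta>))"
      by (rule summable_norm_cancel) (use f in \<open>simp add: norm_mult\<close>)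
    from suminf_mult2[OF this] show ?thesis by (simp add: G_def mult_ac)
  qed
  ultimately show ?thesis by (simp add: W_def)
qed

section \<open>Gaussian integrals with a complex linear term\<close>

lemma gaussian_fourier:
  fixes t :: real and w :: complex
  assumes t: "t > 0"
  shows "integrable lborel (\<lambda>x. exp (- of_real (t * x\<^sup>2) + 2 * w * of_real x))"
    and "(\<integral>x. exp (- of_real (t * x\<^sup>2) + 2 * w * of_real x) \<partial>lborel) = of_real (sqrt (pi / t)) * exp (w\<^sup>2 / of_real t)"
proof -
  define p q where "p = Re w" and "q = Im w"
  have w: "w = of_real p + \<i> * of_real q" by (simp add: p_def q_def complex_eq_iff)
  \<comment> \<open>The scale satisfies t c^2 = 1/2. Then x = p/t + c y completes the square in the
    real part of w and turns the imaginary part into the frequency of the characteristic function of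
    the standard normal distribution.\<close>
  define c where "c = 1 / sqrt (2 * t)"
  have c: "c > 0" "c\<^sup>2 = 1 / (2 * t)" using t by (simp_all add: c_def power_divide)
  define g where "g = (\<lambda>x. exp (- of_real (t * x\<^sup>2) + 2 * w * of_real x))"
  define A where "A = exp (of_real (p\<^sup>2 / t) + 2 * \<i> * of_real (p * q / t))"
  define N where "N = (\<lambda>y. of_real (exp (- y\<^sup>2 / 2)) * iexp (2 * q * c * y))"
  have gN: "g (p / t + c * y) = A * N y" for y
  proof -
    have e1: "t * (p / t + c * y)\<^sup>2 = p\<^sup>2 / t + 2 * p * c * y + y\<^sup>2 / 2"
    proof -
      have "t * (p / t + c * y)\<^sup>2 = p\<^sup>2 / t + 2 * p * c * y + t * c\<^sup>2 * y\<^sup>2"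
        using t by (simp add: power2_eq_square field_simps)
      then show ?thesis using c t by simp
    qed
    have "- of_real (t * (p / t + c * y)\<^sup>2) + 2 * w * complex_of_real (p / t + c * y)
       = (of_real (p\<^sup>2 / t) + 2 * \<i> * of_real (p * q / t)) + (of_real (- y\<^sup>2 / 2) + \<i> * of_real (2 * q * c * y))"
      unfolding e1 w using t by (simp add: complex_eq_iff power2_eq_square field_simps)
    then show ?thesis unfolding g_def A_def N_def exp_of_real[symmetric] by (simp only: exp_add mult_ac)
  qed
  have sn: "prob_space std_normal_distribution"
    by (intro prob_space_normal_density) simp
  have std: "std_normal_density y = 1 / sqrt (2 * pi) * exp (- y\<^sup>2 / 2)" for y
    by (simp add: std_normal_density_def)
  have "complex_integrable std_normal_distribution (\<lambda>y. iexp (2 * q * c * y))"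
    by (intro finite_measure.integrable_const_bound[OF prob_space.finite_measure[OF sn], where B=1] AE_I2) auto
  then have i1: "complex_integrable lborel (\<lambda>y. std_normal_density y *\<^sub>R iexp (2 * q * c * y))"
    by (subst (asm) integrable_density) auto
  have "char std_normal_distribution (2 * q * c) = (\<integral>y. std_normal_density y *\<^sub>R iexp (2 * q * c * y) \<partial>lborel)"
    unfolding char_def by (subst integral_density) auto
  then have I1: "(\<integral>y. std_normal_density y *\<^sub>R iexp (2 * q * c * y) \<partial>lborel) = exp (- (2 * q * c)\<^sup>2 / 2)"
    by (simp add: char_std_normal_distribution)
  have Nstd: "N y = of_real (sqrt (2 * pi)) * (std_normal_density y *\<^sub>R iexp (2 * q * c * y))" for y
    by (simp add: N_def std scaleR_conv_of_real)
  have iN: "integrable lborel N" unfolding Nstd by (intro integrable_mult_right i1)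
  have IN: "(\<integral>y. N y \<partial>lborel) = of_real (sqrt (2 * pi) * exp (- q\<^sup>2 / t))"
  proof -
    have "- (2 * q * c)\<^sup>2 / 2 = - q\<^sup>2 / t" using c t by (simp add: power_mult_distrib)
    then show ?thesis unfolding Nstd integral_mult_right_zero I1 by simp
  qed
  have "integrable lborel (\<lambda>y. g (p / t + c * y))" unfolding gN by (intro integrable_mult_right iN)
  then have "integrable lborel g"
    using lborel_integrable_real_affine_iff[of c g "p / t"] c by simp
  then show "integrable lborel (\<lambda>x. exp (- of_real (t * x\<^sup>2) + 2 * w * of_real x))" by (simp add: g_def)
  have "(\<integral>x. g x \<partial>lborel) = \<bar>c\<bar> *\<^sub>R (\<integral>y. g (p / t + c * y) \<partial>lborel)"
    by (rule lborel_integral_real_affine) (use c in simp)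
  also have "\<dots> = of_real (c * sqrt (2 * pi)) * (A * of_real (exp (- q\<^sup>2 / t)))"
    unfolding gN integral_mult_right_zero IN using c by (simp add: scaleR_conv_of_real mult_ac)
  also have "c * sqrt (2 * pi) = sqrt (pi / t)" using t by (simp add: c_def real_sqrt_divide real_sqrt_mult)
  also have "A * of_real (exp (- q\<^sup>2 / t)) = exp (w\<^sup>2 / of_real t)"
  proof -
    have "w\<^sup>2 / of_real t = (of_real (p\<^sup>2 / t) + 2 * \<i> * of_real (p * q / t)) + of_real (- q\<^sup>2 / t)"
      unfolding w using t by (simp add: complex_eq_iff power2_eq_square field_simps)
    then show ?thesis unfolding A_def exp_of_real[symmetric] by (simp only: exp_add)
  qed
  finally show "(\<integral>x. exp (- of_real (t * x\<^sup>2) + 2 * w * of_real x) \<partial>lborel) = of_real (sqrt (pi / t)) * exp (w\<^sup>2 / of_real t)"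
    by (simp add: g_def)
qed

lemma integrable_gaussian_exp:
  fixes t c :: real
  assumes t: "t > 0"
  shows "integrable lborel (\<lambda>x. exp (- t * x\<^sup>2 + c * x))"
proof -
  have "integrable lborel (\<lambda>x. norm (exp (- of_real (t * x\<^sup>2) + 2 * complex_of_real (c / 2) * of_real x)))"
    by (intro integrable_norm gaussian_fourier(1) t)
  then show ?thesis by simp
qed

lemma integrable_gaussian_abs:
  fixes t c :: real
  assumes t: "t > 0"
  shows "integrable lborel (\<lambda>x. exp (- t * x\<^sup>2 + c * \<bar>x\<bar>))"
proof (rule Bochner_Integration.integrable_bound)
  show "integrable lborel (\<lambda>x. exp (- t * x\<^sup>2 + c * x) + exp (- t * x\<^sup>2 + (- c) * x))"
    by (intro Bochner_Integration.integrable_add integrable_gaussian_exp t)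
  show "AE x in lborel. norm (exp (- t * x\<^sup>2 + c * \<bar>x\<bar>)) \<le> norm (exp (- t * x\<^sup>2 + c * x) + exp (- t * x\<^sup>2 + (- c) * x))"
  proof (rule AE_I2)
    fix x :: real
    have "exp (- t * x\<^sup>2 + c * \<bar>x\<bar>) \<le> exp (- t * x\<^sup>2 + c * x) + exp (- t * x\<^sup>2 + (- c) * x)"
      by (cases "x \<ge> 0") auto
    also have "\<dots> \<le> norm (exp (- t * x\<^sup>2 + c * x) + exp (- t * x\<^sup>2 + (- c) * x))"
      unfolding real_norm_def by (rule abs_ge_self)
    finally show "norm (exp (- t * x\<^sup>2 + c * \<bar>x\<bar>)) \<le> norm (exp (- t * x\<^sup>2 + c * x) + exp (- t * x\<^sup>2 + (- c) * x))"
      by (simp only: real_norm_def abs_exp_cancel)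
  qed
qed auto

text \<open>The derivative (2w - 2tx) g of the Gaussian g integrates to 0 over the line, which
  expresses the first moment through the integral of g. It provides the odd-parity counterpart of
  the Fourier transform.\<close>

lemma gaussian_first_moment:
  fixes t :: real and w :: complex
  assumes t: "t > 0"
  shows "(\<integral>x. of_real x * exp (- of_real (t * x\<^sup>2) + 2 * w * of_real x) \<partial>lborel)
      = w / of_real t * (of_real (sqrt (pi / t)) * exp (w\<^sup>2 / of_real t))"
proof -
  define g where "g = (\<lambda>x::real. exp (- of_real (t * x\<^sup>2) + 2 * w * of_real x))"
  have ig: "integrable lborel g" unfolding g_def by (rule gaussian_fourier(1)[OF t])
  have ng: "norm (g x) \<le> exp (- t * x\<^sup>2 + 2 * \<bar>Re w\<bar> * \<bar>x\<bar>)" for x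
    by (simp add: g_def abs_mult[symmetric])
  have ixg: "integrable lborel (\<lambda>x. of_real x * g x)"
  proof (rule Bochner_Integration.integrable_bound)
    show "integrable lborel (\<lambda>x. exp (- t * x\<^sup>2 + (2 * \<bar>Re w\<bar> + 1) * \<bar>x\<bar>))"
      by (rule integrable_gaussian_abs[OF t])
    show "AE x in lborel. norm (of_real x * g x) \<le> norm (exp (- t * x\<^sup>2 + (2 * \<bar>Re w\<bar> + 1) * \<bar>x\<bar>))"
    proof (rule AE_I2)
      fix x :: real
      have "\<bar>x\<bar> \<le> exp \<bar>x\<bar>" using exp_ge_add_one_self[of "\<bar>x\<bar>"] by linarith
      then have "norm (of_real x * g x) \<le> exp \<bar>x\<bar> * exp (- t * x\<^sup>2 + 2 * \<bar>Re w\<bar> * \<bar>x\<bar>)"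
        unfolding norm_mult using ng[of x] by (intro mult_mono) auto
      also have "\<dots> = exp (- t * x\<^sup>2 + (2 * \<bar>Re w\<bar> + 1) * \<bar>x\<bar>)"
        by (simp add: exp_add[symmetric] algebra_simps)
      finally show "norm (of_real x * g x) \<le> norm (exp (- t * x\<^sup>2 + (2 * \<bar>Re w\<bar> + 1) * \<bar>x\<bar>))" by simp
    qed
  qed (use ig in auto)
  define G where "G = (\<lambda>x. (2 * w) * g x - (2 * of_real t) * (of_real x * g x))"
  have iG: "integrable lborel G" unfolding G_def by (intro Bochner_Integration.integrable_diff integrable_mult_right ig ixg)
  have dg: "(g has_vector_derivative G x) (at x within A)" for x A
  proof -
    have "((\<lambda>z. exp (- (of_real t * z\<^sup>2) + 2 * w * z)) has_field_derivative 
        (2 * w - 2 * of_real t * of_real x) * exp (- (of_real t * (of_real x)\<^sup>2) + 2 * w * of_real x)) (at (of_real x))"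
      by (auto intro!: derivative_eq_intros simp: algebra_simps)
    from has_vector_derivative_real_field[OF this] show ?thesis
      by (simp add: g_def G_def algebra_simps)
  qed
  have "integral {- real n..real n} G = g (real n) - g (- real n)" for n
    by (rule integral_unique, rule fundamental_theorem_of_calculus) (auto intro: dg)
  then have "(\<lambda>n. g (real n) - g (- real n)) \<longlonglongrightarrow> (\<integral>x. G x \<partial>lborel)"
    using vertical_line_integral_limit[OF iG] by simp
  moreover have "(\<lambda>n. g (real n) - g (- real n)) \<longlonglongrightarrow> 0 - 0"
  proof (intro tendsto_diff)
    have l: "(\<lambda>n. exp (- t * (real n)\<^sup>2 + 2 * \<bar>Re w\<bar> * \<bar>real n\<bar>)) \<longlonglongrightarrow> 0"
    proof -
      have "((\<lambda>x. exp (- t * x\<^sup>2 + (2 * \<bar>Re w\<bar>) * x)) \<longlongrightarrow> 0) at_top" using t by real_asymp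
      from filterlim_compose[OF this filterlim_real_sequentially] show ?thesis by simp
    qed
    show "(\<lambda>n. g (real n)) \<longlonglongrightarrow> 0" "(\<lambda>n. g (- real n)) \<longlonglongrightarrow> 0"
      using ng[of "real n" for n] ng[of "- real n" for n]
      by (auto intro!: Lim_null_comparison[OF _ l] always_eventually)
  qed
  ultimately have "(\<integral>x. G x \<partial>lborel) = 0" using LIMSEQ_unique by fastforce
  then have "2 * of_real t * (\<integral>x. of_real x * g x \<partial>lborel) = 2 * w * (\<integral>x. g x \<partial>lborel)"
    unfolding G_def by (subst (asm) Bochner_Integration.integral_diff) (auto intro: ig ixg)
  then have "(\<integral>x. of_real x * g x \<partial>lborel) = w / of_real t * (\<integral>x. g x \<partial>lborel)" using t by (simp add: field_simps)
  then show ?thesis unfolding g_def gaussian_fourier(2)[OF t] .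
qed

text \<open>The even or odd part of exp, that is cosh or sinh, so that one power series with
  exponents 2l + \<delta> serves both parities.\<close>

definition hyp :: "nat \<Rightarrow> real \<Rightarrow> real" where
  "hyp \<delta> x = (exp x + (-1) ^ \<delta> * exp (- x)) / 2"

definition trig :: "nat \<Rightarrow> real \<Rightarrow> real" where
  "trig \<delta> x = (if \<delta> = 0 then cos x else sin x)"

lemma hyp_sums:
  assumes "\<delta> = 0 \<or> \<delta> = 1"
  shows "(\<lambda>l. x ^ (2 * l + \<delta>) / fact (2 * l + \<delta>)) sums hyp \<delta> x"
proof -
  have "(\<lambda>n. (x ^ n /\<^sub>R fact n + (-1) ^ \<delta> * ((- x) ^ n /\<^sub>R fact n)) / 2) sums hyp \<delta> x"
    unfolding hyp_def by (intro sums_divide sums_add sums_mult exp_converges)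
  moreover have "(x ^ n /\<^sub>R fact n + (-1) ^ \<delta> * ((- x) ^ n /\<^sub>R fact n)) / 2 = (if even n = (\<delta> = 0) then x ^ n / fact n else 0)" for n
    using assms by (elim disjE; cases "even n") (simp_all add: field_simps)
  ultimately have *: "(\<lambda>n. if even n = (\<delta> = 0) then x ^ n / fact n else 0) sums hyp \<delta> x" by simp
  have "strict_mono (\<lambda>l. 2 * l + \<delta>)" by (auto simp: strict_mono_def)
  moreover have "(if even n = (\<delta> = 0) then x ^ n / fact n else 0) = 0" if "n \<notin> range (\<lambda>l. 2 * l + \<delta>)" for n
  proof -
    have "\<not> (even n = (\<delta> = 0))"
    proof
      assume e: "even n = (\<delta> = 0)"
      then have "n = 2 * (n div 2) + \<delta>" using assms by (auto elim!: oddE evenE)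
      then show False using that by blast
    qed
    then show ?thesis by (rule if_not_P)
  qed
  ultimately have "(\<lambda>l. if even (2 * l + \<delta>) = (\<delta> = 0) then x ^ (2 * l + \<delta>) / fact (2 * l + \<delta>) else 0) sums hyp \<delta> x"
    using sums_mono_reindex[of "\<lambda>l. 2 * l + \<delta>" "\<lambda>n. if even n = (\<delta> = 0) then x ^ n / fact n else 0"] * by simp
  moreover have "even (2 * l + \<delta>) = (\<delta> = 0)" for l using assms by auto
  ultimately show ?thesis by simp
qed

text \<open>The two exponentials of \<open>hyp\<close> move the linear coefficient to z + im and -z
  + im. Both squares have real part z^2 - m^2, and their opposite imaginary parts 2mz and -2mz
  recombine to a cosine, or to i times a sine.\<close>

lemma gaussian_hyp:
  fixes t z m :: real
  assumes t: "t > 0" and \<delta>: "\<delta> = 0 \<or> \<delta> = 1"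
  shows "(\<integral>x. of_real (hyp \<delta> (2 * x * z)) * exp (- of_real (t * x\<^sup>2) + 2 * (\<i> * of_real m) * of_real x) \<partial>lborel)
    = \<i> ^ \<delta> * of_real (sqrt (pi / t) * exp ((z\<^sup>2 - m\<^sup>2) / t) * trig \<delta> (2 * m * z / t))"
proof -
  define e where "e = (\<lambda>w x. exp (- complex_of_real (t * x\<^sup>2) + 2 * w * of_real x))"
  define w1 w2 where "w1 = of_real z + \<i> * complex_of_real m" and "w2 = of_real (- z) + \<i> * complex_of_real m"
  define u where "u = 2 * m * z / t"
  have "of_real (hyp \<delta> (2 * x * z)) * exp (- of_real (t * x\<^sup>2) + 2 * (\<i> * of_real m) * of_real x) =
      (1/2) * e w1 x + ((-1) ^ \<delta> / 2) * e w2 x" for x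
  proof -
    have 1: "e w1 x = of_real (exp (2 * x * z)) * exp (- of_real (t * x\<^sup>2) + 2 * (\<i> * of_real m) * of_real x)"
      unfolding e_def w1_def exp_of_real[symmetric] exp_add[symmetric] by (rule arg_cong[of _ _ exp]) (simp add: algebra_simps)
    have 2: "e w2 x = of_real (exp (- (2 * x * z))) * exp (- of_real (t * x\<^sup>2) + 2 * (\<i> * of_real m) * of_real x)"
      unfolding e_def w2_def exp_of_real[symmetric] exp_add[symmetric] by (rule arg_cong[of _ _ exp]) (simp add: algebra_simps)
    show ?thesis unfolding 1 2 by (simp add: hyp_def algebra_simps add_divide_distrib)
  qed
  then have "(\<integral>x. of_real (hyp \<delta> (2 * x * z)) * exp (- of_real (t * x\<^sup>2) + 2 * (\<i> * of_real m) * of_real x) \<partial>lborel)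
      = (\<integral>x. (1/2) * e w1 x + ((-1) ^ \<delta> / 2) * e w2 x \<partial>lborel)" by presburger
  also have "\<dots> = (1/2) * (\<integral>x. e w1 x \<partial>lborel) + ((-1) ^ \<delta> / 2) * (\<integral>x. e w2 x \<partial>lborel)"
    unfolding e_def
    by (subst Bochner_Integration.integral_add; (intro integrable_mult_right gaussian_fourier(1) t)?) (simp only: integral_mult_right_zero)
  also have "\<dots> = of_real (sqrt (pi / t)) * ((exp (w1\<^sup>2 / of_real t) + (-1) ^ \<delta> * exp (w2\<^sup>2 / of_real t)) / 2)"
    unfolding e_def gaussian_fourier(2)[OF t] by (simp add: algebra_simps add_divide_distrib)
  also have "w1\<^sup>2 / of_real t = of_real ((z\<^sup>2 - m\<^sup>2) / t) + \<i> * of_real u"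
    unfolding w1_def u_def using t by (simp add: complex_eq_iff power2_eq_square field_simps)
  also have "w2\<^sup>2 / of_real t = of_real ((z\<^sup>2 - m\<^sup>2) / t) - \<i> * of_real u"
    unfolding w2_def u_def using t by (simp add: complex_eq_iff power2_eq_square field_simps)
  also have "(exp (of_real ((z\<^sup>2 - m\<^sup>2) / t) + \<i> * of_real u) + (-1) ^ \<delta> * exp (of_real ((z\<^sup>2 - m\<^sup>2) / t) - \<i> * of_real u)) / 2
     = of_real (exp ((z\<^sup>2 - m\<^sup>2) / t)) * (\<i> ^ \<delta> * of_real (trig \<delta> u))"
  proof -
    have a: "(exp (\<i> * of_real u) + (-1) ^ \<delta> * exp (- (\<i> * of_real u))) / 2 = \<i> ^ \<delta> * complex_of_real (trig \<delta> u)"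
      using \<delta> by (auto simp: trig_def cos_of_real[symmetric] sin_of_real[symmetric] cos_exp_eq sin_exp_eq field_simps)
    show ?thesis unfolding a[symmetric] exp_of_real[symmetric] exp_add exp_diff
      by (simp add: exp_minus field_simps)
  qed
  finally show ?thesis by (simp add: u_def mult_ac)
qed

text \<open>
  On the circle of radius r about t the l-th Taylor coefficient at t of a function is multiplied by
  r^l times this weight. The weights are chosen such that the coefficients
  (- x^2)^l / l! of exp(- x^2 (\<open>\<tau>\<close> - t)), times x^\<open>\<delta>\<close>, become those of cosh(2xz) or sinh(2xz).
\<close>

definition shift_coeff :: "nat \<Rightarrow> real \<Rightarrow> real \<Rightarrow> nat \<Rightarrow> complex" where
  "shift_coeff \<delta> r z l = of_real ((-1) ^ l * fact l * (2 * z) ^ (2 * l + \<delta>) / (fact (2 * l + \<delta>) * r ^ l))"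

text \<open>The negative frequencies make integration over the circle pick out Taylor coefficients,
  because the l-th power of the circle variable carries the frequency +l.\<close>

definition shift_kernel :: "nat \<Rightarrow> real \<Rightarrow> real \<Rightarrow> real \<Rightarrow> complex" where
  "shift_kernel \<delta> r z \<theta> = (\<Sum>l. shift_coeff \<delta> r z l * cis (- real l * \<theta>))"

text \<open>Since l!^2 <= (2l)!, the quotient l!/(2l + \<delta>)! is at most 1/l!, which beats the
  geometric factor (4 z^2 / r)^l for every radius. The kernel is therefore bounded for all z,
  however small the circle.\<close>

lemma summable_shift_coeff:
  assumes r: "r > 0"
  shows "summable (\<lambda>l. norm (shift_coeff \<delta> r z l))"
proof -
  have "summable (\<lambda>l. (2 * \<bar>z\<bar>) ^ \<delta> * (((2 * z)\<^sup>2 / r) ^ l / fact l))"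
    using summable_exp[of "(2 * z)\<^sup>2 / r"] by (intro summable_mult) (simp add: field_simps)
  then show ?thesis
  proof (rule summable_comparison_test'[where N = 0])
    fix l :: nat
    have "(fact l * fact l :: nat) \<le> fact (2 * l)"
      using fact_fact_dvd_fact[of l l] by (intro dvd_imp_le) (auto simp: mult_2)
    also have "(fact (2 * l) :: nat) \<le> fact (2 * l + \<delta>)" by (rule fact_mono_nat) simp
    finally have "fact l * fact l \<le> (fact (2 * l + \<delta>) :: real)"
      by (metis of_nat_fact of_nat_le_iff of_nat_mult)
    then have f: "fact l / fact (2 * l + \<delta>) \<le> 1 / (fact l :: real)" by (simp add: field_simps)
    have "norm (shift_coeff \<delta> r z l) = (fact l / fact (2 * l + \<delta>)) * ((2 * \<bar>z\<bar>) ^ \<delta> * ((2 * z)\<^sup>2 / r) ^ l)"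
      using r by (simp add: shift_coeff_def norm_mult norm_divide norm_power abs_mult power_abs power_add power_mult power_divide
          power_mult_distrib abs_of_pos)
    also have "\<dots> \<le> (1 / fact l) * ((2 * \<bar>z\<bar>) ^ \<delta> * ((2 * z)\<^sup>2 / r) ^ l)"
      using r by (intro mult_right_mono f) auto
    finally show "norm (norm (shift_coeff \<delta> r z l)) \<le> (2 * \<bar>z\<bar>) ^ \<delta> * (((2 * z)\<^sup>2 / r) ^ l / fact l)"
      by (simp add: mult_ac)
  qed
qed

lemma shift_kernel_measurable: "shift_kernel \<delta> r z \<in> borel_measurable circle_measure"
  unfolding shift_kernel_def
  by (intro borel_measurable_suminf borel_measurable_times borel_measurable_const measurable_circle_measure
      borel_measurable_continuous_onI continuous_intros)

lemma norm_shift_kernel_le: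
  assumes "r > 0"
  shows "norm (shift_kernel \<delta> r z \<theta>) \<le> (\<Sum>l. norm (shift_coeff \<delta> r z l))"
  unfolding shift_kernel_def by (rule norm_suminf_le[OF _ summable_shift_coeff[OF assms]]) (simp add: norm_mult)

lemma shift_power_series:
  fixes c :: "nat \<Rightarrow> complex"
  assumes r: "r > 0" and c: "summable (\<lambda>l. norm (c l) * r ^ l)"
  shows "(\<lambda>l. 2 * pi * (c l * of_real r ^ l * shift_coeff \<delta> r z l)) sums
    (\<integral>\<theta>. (\<Sum>l. c l * (of_real r * cis \<theta>) ^ l) * shift_kernel \<delta> r z \<theta> \<partial>circle_measure)"
proof -
  have "summable (\<lambda>l. norm (c l * of_real r ^ l))" using c r by (simp add: norm_mult norm_power)
  from circle_pairing[OF this summable_shift_coeff[OF r, of \<delta> z]]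
  show ?thesis by (simp add: shift_kernel_def power_mult_distrib Complex.DeMoivre mult_ac)
qed

text \<open>In the product of coefficient and weight the signs, the factor l! and the radius cancel;
  x^(2l) and x^\<delta> combine to x^(2l + \<delta>), leaving the series of \<open>hyp\<close> at
  2xz.\<close>

lemma shift_gaussian:
  fixes t r x z :: real
  assumes r: "r > 0" and \<delta>: "\<delta> = 0 \<or> \<delta> = 1"
  shows "(\<integral>\<theta>. (of_real x ^ \<delta> * exp (- of_real (x\<^sup>2) * (of_real t + of_real r * cis \<theta>))) * shift_kernel \<delta> r z \<theta> \<partial>circle_measure)
    = 2 * pi * complex_of_real (exp (- t * x\<^sup>2) * hyp \<delta> (2 * x * z))"
proof -
  define c where "c = (\<lambda>l. complex_of_real (x ^ \<delta> * exp (- t * x\<^sup>2) * (- x\<^sup>2) ^ l / fact l))"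
  have sc: "summable (\<lambda>l. norm (c l) * r ^ l)"
  proof -
    have "summable (\<lambda>l. \<bar>x\<bar> ^ \<delta> * exp (- t * x\<^sup>2) * ((x\<^sup>2 * r) ^ l / fact l))"
      using summable_exp[of "x\<^sup>2 * r"] by (intro summable_mult) (simp add: field_simps)
    then show ?thesis by (simp add: c_def norm_mult norm_divide abs_mult power_abs norm_power power_mult_distrib mult_ac)
  qed
  have series: "(\<Sum>l. c l * (of_real r * cis \<theta>) ^ l) = of_real x ^ \<delta> * exp (- of_real (x\<^sup>2) * (of_real t + of_real r * cis \<theta>))" for \<theta>
  proof -
    define h where "h = of_real r * cis \<theta>"
    have "(\<lambda>l. (of_real x ^ \<delta> * exp (- of_real (t * x\<^sup>2))) * ((- of_real (x\<^sup>2) * h) ^ l /\<^sub>R fact l)) sums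
       ((of_real x ^ \<delta> * exp (- of_real (t * x\<^sup>2))) * exp (- of_real (x\<^sup>2) * h))"
      by (intro sums_mult exp_converges)
    moreover have "(of_real x ^ \<delta> * exp (- of_real (t * x\<^sup>2))) * ((- of_real (x\<^sup>2) * h) ^ l /\<^sub>R fact l) = c l * h ^ l" for l
    proof -
      have "(- of_real (x\<^sup>2) * h) ^ l = of_real ((- x\<^sup>2) ^ l) * h ^ l"
        by (simp only: power_mult_distrib of_real_power of_real_minus)
      then show ?thesis by (simp add: c_def scaleR_conv_of_real exp_of_real[symmetric] field_simps)
    qed
    moreover have "(of_real x ^ \<delta> * exp (- of_real (t * x\<^sup>2))) * exp (- of_real (x\<^sup>2) * h) = of_real x ^ \<delta> * exp (- of_real (x\<^sup>2) * (of_real t + h))"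
      by (simp add: exp_add[symmetric] algebra_simps)
    ultimately show ?thesis by (simp add: sums_iff h_def)
  qed
  have "(\<lambda>l. 2 * pi * (c l * of_real r ^ l * shift_coeff \<delta> r z l)) sums
     (\<integral>\<theta>. (of_real x ^ \<delta> * exp (- of_real (x\<^sup>2) * (of_real t + of_real r * cis \<theta>))) * shift_kernel \<delta> r z \<theta> \<partial>circle_measure)"
    using shift_power_series[OF r sc, of \<delta> z] unfolding series .
  moreover have "2 * pi * (c l * of_real r ^ l * shift_coeff \<delta> r z l) = 
      of_real (2 * pi * (exp (- t * x\<^sup>2) * ((2 * x * z) ^ (2 * l + \<delta>) / fact (2 * l + \<delta>))))" for l
  proof -
    have s1: "(- x\<^sup>2) ^ l = (-1) ^ l * (x\<^sup>2) ^ l" by (rule power_minus)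
    have s2: "(2 * x * z) ^ (2 * l + \<delta>) = (x\<^sup>2) ^ l * x ^ \<delta> * (2 * z) ^ (2 * l + \<delta>)"
    proof -
      have "x ^ (2 * l + \<delta>) = (x\<^sup>2) ^ l * x ^ \<delta>" by (simp only: power_add power_mult)
      moreover have "2 * x * z = x * (2 * z)" by simp
      ultimately show ?thesis by (simp only: power_mult_distrib[of x])
    qed
    have s3: "(-1) ^ l * ((-1) ^ l * y) = (y :: real)" for y
      by (simp add: mult.assoc[symmetric] power_mult_distrib[symmetric])
    have "x ^ \<delta> * exp (- t * x\<^sup>2) * (- x\<^sup>2) ^ l / fact l * r ^ l * ((-1) ^ l * fact l * (2 * z) ^ (2 * l + \<delta>) / (fact (2 * l + \<delta>) * r ^ l))
       = (-1) ^ l * ((-1) ^ l * (exp (- t * x\<^sup>2) * ((x\<^sup>2) ^ l * x ^ \<delta> * (2 * z) ^ (2 * l + \<delta>) / fact (2 * l + \<delta>))))"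
      unfolding s1 using r by simp
    then have "x ^ \<delta> * exp (- t * x\<^sup>2) * (- x\<^sup>2) ^ l / fact l * r ^ l * ((-1) ^ l * fact l * (2 * z) ^ (2 * l + \<delta>) / (fact (2 * l + \<delta>) * r ^ l))
       = exp (- t * x\<^sup>2) * ((2 * x * z) ^ (2 * l + \<delta>) / fact (2 * l + \<delta>))"
      unfolding s2 s3 .
    then show ?thesis
      unfolding c_def shift_coeff_def by (simp only: of_real_mult[symmetric] of_real_power[symmetric])
  qed
  moreover have "(\<lambda>l. complex_of_real (2 * pi * (exp (- t * x\<^sup>2) * ((2 * x * z) ^ (2 * l + \<delta>) / fact (2 * l + \<delta>))))) sums
      of_real (2 * pi * (exp (- t * x\<^sup>2) * hyp \<delta> (2 * x * z)))"
    by (intro sums_of_real sums_mult hyp_sums \<delta>)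
  ultimately show ?thesis using sums_unique2 by fastforce
qed

text \<open>
  A dual Gaussian is the Fourier transform of a Gaussian; expanding the latter in powers of \<open>\<tau>\<close> - t
  shows how the shift functional acts on it.
\<close>

definition dual_gaussian :: "nat \<Rightarrow> real \<Rightarrow> complex \<Rightarrow> complex" where
  "dual_gaussian \<delta> m \<tau> = of_real m ^ \<delta> * \<tau> powr of_real (- 1/2 - real \<delta>) * exp (- of_real (m\<^sup>2) * (1 / \<tau>))"

text \<open>The Fourier transform for \<delta> = 0 and the first moment for \<delta> = 1. Dividing
  the latter by t once more is what turns t^(-1/2) into t^(-1/2 - \<delta>).\<close>

lemma dual_gaussian_integral:
  fixes t m :: real
  assumes t: "t > 0" and \<delta>: "\<delta> = 0 \<or> \<delta> = 1"
  shows "(\<integral>x. of_real x ^ \<delta> * exp (- of_real (t * x\<^sup>2) + 2 * (\<i> * of_real m) * of_real x) \<partial>lborel)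
     = \<i> ^ \<delta> * of_real (sqrt pi) * dual_gaussian \<delta> m (of_real t)"
proof -
  have p: "complex_of_real t powr of_real (- 1/2 - real \<delta>) = of_real (1 / (sqrt t * t ^ \<delta>))"
  proof -
    have "t powr (- 1/2 - real \<delta>) = 1 / (sqrt t * t ^ \<delta>)"
      using t by (simp add: powr_diff powr_minus_divide powr_half_sqrt powr_realpow)
    then show ?thesis using t by (subst powr_of_real) auto
  qed
  have s: "sqrt (pi / t) = sqrt pi * (1 / sqrt t)" by (simp add: real_sqrt_divide)
  have e: "(\<i> * of_real m)\<^sup>2 / complex_of_real t = - of_real (m\<^sup>2) * (1 / of_real t)"
    by (simp add: power_mult_distrib)
  from \<delta> show ?thesis
  proof
    assume d: "\<delta> = 0"
    then show ?thesis
      using gaussian_fourier(2)[OF t, of "\<i> * of_real m"] unfolding dual_gaussian_def p e s by simp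
  next
    assume d: "\<delta> = 1"
    then show ?thesis
      using gaussian_first_moment[OF t, of "\<i> * of_real m"] unfolding dual_gaussian_def p e s by (simp add: field_simps)
  qed
qed

text \<open>The functional is moved inside the Fourier integral over x, where it meets ordinary
  Gaussians and produces \<open>hyp \<delta> (2 * x * z)\<close>; \<open>gaussian_hyp\<close> then
  evaluates the integral. The condition r < t keeps enough Gaussian decay in x for expanding in
  powers of \<tau> - t under the integral.\<close>

lemma shift_dual_gaussian:
  fixes t r m z :: real
  assumes r: "0 < r" "r < t" and \<delta>: "\<delta> = 0 \<or> \<delta> = 1"
  shows "(\<integral>\<theta>. dual_gaussian \<delta> m (of_real t + of_real r * cis \<theta>) * shift_kernel \<delta> r z \<theta> \<partial>circle_measure)
    = 2 * pi * complex_of_real (t powr (- 1/2) * exp ((z\<^sup>2 - m\<^sup>2) / t) * trig \<delta> (2 * m * z / t))"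
proof -
  define E where "E = (\<lambda>x::real. exp (- of_real (t * x\<^sup>2) + 2 * (\<i> * complex_of_real m) * of_real x))"
  have t: "t > 0" using r by simp
  have nE: "norm (E x) = exp (- t * x\<^sup>2)" for x by (simp add: E_def)
  have mE: "E \<in> borel_measurable borel" unfolding E_def by measurable
  define M where "M = (\<lambda>l. (\<integral>x. of_real (x ^ (2 * l + \<delta>)) * E x \<partial>lborel))"
  define F where "F = (\<lambda>(h::complex) l x. ((- h) ^ l / fact l) * (of_real (x ^ (2 * l + \<delta>)) * E x))"
  have expsum: "(\<lambda>l. (\<rho> * x\<^sup>2) ^ l / fact l) sums exp (\<rho> * x\<^sup>2)" for \<rho> x :: real
    using exp_converges[of "\<rho> * x\<^sup>2"] by (simp add: field_simps)
  have nF: "norm (F h l x) = (\<bar>x\<bar> ^ \<delta> * exp (- t * x\<^sup>2)) * ((norm h * x\<^sup>2) ^ l / fact l)" for h l x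
  proof -
    have "\<bar>x\<bar> ^ (2 * l) = (x\<^sup>2) ^ l" by (simp add: power_mult)
    then show ?thesis unfolding F_def
      by (simp add: norm_mult norm_divide norm_power nE power_add power_mult_distrib)
  qed
  have sF: "summable (\<lambda>l. norm (F h l x))" and sF': "(\<Sum>l. norm (F h l x)) = \<bar>x\<bar> ^ \<delta> * exp (- (t - norm h) * x\<^sup>2)" for h x
  proof -
    have "(\<lambda>l. norm (F h l x)) sums ((\<bar>x\<bar> ^ \<delta> * exp (- t * x\<^sup>2)) * exp (norm h * x\<^sup>2))"
      unfolding nF by (intro sums_mult expsum)
    moreover have "(\<bar>x\<bar> ^ \<delta> * exp (- t * x\<^sup>2)) * exp (norm h * x\<^sup>2) = \<bar>x\<bar> ^ \<delta> * exp (- (t - norm h) * x\<^sup>2)"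
      by (simp add: exp_add[symmetric] algebra_simps)
    ultimately show "summable (\<lambda>l. norm (F h l x))" "(\<Sum>l. norm (F h l x)) = \<bar>x\<bar> ^ \<delta> * exp (- (t - norm h) * x\<^sup>2)"
      by (auto simp: sums_iff)
  qed
  have dom: "(\<lambda>l. integral\<^sup>L lborel (F h l)) sums (\<integral>x. (\<Sum>l. F h l x) \<partial>lborel)"
       "summable (\<lambda>l. \<integral>x. norm (F h l x) \<partial>lborel)" if h: "norm h < t" for h
  proof -
    have m: "F h l \<in> borel_measurable lborel" for l unfolding F_def using mE by measurable
    have i: "integrable lborel (\<lambda>x. exp (- (t - norm h) * x\<^sup>2 + 1 * \<bar>x\<bar>))"
      using h by (intro integrable_gaussian_abs) simp
    have le: "(\<Sum>l. norm (F h l x)) \<le> exp (- (t - norm h) * x\<^sup>2 + 1 * \<bar>x\<bar>)" for x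
    proof -
      have "\<bar>x\<bar> ^ \<delta> \<le> exp \<bar>x\<bar>"
        using \<delta> exp_ge_add_one_self[of "\<bar>x\<bar>"] by (elim disjE) (auto intro: order_trans[of _ "1 + \<bar>x\<bar>"])
      then have "\<bar>x\<bar> ^ \<delta> * exp (- (t - norm h) * x\<^sup>2) \<le> exp \<bar>x\<bar> * exp (- (t - norm h) * x\<^sup>2)"
        by (intro mult_right_mono) auto
      then show ?thesis unfolding sF' by (simp only: exp_add mult_ac mult_1_left mult_1_right)
    qed
    show "(\<lambda>l. integral\<^sup>L lborel (F h l)) sums (\<integral>x. (\<Sum>l. F h l x) \<partial>lborel)"
       "summable (\<lambda>l. \<integral>x. norm (F h l x) \<partial>lborel)"
      using sums_integral_dominated[OF m i sF le] by auto
  qed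
  define c where "c = (\<lambda>l. (- 1) ^ l / fact l * M l)"
  have IF: "integral\<^sup>L lborel (F h l) = c l * h ^ l" for h l
    unfolding F_def c_def M_def integral_mult_right_zero by (subst power_minus) (simp add: mult_ac)
  have sumF: "(\<Sum>l. F h l x) = of_real x ^ \<delta> * exp (- (of_real t + h) * of_real (x\<^sup>2) + 2 * (\<i> * complex_of_real m) * of_real x)" for h x
  proof -
    have "(\<lambda>l. (of_real x ^ \<delta> * E x) * ((- h * of_real (x\<^sup>2)) ^ l /\<^sub>R fact l)) sums ((of_real x ^ \<delta> * E x) * exp (- h * of_real (x\<^sup>2)))"
      by (intro sums_mult exp_converges)
    moreover have "(of_real x ^ \<delta> * E x) * ((- h * of_real (x\<^sup>2)) ^ l /\<^sub>R fact l) = F h l x" for l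
    proof -
      have "(- h * of_real (x\<^sup>2)) ^ l = (- h) ^ l * of_real x ^ (2 * l)"
        by (simp only: power_mult_distrib power_mult of_real_power)
      then show ?thesis by (simp add: F_def scaleR_conv_of_real power_add field_simps)
    qed
    moreover have "(of_real x ^ \<delta> * E x) * exp (- h * of_real (x\<^sup>2)) 
       = of_real x ^ \<delta> * exp (- (of_real t + h) * of_real (x\<^sup>2) + 2 * (\<i> * complex_of_real m) * of_real x)"
      unfolding E_def mult.assoc exp_add[symmetric] by (simp add: algebra_simps)
    ultimately show ?thesis by (simp add: sums_iff)
  qed
  \<comment> \<open>The Fourier formula is available for real parameters t + h only. Both J, as the
    sum of a power series, and g are holomorphic in |h| < t, so the identity theorem transfers it to
    the complex h on the circle.\<close>
  define J where "J = (\<lambda>h. \<integral>x. (\<Sum>l. F h l x) \<partial>lborel)"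
  have Jser: "(\<lambda>l. c l * h ^ l) sums J h" if "norm h < t" for h
    using dom(1)[OF that] unfolding IF J_def .
  have Jhol: "J holomorphic_on ball 0 t"
    by (rule power_series_holomorphic[where a = c]) (use Jser in \<open>auto simp: dist_norm\<close>)
  define g where "g = (\<lambda>h. \<i> ^ \<delta> * of_real (sqrt pi) * dual_gaussian \<delta> m (of_real t + h))"
  have rep: "Re (of_real t + h) > 0" if "h \<in> ball 0 t" for h :: complex
    using that abs_Re_le_cmod[of h] by (auto simp: dist_norm)
  have ghol: "g holomorphic_on ball 0 t"
  proof -
    have "of_real t + h \<notin> \<real>\<^sub>\<le>\<^sub>0" "of_real t + h \<noteq> 0" if "h \<in> ball 0 t" for h :: complex
      using rep[OF that] by (auto simp: complex_nonpos_Reals_iff complex_eq_iff)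
    then show ?thesis unfolding g_def dual_gaussian_def by (intro holomorphic_intros) auto
  qed
  have eqr: "J (of_real h) = g (of_real h)" if "\<bar>h\<bar> < t" for h
  proof -
    have th: "t + h > 0" using that by linarith
    have "J (of_real h) = (\<integral>x. of_real x ^ \<delta> * exp (- of_real ((t + h) * x\<^sup>2) + 2 * (\<i> * of_real m) * of_real x) \<partial>lborel)"
      unfolding J_def sumF by (simp add: algebra_simps)
    then show ?thesis unfolding dual_gaussian_integral[OF th \<delta>] g_def by simp
  qed
  have J_eq: "J h = g h" if h: "h \<in> ball 0 t" for h
    by (rule holomorphic_eq_of_eq_on_reals[where S = "ball 0 t" and p = 0 and f = J and g = g]) (use Jhol ghol eqr t h in \<open>auto simp: dist_norm\<close>)
  have sc: "summable (\<lambda>l. norm (c l) * r ^ l)"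
  proof (rule summable_comparison_test'[OF dom(2)[of "of_real r"], of 0])
    fix l
    have "norm (c l) * r ^ l = norm (integral\<^sup>L lborel (F (of_real r) l))"
      using r unfolding IF by (simp add: norm_mult norm_power)
    also have "\<dots> \<le> (\<integral>x. norm (F (of_real r) l x) \<partial>lborel)" by (rule integral_norm_bound)
    finally show "norm (norm (c l) * r ^ l) \<le> (\<integral>x. norm (F (of_real r) l x) \<partial>lborel)" using r by simp
  qed (use r in auto)
  have ser: "(\<Sum>l. c l * (of_real r * cis \<theta>) ^ l) = g (of_real r * cis \<theta>)" for \<theta>
  proof -
    have "norm (of_real r * cis \<theta>) < t" using r by (simp add: norm_mult)
    from Jser[OF this] J_eq[of "of_real r * cis \<theta>"] this show ?thesis by (simp add: sums_iff dist_norm)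
  qed
  have 1: "(\<lambda>l. 2 * pi * (c l * of_real r ^ l * shift_coeff \<delta> r z l)) sums
     (\<integral>\<theta>. g (of_real r * cis \<theta>) * shift_kernel \<delta> r z \<theta> \<partial>circle_measure)"
    using shift_power_series[OF r(1) sc, of \<delta> z] unfolding ser .
  define H where "H = (\<lambda>l x. of_real ((2 * x * z) ^ (2 * l + \<delta>) / fact (2 * l + \<delta>)) * E x)"
  have cH: "2 * pi * (c l * of_real r ^ l * shift_coeff \<delta> r z l) = 2 * pi * integral\<^sup>L lborel (H l)" for l
  proof -
    have "H l = (\<lambda>x. of_real ((2 * z) ^ (2 * l + \<delta>) / fact (2 * l + \<delta>)) * (of_real (x ^ (2 * l + \<delta>)) * E x))"
      by (rule ext) (simp add: H_def power_mult_distrib mult_ac)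
    then have "integral\<^sup>L lborel (H l) = of_real ((2 * z) ^ (2 * l + \<delta>) / fact (2 * l + \<delta>)) * M l"
      unfolding M_def by (simp only: integral_mult_right_zero)
    moreover have "(-1) ^ l * ((-1) ^ l * y) = (y :: complex)" for y
      by (simp add: mult.assoc[symmetric] power_mult_distrib[symmetric])
    then have "c l * of_real r ^ l * shift_coeff \<delta> r z l = of_real ((2 * z) ^ (2 * l + \<delta>) / fact (2 * l + \<delta>)) * M l"
      unfolding c_def shift_coeff_def using r by (simp add: field_simps)
    ultimately show ?thesis by simp
  qed
  have hs: "(\<lambda>l. \<bar>(2 * x * z) ^ (2 * l + \<delta>) / fact (2 * l + \<delta>)\<bar>) sums hyp \<delta> \<bar>2 * x * z\<bar>" for x
    using hyp_sums[OF \<delta>, of "\<bar>2 * x * z\<bar>"] by (simp add: abs_divide power_abs)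
  have nH: "norm (H l x) = \<bar>(2 * x * z) ^ (2 * l + \<delta>) / fact (2 * l + \<delta>)\<bar> * exp (- t * x\<^sup>2)" for l x
    unfolding H_def norm_mult nE norm_of_real by simp
  have nHs: "(\<lambda>l. norm (H l x)) sums (hyp \<delta> \<bar>2 * x * z\<bar> * exp (- t * x\<^sup>2))" for x
    unfolding nH by (intro sums_mult2 hs)
  have "(\<lambda>l. integral\<^sup>L lborel (H l)) sums (\<integral>x. (\<Sum>l. H l x) \<partial>lborel)"
  proof (rule sums_integral_dominated(4))
    show "H l \<in> borel_measurable lborel" for l unfolding H_def using mE by measurable
    show "integrable lborel (\<lambda>x. exp (- t * x\<^sup>2 + (2 * \<bar>z\<bar>) * \<bar>x\<bar>))" by (rule integrable_gaussian_abs[OF t])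
    show "summable (\<lambda>l. norm (H l x))" for x using nHs sums_summable by blast
    show "(\<Sum>l. norm (H l x)) \<le> exp (- t * x\<^sup>2 + (2 * \<bar>z\<bar>) * \<bar>x\<bar>)" for x
    proof -
      have "hyp \<delta> u \<le> exp u" if "u \<ge> 0" for u :: real
      proof -
        have "exp (- u) \<le> exp u" using that by simp
        moreover have "(-1) ^ \<delta> * exp (- u) \<le> exp (- u)" using \<delta> by (elim disjE) auto
        ultimately have X: "(-1) ^ \<delta> * exp (- u) \<le> exp u" by (rule order_trans[rotated])
        have "(exp u + y) / 2 \<le> exp u" if "y \<le> exp u" for y using that by simp
        from this[OF X] show ?thesis unfolding hyp_def .
      qed
      then have "hyp \<delta> \<bar>2 * x * z\<bar> * exp (- t * x\<^sup>2) \<le> exp \<bar>2 * x * z\<bar> * exp (- t * x\<^sup>2)"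
        by (intro mult_right_mono) auto
      also have "\<dots> = exp (- t * x\<^sup>2 + (2 * \<bar>z\<bar>) * \<bar>x\<bar>)" by (simp add: exp_add[symmetric] abs_mult algebra_simps)
      finally show ?thesis using nHs[of x] by (simp add: sums_iff)
    qed
  qed
  moreover have "(\<Sum>l. H l x) = of_real (hyp \<delta> (2 * x * z)) * E x" for x
  proof -
    have "(\<lambda>l. of_real ((2 * x * z) ^ (2 * l + \<delta>) / fact (2 * l + \<delta>)) * E x) sums (of_real (hyp \<delta> (2 * x * z)) * E x)"
      by (intro sums_mult2 sums_of_real hyp_sums \<delta>)
    then show ?thesis by (simp add: H_def sums_iff)
  qed
  ultimately have "(\<lambda>l. integral\<^sup>L lborel (H l)) sums (\<i> ^ \<delta> * of_real (sqrt (pi / t) * exp ((z\<^sup>2 - m\<^sup>2) / t) * trig \<delta> (2 * m * z / t)))"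
    using gaussian_hyp[OF t \<delta>, of z m] by (simp add: E_def)
  then have "(\<lambda>l. 2 * pi * integral\<^sup>L lborel (H l)) sums (2 * pi * (\<i> ^ \<delta> * of_real (sqrt (pi / t) * exp ((z\<^sup>2 - m\<^sup>2) / t) * trig \<delta> (2 * m * z / t))))"
    by (rule sums_mult)
  then have "(\<integral>\<theta>. g (of_real r * cis \<theta>) * shift_kernel \<delta> r z \<theta> \<partial>circle_measure) 
      = 2 * pi * (\<i> ^ \<delta> * of_real (sqrt (pi / t) * exp ((z\<^sup>2 - m\<^sup>2) / t) * trig \<delta> (2 * m * z / t)))"
    using 1 unfolding cH by (rule sums_unique2[symmetric])
  then have "(\<i> ^ \<delta> * of_real (sqrt pi)) * (\<integral>\<theta>. dual_gaussian \<delta> m (of_real t + of_real r * cis \<theta>) * shift_kernel \<delta> r z \<theta> \<partial>circle_measure)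
     = (\<i> ^ \<delta> * of_real (sqrt pi)) * (2 * pi * complex_of_real (t powr (- 1/2) * exp ((z\<^sup>2 - m\<^sup>2) / t) * trig \<delta> (2 * m * z / t)))"
  proof -
    have "sqrt (pi / t) = sqrt pi * t powr (- 1/2)"
      using t by (simp add: real_sqrt_divide powr_minus_divide powr_half_sqrt)
    then show ?thesis using \<open>(\<integral>\<theta>. g (of_real r * cis \<theta>) * shift_kernel \<delta> r z \<theta> \<partial>circle_measure) = _\<close>
      unfolding g_def mult.assoc integral_mult_right_zero by (simp only: of_real_mult mult_ac)
  qed
  then show ?thesis by simp
qed

section \<open>Termwise application of the functional and the shifted inversion formula\<close>

lemma continuous_bounded_on_circle:
  fixes f :: "real \<Rightarrow> complex"
  assumes "continuous_on UNIV f"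
  obtains K where "\<And>\<theta>. \<theta> \<in> {0..2 * pi} \<Longrightarrow> norm (f \<theta>) \<le> K"
proof -
  have "bounded (f ` {0..2 * pi})"
    using continuous_on_subset[OF assms] by (intro compact_imp_bounded compact_continuous_image) auto
  then show ?thesis using that unfolding bounded_iff by fast
qed

lemma integrable_times_shift_kernel:
  fixes f :: "real \<Rightarrow> complex"
  assumes r: "r > 0" and f: "continuous_on UNIV f"
  shows "integrable circle_measure (\<lambda>\<theta>. f \<theta> * shift_kernel \<delta> r z \<theta>)"
proof -
  obtain K where K: "\<And>\<theta>. \<theta> \<in> {0..2 * pi} \<Longrightarrow> norm (f \<theta>) \<le> K"
    using continuous_bounded_on_circle[OF f] by blast
  show ?thesis
  proof (rule integrable_circle_bounded)
    show "(\<lambda>\<theta>. f \<theta> * shift_kernel \<delta> r z \<theta>) \<in> borel_measurable circle_measure"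
      using f by (intro borel_measurable_times shift_kernel_measurable measurable_circle_measure borel_measurable_continuous_onI)
    fix \<theta> assume "\<theta> \<in> {0..2 * pi}"
    then show "norm (f \<theta> * shift_kernel \<delta> r z \<theta>) \<le> K * (\<Sum>l. norm (shift_coeff \<delta> r z l))"
      unfolding norm_mult using K[of \<theta>] norm_shift_kernel_le[OF r, of \<delta> z \<theta>] order_trans[OF norm_ge_zero K[of \<theta>]]
      by (intro mult_mono) auto
  qed
qed

text \<open>Continuity of the functional: a series with a uniform summable majorant on the circle
  may be paired term by term, because the kernel is bounded.\<close>

lemma sums_times_shift_kernel:
  fixes f :: "nat \<Rightarrow> real \<Rightarrow> complex"
  assumes r: "r > 0" and f: "\<And>m. continuous_on UNIV (f m)" and M: "summable M" "\<And>m \<theta>. norm (f m \<theta>) \<le> M m"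
  shows "(\<lambda>m. \<integral>\<theta>. f m \<theta> * shift_kernel \<delta> r z \<theta> \<partial>circle_measure) sums
    (\<integral>\<theta>. (\<Sum>m. f m \<theta>) * shift_kernel \<delta> r z \<theta> \<partial>circle_measure)"
proof -
  define S where "S = (\<Sum>l. norm (shift_coeff \<delta> r z l))"
  have b: "norm (f m \<theta> * shift_kernel \<delta> r z \<theta>) \<le> M m * S" for m \<theta>
    unfolding norm_mult S_def using M(2)[of m \<theta>] norm_shift_kernel_le[OF r, of \<delta> z \<theta>] order_trans[OF norm_ge_zero M(2)[of m \<theta>]]
    by (intro mult_mono) auto
  have sM: "summable (\<lambda>m. M m * S)" by (intro summable_mult2 M)
  have s: "summable (\<lambda>m. norm (f m \<theta> * shift_kernel \<delta> r z \<theta>))" for \<theta>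
    by (rule summable_comparison_test'[OF sM, of 0]) (use b in auto)
  have "(\<lambda>m. \<integral>\<theta>. f m \<theta> * shift_kernel \<delta> r z \<theta> \<partial>circle_measure) sums
    (\<integral>\<theta>. (\<Sum>m. f m \<theta> * shift_kernel \<delta> r z \<theta>) \<partial>circle_measure)"
  proof (rule sums_integral_dominated(4))
    show "(\<lambda>\<theta>. f m \<theta> * shift_kernel \<delta> r z \<theta>) \<in> borel_measurable circle_measure" for m
      using f by (intro borel_measurable_times shift_kernel_measurable measurable_circle_measure borel_measurable_continuous_onI)
    show "integrable circle_measure (\<lambda>_. \<Sum>m. M m * S)"
      using finite_circle_measure by (simp add: finite_measure.integrable_const)
    show "(\<Sum>m. norm (f m \<theta> * shift_kernel \<delta> r z \<theta>)) \<le> (\<Sum>m. M m * S)" for \<theta>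
      by (intro suminf_le b s sM)
  qed (rule s)
  moreover have "(\<Sum>m. f m \<theta> * shift_kernel \<delta> r z \<theta>) = (\<Sum>m. f m \<theta>) * shift_kernel \<delta> r z \<theta>" for \<theta>
  proof -
    have "summable (\<lambda>m. f m \<theta>)"
      by (rule summable_norm_cancel, rule summable_comparison_test'[OF M(1), of 0]) (use M(2) in auto)
    from suminf_mult2[OF this] show ?thesis by simp
  qed
  ultimately show ?thesis by simp
qed

text \<open>The circle of radius t/2 about t stays at distance t/2 from the imaginary axis and
  inside |\<tau>| <= 3t/2. Hence Re(1/\<tau>) = Re \<tau> / |\<tau>|^2 is at least (t/2)/(3t/2)^2 =
  2/(9t), which makes the dual series converge uniformly as well.\<close>

lemma theta_circle:
  fixes t :: real
  assumes t: "t > 0"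
  defines "\<tau> \<equiv> (\<lambda>\<theta>. complex_of_real t + of_real (t / 2) * cis \<theta>)"
  shows "Re (\<tau> \<theta>) \<ge> t / 2" "norm (\<tau> \<theta>) \<ge> t / 2" "Re (1 / \<tau> \<theta>) \<ge> 2 / (9 * t)" "continuous_on UNIV \<tau>"
proof -
  have c: "- 1 \<le> cos \<theta>" by simp
  then have "(t / 2) * (- 1) \<le> (t / 2) * cos \<theta>" using t by (intro mult_left_mono) auto
  then show re: "Re (\<tau> \<theta>) \<ge> t / 2" by (simp add: \<tau>_def)
  then show n: "norm (\<tau> \<theta>) \<ge> t / 2" using complex_Re_le_cmod[of "\<tau> \<theta>"] by linarith
  have "norm (\<tau> \<theta>) \<le> t + t / 2"
    unfolding \<tau>_def by (rule order_trans[OF norm_triangle_ineq]) (use t in \<open>simp add: norm_mult\<close>)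
  then have u: "(norm (\<tau> \<theta>))\<^sup>2 \<le> (3 * t / 2)\<^sup>2" using t by (intro power_mono) auto
  have p: "(norm (\<tau> \<theta>))\<^sup>2 > 0" using n t by (intro zero_less_power) linarith
  have "2 / (9 * t) = (t / 2) / (3 * t / 2)\<^sup>2" using t by (simp add: power2_eq_square field_simps)
  also have "\<dots> \<le> Re (\<tau> \<theta>) / (norm (\<tau> \<theta>))\<^sup>2" using re u p t by (intro frac_le) auto
  also have "\<dots> = Re (1 / \<tau> \<theta>)" by (simp add: Re_divide cmod_power2)
  finally show "Re (1 / \<tau> \<theta>) \<ge> 2 / (9 * t)" .
  show "continuous_on UNIV \<tau>" unfolding \<tau>_def by (intro continuous_intros)
qed

text \<open>Gaussians centred at x and -x, combined with the parity sign: the contribution of the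
  frequencies l and -l of the extended sequence, halved.\<close>

definition shifted_gaussian :: "nat \<Rightarrow> real \<Rightarrow> real \<Rightarrow> real \<Rightarrow> real" where
  "shifted_gaussian \<delta> t x l = (exp (- t * (l - x)\<^sup>2) + (-1) ^ \<delta> * exp (- t * (l + x)\<^sup>2)) / 2"

text \<open>Expanding the squares shows which parameter of the functional moves the centre to x: it
  is z = t x, up to the factor exp(-t x^2).\<close>

lemma shifted_gaussian_hyp:
  "shifted_gaussian \<delta> t x l = exp (- t * x\<^sup>2) * (exp (- t * l\<^sup>2) * hyp \<delta> (2 * l * (t * x)))"
proof -
  have "exp (- t * (l - x)\<^sup>2) = exp (- t * x\<^sup>2) * exp (- t * l\<^sup>2) * exp (2 * l * (t * x))"
    "exp (- t * (l + x)\<^sup>2) = exp (- t * x\<^sup>2) * exp (- t * l\<^sup>2) * exp (- (2 * l * (t * x)))"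
    unfolding exp_add[symmetric] by (rule arg_cong[of _ _ exp], simp add: power2_eq_square algebra_simps)+
  then show ?thesis unfolding shifted_gaussian_def hyp_def by (simp add: algebra_simps add_divide_distrib)
qed

text \<open>The functional with z = t x is applied to the theta transformation on the circle, and
  the result is multiplied by exp(-t x^2) / (2 pi). On the dual side z^2/t = t x^2 cancels this
  prefactor, so there the shift survives only as the oscillating factor
  \<open>trig \<delta> (2 * mu (Suc m) * x)\<close>.\<close>

theorem shifted_theta_transformation:
  fixes t x :: real
  assumes B: "class_B \<delta> a lam b mu \<phi> \<psi>" and t: "t > 0"
  shows "(\<Sum>m. a (Suc m) * of_real (shifted_gaussian \<delta> t x (lam (Suc m)))) =
    (if \<delta> = 0 then \<phi> 0 * of_real (exp (- t * x\<^sup>2)) + of_real (sqrt pi / 2 * t powr (- 1/2)) * residue \<phi> 1 else 0)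
    + (\<Sum>m. b (Suc m) * of_real (t powr (- 1/2) * exp (- (mu (Suc m))\<^sup>2 / t) * trig \<delta> (2 * mu (Suc m) * x)))"
proof -
  note fra = class_BD(2)[OF B] and frb = class_BD(3)[OF B] and fina = class_BD(4)[OF B] and finb = class_BD(5)[OF B]
    and \<delta> = class_BD(1)[OF B]
  define r where "r = t / 2"
  have r: "0 < r" "r < t" using t by (simp_all add: r_def)
  define \<tau> where "\<tau> = (\<lambda>\<theta>. complex_of_real t + of_real r * cis \<theta>)"
  have tc: "Re (\<tau> \<theta>) \<ge> r" "norm (\<tau> \<theta>) \<ge> r" "Re (1 / \<tau> \<theta>) \<ge> 2 / (9 * t)" "continuous_on UNIV \<tau>" for \<theta>
    unfolding \<tau>_def r_def by (rule theta_circle[OF t])+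
  have tp: "Re (\<tau> \<theta>) > 0" for \<theta> using tc(1)[of \<theta>] r by linarith
  have t0: "\<tau> \<theta> \<noteq> 0" "\<tau> \<theta> \<notin> \<real>\<^sub>\<le>\<^sub>0" for \<theta> using tp[of \<theta>] by (auto simp: complex_nonpos_Reals_iff)
  define z where "z = t * x"
  define W where "W = shift_kernel \<delta> r z"
  define p where "p = - 1/2 - real \<delta>"
  define Fa where "Fa = (\<lambda>m \<theta>. a (Suc m) * (of_real (lam (Suc m)) ^ \<delta> * exp (- of_real ((lam (Suc m))\<^sup>2) * \<tau> \<theta>)))"
  define Fb where "Fb = (\<lambda>m \<theta>. b (Suc m) * dual_gaussian \<delta> (mu (Suc m)) (\<tau> \<theta>))"
  have cpow: "continuous_on UNIV (\<lambda>\<theta>. \<tau> \<theta> powr c)" for c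
    using t0 tc(4) by (intro continuous_intros) (auto simp: less_imp_le[OF tp])
  have cFa: "continuous_on UNIV (Fa m)" for m unfolding Fa_def by (intro continuous_intros tc(4))
  have cdg: "continuous_on UNIV (\<lambda>\<theta>. dual_gaussian \<delta>' c (\<tau> \<theta>))" for \<delta>' c
    unfolding dual_gaussian_def using t0 by (intro continuous_intros cpow tc(4)) auto
  have cFb: "continuous_on UNIV (Fb m)" for m
    unfolding Fb_def by (intro continuous_intros cdg)
  have bFa: "norm (Fa m \<theta>) \<le> norm (a (Suc m)) * lam (Suc m) ^ \<delta> * exp (- (lam (Suc m))\<^sup>2 * r)" for m \<theta>
  proof -
    have "norm (Fa m \<theta>) = norm (a (Suc m)) * lam (Suc m) ^ \<delta> * exp (- (lam (Suc m))\<^sup>2 * Re (\<tau> \<theta>))"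
      using norm_theta_term[OF fra, of a m \<delta> "\<tau> \<theta>"] by (simp add: Fa_def mult.assoc)
    also have "\<dots> \<le> norm (a (Suc m)) * lam (Suc m) ^ \<delta> * exp (- (lam (Suc m))\<^sup>2 * r)"
      using frequencies_pos[OF fra, of m] tc(1)[of \<theta>] by (intro mult_left_mono) (auto intro!: mult_nonneg_nonneg)
    finally show ?thesis .
  qed
  have bFb: "norm (Fb m \<theta>) \<le> (norm (b (Suc m)) * mu (Suc m) ^ \<delta> * exp (- (mu (Suc m))\<^sup>2 * (2 / (9 * t)))) * r powr p" for m \<theta>
  proof -
    have "norm (Fb m \<theta>) = norm (b (Suc m) * of_real (mu (Suc m)) ^ \<delta> * exp (- of_real ((mu (Suc m))\<^sup>2) * (1 / \<tau> \<theta>))) * norm (\<tau> \<theta> powr of_real p)"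
      unfolding Fb_def dual_gaussian_def p_def norm_mult by (simp only: mult_ac)
    also have "\<dots> = (norm (b (Suc m)) * mu (Suc m) ^ \<delta> * exp (- (mu (Suc m))\<^sup>2 * Re (1 / \<tau> \<theta>))) * norm (\<tau> \<theta>) powr p"
      using t0[of \<theta>] by (subst norm_theta_term[OF frb]) (simp add: norm_powr_real_powr')
    also have "\<dots> \<le> (norm (b (Suc m)) * mu (Suc m) ^ \<delta> * exp (- (mu (Suc m))\<^sup>2 * (2 / (9 * t)))) * r powr p"
    proof (rule mult_mono)
      show "norm (\<tau> \<theta>) powr p \<le> r powr p" using tc(2)[of \<theta>] r by (intro powr_mono2') (auto simp: p_def)
      have "exp (- (mu (Suc m))\<^sup>2 * Re (1 / \<tau> \<theta>)) \<le> exp (- (mu (Suc m))\<^sup>2 * (2 / (9 * t)))"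
        unfolding exp_le_cancel_iff using tc(3)[of \<theta>] by (intro mult_left_mono_neg) auto
      then show "norm (b (Suc m)) * mu (Suc m) ^ \<delta> * exp (- (mu (Suc m))\<^sup>2 * Re (1 / \<tau> \<theta>)) \<le> 
          norm (b (Suc m)) * mu (Suc m) ^ \<delta> * exp (- (mu (Suc m))\<^sup>2 * (2 / (9 * t)))"
        using frequencies_pos[OF frb, of m] by (intro mult_left_mono) auto
    qed (use frequencies_pos[OF frb, of m] in auto)
    finally show ?thesis .
  qed
  have sa: "summable (\<lambda>m. norm (a (Suc m)) * lam (Suc m) ^ \<delta> * exp (- (lam (Suc m))\<^sup>2 * r))"
    by (rule theta_terms_summable[OF fra fina r(1)])
  have sb: "summable (\<lambda>m. (norm (b (Suc m)) * mu (Suc m) ^ \<delta> * exp (- (mu (Suc m))\<^sup>2 * (2 / (9 * t)))) * r powr p)"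
    using t by (intro summable_mult2 theta_terms_summable[OF frb finb]) auto
  note Sa = sums_times_shift_kernel[OF r(1) cFa sa bFa, of \<delta> z, folded W_def]
  note Sb = sums_times_shift_kernel[OF r(1) cFb sb bFb, of \<delta> z, folded W_def]
  have Ia: "(\<integral>\<theta>. Fa m \<theta> * W \<theta> \<partial>circle_measure) = 2 * pi * (a (Suc m) * of_real (exp (- t * (lam (Suc m))\<^sup>2) * hyp \<delta> (2 * lam (Suc m) * z)))" for m
    using shift_gaussian[OF r(1) \<delta>, of "lam (Suc m)" t z]
    unfolding Fa_def W_def \<tau>_def mult.assoc[of "a (Suc m)"] integral_mult_right_zero by (simp add: mult_ac)
  have Ib: "(\<integral>\<theta>. Fb m \<theta> * W \<theta> \<partial>circle_measure) = 2 * pi * (b (Suc m) * of_real (t powr (- 1/2) * exp ((z\<^sup>2 - (mu (Suc m))\<^sup>2) / t) * trig \<delta> (2 * mu (Suc m) * z / t)))" for m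
    unfolding Fb_def W_def \<tau>_def mult.assoc[of "b (Suc m)"] integral_mult_right_zero
    by (subst shift_dual_gaussian[OF r \<delta>]) (simp only: mult_ac)
  have Ta: "(\<Sum>m. Fa m \<theta>) = theta_series \<delta> a lam (\<tau> \<theta>)" for \<theta>
    unfolding Fa_def theta_series_def by (simp only: mult.assoc)
  have Tb: "(\<Sum>m. Fb m \<theta>) = \<tau> \<theta> powr of_real p * theta_series \<delta> b mu (1 / \<tau> \<theta>)" for \<theta>
  proof -
    have "(\<lambda>m. \<tau> \<theta> powr of_real p * (b (Suc m) * of_real (mu (Suc m)) ^ \<delta> * exp (- of_real ((mu (Suc m))\<^sup>2) * (1 / \<tau> \<theta>))))
       sums (\<tau> \<theta> powr of_real p * theta_series \<delta> b mu (1 / \<tau> \<theta>))"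
      by (intro sums_mult theta_series_sums[OF frb finb] Re_inverse_pos tp)
    then show ?thesis unfolding Fb_def dual_gaussian_def p_def by (simp only: sums_iff mult_ac)
  qed
  define Cc where "Cc = (\<lambda>\<theta>. theta_correction \<delta> \<phi> (\<tau> \<theta>))"
  have cC: "continuous_on UNIV Cc"
    unfolding Cc_def theta_correction_def by (cases "\<delta> = 0") (auto intro!: continuous_intros cpow)
  have e: "(\<Sum>m. Fa m \<theta>) = (\<Sum>m. Fb m \<theta>) + Cc \<theta>" for \<theta>
    unfolding Ta Tb Cc_def p_def by (rule theta_transformation[OF B tp])
  have iC: "integrable circle_measure (\<lambda>\<theta>. Cc \<theta> * W \<theta>)"
    unfolding W_def by (rule integrable_times_shift_kernel[OF r(1) cC])
  have cTa: "continuous_on UNIV (\<lambda>\<theta>. \<Sum>m. Fa m \<theta>)"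
  proof -
    have "continuous_on {\<tau>. Re \<tau> > 0} (theta_series \<delta> a lam)"
      by (intro holomorphic_on_imp_continuous_on theta_series_holomorphic fra fina)
    then show ?thesis unfolding Ta by (rule continuous_on_compose2[OF _ tc(4)]) (use tp in auto)
  qed
  have iA: "integrable circle_measure (\<lambda>\<theta>. (\<Sum>m. Fa m \<theta>) * W \<theta>)"
    unfolding W_def by (rule integrable_times_shift_kernel[OF r(1) cTa])
  have "(\<integral>\<theta>. (\<Sum>m. Fb m \<theta>) * W \<theta> \<partial>circle_measure) = (\<integral>\<theta>. (\<Sum>m. Fa m \<theta>) * W \<theta> - Cc \<theta> * W \<theta> \<partial>circle_measure)"
    unfolding e by (simp add: algebra_simps)
  also have "\<dots> = (\<integral>\<theta>. (\<Sum>m. Fa m \<theta>) * W \<theta> \<partial>circle_measure) - (\<integral>\<theta>. Cc \<theta> * W \<theta> \<partial>circle_measure)"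
    by (rule Bochner_Integration.integral_diff[OF iA iC])
  finally have main: "(\<integral>\<theta>. (\<Sum>m. Fa m \<theta>) * W \<theta> \<partial>circle_measure) = (\<integral>\<theta>. (\<Sum>m. Fb m \<theta>) * W \<theta> \<partial>circle_measure) + (\<integral>\<theta>. Cc \<theta> * W \<theta> \<partial>circle_measure)"
    by simp
  define D where "D = (if \<delta> = 0 then \<phi> 0 + of_real (sqrt pi / 2 * t powr (- 1/2) * exp (t * x\<^sup>2)) * residue \<phi> 1 else 0)"
  have IC: "(\<integral>\<theta>. Cc \<theta> * W \<theta> \<partial>circle_measure) = 2 * pi * D"
  proof (cases "\<delta> = 0")
    case True
    \<comment> \<open>The constant is a Gaussian of frequency 0 and the pole term a dual Gaussian of
      frequency 0, so both fall under the shift formulas. The second one acquires exp(t x^2), which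
      the prefactor \<open>E\<close> removes again.\<close>
    have "Cc \<theta> = \<phi> 0 * (of_real 0 ^ 0 * exp (- of_real (0\<^sup>2) * \<tau> \<theta>)) + (of_real (sqrt pi / 2) * residue \<phi> 1) * dual_gaussian 0 0 (\<tau> \<theta>)" for \<theta>
      by (simp add: Cc_def theta_correction_def True dual_gaussian_def)
    then have "(\<integral>\<theta>. Cc \<theta> * W \<theta> \<partial>circle_measure) = (\<integral>\<theta>. \<phi> 0 * ((of_real 0 ^ 0 * exp (- of_real (0\<^sup>2) * \<tau> \<theta>)) * W \<theta>)
        + (of_real (sqrt pi / 2) * residue \<phi> 1) * (dual_gaussian 0 0 (\<tau> \<theta>) * W \<theta>) \<partial>circle_measure)"
      by (simp add: algebra_simps)
    also have "\<dots> = \<phi> 0 * (\<integral>\<theta>. (of_real 0 ^ 0 * exp (- of_real (0\<^sup>2) * \<tau> \<theta>)) * W \<theta> \<partial>circle_measure)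
        + (of_real (sqrt pi / 2) * residue \<phi> 1) * (\<integral>\<theta>. dual_gaussian 0 0 (\<tau> \<theta>) * W \<theta> \<partial>circle_measure)"
      unfolding W_def
      by (subst Bochner_Integration.integral_add;
          (intro integrable_mult_right integrable_times_shift_kernel[OF r(1)] cdg continuous_intros tc(4))?)
        (simp only: integral_mult_right_zero)
    also have "(\<integral>\<theta>. (of_real 0 ^ 0 * exp (- of_real (0\<^sup>2) * \<tau> \<theta>)) * W \<theta> \<partial>circle_measure) = 2 * pi"
      using shift_gaussian[OF r(1), of 0 0 t z] unfolding W_def \<tau>_def True by (simp add: hyp_def)
    also have "(\<integral>\<theta>. dual_gaussian 0 0 (\<tau> \<theta>) * W \<theta> \<partial>circle_measure) = 2 * pi * complex_of_real (t powr (- 1/2) * exp (t * x\<^sup>2))"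
    proof -
      have "z\<^sup>2 / t = t * x\<^sup>2" using t by (simp add: z_def power2_eq_square)
      then show ?thesis
        using shift_dual_gaussian[OF r, of 0 0 z] unfolding W_def \<tau>_def True by (simp add: trig_def)
    qed
    finally show ?thesis by (simp add: D_def True algebra_simps)
  next
    case False
    then show ?thesis by (simp add: Cc_def D_def theta_correction_def)
  qed
  define E where "E = complex_of_real (exp (- t * x\<^sup>2))"
  define k where "k = E / (2 * of_real pi)"
  have kI: "k * (complex_of_real (2 * pi) * y) = E * y" for y by (simp add: k_def)
  have Sa': "(\<lambda>m. a (Suc m) * of_real (shifted_gaussian \<delta> t x (lam (Suc m)))) sums (k * (\<integral>\<theta>. (\<Sum>m. Fa m \<theta>) * W \<theta> \<partial>circle_measure))"
  proof -
    have "k * (\<integral>\<theta>. Fa m \<theta> * W \<theta> \<partial>circle_measure) = a (Suc m) * of_real (shifted_gaussian \<delta> t x (lam (Suc m)))" for m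
      unfolding Ia kI shifted_gaussian_hyp E_def z_def by (simp only: of_real_mult mult_ac)
    then show ?thesis using sums_mult[OF Sa, of k] by simp
  qed
  have Sb': "(\<lambda>m. b (Suc m) * of_real (t powr (- 1/2) * exp (- (mu (Suc m))\<^sup>2 / t) * trig \<delta> (2 * mu (Suc m) * x))) sums
      (k * (\<integral>\<theta>. (\<Sum>m. Fb m \<theta>) * W \<theta> \<partial>circle_measure))"
  proof -
    have "k * (\<integral>\<theta>. Fb m \<theta> * W \<theta> \<partial>circle_measure) = b (Suc m) * of_real (t powr (- 1/2) * exp (- (mu (Suc m))\<^sup>2 / t) * trig \<delta> (2 * mu (Suc m) * x))" for m
    proof -
      have "exp (- t * x\<^sup>2) * exp ((z\<^sup>2 - (mu (Suc m))\<^sup>2) / t) = exp (- (mu (Suc m))\<^sup>2 / t)"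
        unfolding exp_add[symmetric] using t by (intro arg_cong[of _ _ exp]) (simp add: z_def power2_eq_square field_simps)
      moreover have "2 * mu (Suc m) * z / t = 2 * mu (Suc m) * x" using t by (simp add: z_def)
      moreover have "complex_of_real e * (c * of_real (u * v * w)) = c * of_real (u * (e * v) * w)" for e u v w :: real and c
        by (simp only: of_real_mult mult_ac)
      ultimately show ?thesis unfolding Ib kI E_def by (simp only:)
    qed
    then show ?thesis using sums_mult[OF Sb, of k] by simp
  qed
  have ED: "E * D = (if \<delta> = 0 then \<phi> 0 * of_real (exp (- t * x\<^sup>2)) + of_real (sqrt pi / 2 * t powr (- 1/2)) * residue \<phi> 1 else 0)"
  proof -
    have "complex_of_real (exp (t * x\<^sup>2)) * of_real (exp (- (t * x\<^sup>2))) = 1"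
      by (simp flip: of_real_mult exp_add)
    then show ?thesis by (simp add: D_def E_def distrib_left mult_ac)
  qed
  have "k * (\<integral>\<theta>. (\<Sum>m. Fa m \<theta>) * W \<theta> \<partial>circle_measure) = k * (\<integral>\<theta>. (\<Sum>m. Fb m \<theta>) * W \<theta> \<partial>circle_measure) + E * D"
    unfolding main IC distrib_left kI ..
  then show ?thesis using Sa' Sb' unfolding ED by (simp only: sums_iff add.commute)
qed

section \<open>Gamma and Bessel integrals\<close>

text \<open>A measure of its own, so that the theorems on integrals of series apply without
  indicator functions and every point of the space is positive, as the rules for \<open>powr\<close>
  require.\<close>

definition pos_measure :: "real measure" where
  "pos_measure = restrict_space lborel {0<..}"

lemma space_pos_measure [simp]: "space pos_measure = {0<..}"
  by (simp add: pos_measure_def space_restrict_space)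

lemma integrable_pos_measure_iff:
  fixes f :: "real \<Rightarrow> 'a::{banach,second_countable_topology}"
  shows "integrable pos_measure f \<longleftrightarrow> set_integrable lborel {0<..} f"
  unfolding pos_measure_def set_integrable_def by (subst integrable_restrict_space) auto

lemma integral_pos_measure:
  fixes f :: "real \<Rightarrow> 'a::{banach,second_countable_topology}"
  shows "integral\<^sup>L pos_measure f = (LINT t:{0<..}|lborel. f t)"
  unfolding pos_measure_def set_lebesgue_integral_def by (subst integral_restrict_space) auto

lemma pos_measure_measurable:
  fixes f :: "real \<Rightarrow> complex"
  assumes "continuous_on {0<..} f"
  shows "f \<in> borel_measurable pos_measure"
proof -
  have "f \<in> borel_measurable (restrict_space borel {0<..})"
    by (rule borel_measurable_continuous_on_restrict[OF assms])
  moreover have "sets (restrict_space borel {0<..}) = sets pos_measure"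
    unfolding pos_measure_def by (rule sets_restrict_space_cong) simp
  ultimately show ?thesis using measurable_cong_sets by blast
qed

lemma gamma_power_integral:
  fixes w :: complex and A :: real
  assumes w: "Re w > 0" and A: "A > 0"
  shows "integrable pos_measure (\<lambda>t. of_real t powr (w - 1) * of_real (exp (- A * t)))"
    and "(\<integral>t. of_real t powr (w - 1) * of_real (exp (- A * t)) \<partial>pos_measure) = Gamma w * of_real A powr (- w)"
proof -
  have abs: "set_integrable lborel {0<..} (\<lambda>t. of_real t powr (w - 1) * of_real (exp (- B * t)))" if B: "B > 0" for B
  proof -
    have m: "(\<lambda>t. complex_of_real t powr (w - 1) * of_real (exp (- B * t))) \<in> borel_measurable pos_measure"
      by (intro pos_measure_measurable continuous_intros) auto
    then have "(\<lambda>t. indicator {0<..} t *\<^sub>R (complex_of_real t powr (w - 1) * of_real (exp (- B * t)))) \<in> borel_measurable lborel"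
      unfolding pos_measure_def by (subst (asm) borel_measurable_restrict_space_iff) auto
    moreover have "(\<lambda>t. complex_of_real t powr (w - 1) / of_real (exp (B * t))) absolutely_integrable_on {0<..}"
      by (rule absolutely_integrable_Gamma_integral[OF w B])
    then have "(\<lambda>t. complex_of_real t powr (w - 1) * of_real (exp (- B * t))) absolutely_integrable_on {0<..}"
      by (simp add: exp_minus field_simps)
    ultimately show ?thesis
      unfolding set_integrable_def by (subst (asm) integrable_completion) auto
  qed
  show "integrable pos_measure (\<lambda>t. of_real t powr (w - 1) * of_real (exp (- A * t)))"
    unfolding integrable_pos_measure_iff by (rule abs[OF A])
  define g where "g = (\<lambda>t. indicator {0<..} t *\<^sub>R (complex_of_real t powr (w - 1) * of_real (exp (- t))))"
  have "(\<integral>t. g t \<partial>lborel) = (LINT t:{0<..}|lborel. of_real t powr (w - 1) * of_real (exp (- 1 * t)))"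
    by (simp add: g_def set_lebesgue_integral_def)
  also have "\<dots> = integral {0<..} (\<lambda>t. of_real t powr (w - 1) * of_real (exp (- 1 * t)))"
    by (rule set_borel_integral_eq_integral(2)[OF abs]) simp
  also have "\<dots> = Gamma w"
    using integral_unique[OF Gamma_integral_complex'[OF w]] by (simp add: exp_minus divide_inverse)
  finally have G: "(\<integral>t. g t \<partial>lborel) = Gamma w" .
  have "(\<integral>t. g t \<partial>lborel) = \<bar>A\<bar> *\<^sub>R (\<integral>t. g (0 + A * t) \<partial>lborel)"
    by (rule lborel_integral_real_affine) (use A in simp)
  also have "(\<lambda>t. g (0 + A * t)) = (\<lambda>t. of_real A powr (w - 1) * (indicator {0<..} t *\<^sub>R (of_real t powr (w - 1) * of_real (exp (- A * t)))))"
  proof (rule ext)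
    fix t :: real
    show "g (0 + A * t) = of_real A powr (w - 1) * (indicator {0<..} t *\<^sub>R (of_real t powr (w - 1) * of_real (exp (- A * t))))"
    proof (cases "t > 0")
      case True
      then have "complex_of_real (A * t) powr (w - 1) = of_real A powr (w - 1) * of_real t powr (w - 1)"
        using A by (simp add: powr_times_real)
      then show ?thesis using True A by (simp add: g_def)
    next
      case False
      then have "\<not> A * t > 0" using A by (simp add: zero_less_mult_iff)
      then show ?thesis using False by (simp add: g_def)
    qed
  qed
  finally have "Gamma w = of_real A * (of_real A powr (w - 1) * (\<integral>t. of_real t powr (w - 1) * of_real (exp (- A * t)) \<partial>pos_measure))"
    unfolding G integral_mult_right_zero integral_pos_measure set_lebesgue_integral_def using A by (simp add: scaleR_conv_of_real)
  also have "\<dots> = of_real A powr w * (\<integral>t. of_real t powr (w - 1) * of_real (exp (- A * t)) \<partial>pos_measure)"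
    using A by (simp add: powr_diff)
  finally show "(\<integral>t. of_real t powr (w - 1) * of_real (exp (- A * t)) \<partial>pos_measure) = Gamma w * of_real A powr (- w)"
    using A by (simp add: powr_minus field_simps)
qed

lemma gamma_power_integral_real:
  fixes p A :: real
  assumes p: "p > 0" and A: "A > 0"
  shows "integrable pos_measure (\<lambda>t. t powr (p - 1) * exp (- A * t))"
    and "(\<integral>t. t powr (p - 1) * exp (- A * t) \<partial>pos_measure) = Gamma p * A powr (- p)"
proof -
  have e: "complex_of_real t powr (of_real p - 1) * of_real (exp (- A * t)) = of_real (t powr (p - 1) * exp (- A * t))"
    if "t \<in> space pos_measure" for t using that by (simp add: powr_of_real[symmetric])
  have "integrable pos_measure (\<lambda>t. complex_of_real (t powr (p - 1) * exp (- A * t)))"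
    using gamma_power_integral(1)[of "of_real p" A] p A e by (subst (asm) Bochner_Integration.integrable_cong[OF refl e]) auto
  then show "integrable pos_measure (\<lambda>t. t powr (p - 1) * exp (- A * t))" by (simp only: complex_of_real_integrable_eq)
  have "complex_of_real (\<integral>t. t powr (p - 1) * exp (- A * t) \<partial>pos_measure) = (\<integral>t. complex_of_real (t powr (p - 1) * exp (- A * t)) \<partial>pos_measure)"
    by (rule integral_complex_of_real[symmetric])
  also have "\<dots> = (\<integral>t. of_real t powr (of_real p - 1) * of_real (exp (- A * t)) \<partial>pos_measure)"
    by (intro Bochner_Integration.integral_cong refl e[symmetric])
  also have "\<dots> = Gamma (of_real p) * of_real A powr (- of_real p)"
    by (rule gamma_power_integral(2)) (use p A in auto)
  also have "\<dots> = of_real (Gamma p * A powr (- p))"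
    using A by (simp add: Gamma_complex_of_real powr_of_real flip: of_real_minus)
  finally show "(\<integral>t. t powr (p - 1) * exp (- A * t) \<partial>pos_measure) = Gamma p * A powr (- p)"
    by (simp only: of_real_eq_iff)
qed

lemma power_le_exp: "u \<ge> 0 \<Longrightarrow> u ^ n \<le> fact n * exp (u :: real)"
proof -
  assume u: "u \<ge> 0"
  have "u ^ n / fact n \<le> (\<Sum>k. u ^ k / fact k)"
    using sum_le_suminf[of "\<lambda>k. u ^ k / fact k" "{n}"] summable_exp[of u] u by (simp add: field_simps)
  also have "\<dots> = exp u" by (simp add: exp_def field_simps)
  finally show ?thesis by (simp add: field_simps)
qed

text \<open>No condition on w is needed: exp(-\<beta>/t) is at most a constant times t^N, and N with
  Re w + N > 0 reduces the integrand to that of a Gamma integral.\<close>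

lemma bessel_integrand_integrable:
  fixes w :: complex and \<alpha> \<beta> :: real
  assumes \<alpha>: "\<alpha> > 0" and \<beta>: "\<beta> > 0"
  shows "integrable pos_measure (\<lambda>t. of_real t powr (w - 1) * of_real (exp (- \<alpha> * t - \<beta> / t)))"
proof -
  obtain N :: nat where "- Re w < real N"
    using reals_Archimedean2 by blast
  then have N: "Re w + real N > 0" by simp
  define C where "C = fact N / \<beta> ^ N"
  show ?thesis
  proof (rule Bochner_Integration.integrable_bound)
    show "integrable pos_measure (\<lambda>t. C * (t powr ((Re w + real N) - 1) * exp (- \<alpha> * t)))"
      by (intro integrable_mult_right gamma_power_integral_real(1) N \<alpha>)
    show "(\<lambda>t. of_real t powr (w - 1) * of_real (exp (- \<alpha> * t - \<beta> / t))) \<in> borel_measurable pos_measure"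
      by (intro pos_measure_measurable continuous_intros) auto
    show "AE t in pos_measure. norm (of_real t powr (w - 1) * complex_of_real (exp (- \<alpha> * t - \<beta> / t)))
       \<le> norm (C * (t powr ((Re w + real N) - 1) * exp (- \<alpha> * t)))"
    proof (rule AE_I2)
      fix t assume "t \<in> space pos_measure"
      then have t: "t > 0" by simp
      have "exp (- \<beta> / t) \<le> C * t ^ N"
        using power_le_exp[of "\<beta> / t" N] t \<beta> by (simp add: C_def exp_minus field_simps)
      then have le: "t powr (Re w - 1) * exp (- \<alpha> * t) * exp (- \<beta> / t) \<le> t powr (Re w - 1) * exp (- \<alpha> * t) * (C * t ^ N)"
        by (intro mult_left_mono) auto
      have n1: "norm (of_real t powr (w - 1) * complex_of_real (exp (- \<alpha> * t - \<beta> / t))) = t powr (Re w - 1) * exp (- \<alpha> * t) * exp (- \<beta> / t)"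
        using t by (simp add: norm_mult norm_powr_real_powr exp_add[symmetric])
      have n2: "t powr (Re w - 1) * exp (- \<alpha> * t) * (C * t ^ N) = C * (t powr ((Re w + real N) - 1) * exp (- \<alpha> * t))"
        using t by (simp add: powr_realpow[symmetric] powr_add[symmetric] algebra_simps)
      have "C \<ge> 0" using \<beta> by (simp add: C_def)
      then have n3: "norm (C * (t powr ((Re w + real N) - 1) * exp (- \<alpha> * t))) = C * (t powr ((Re w + real N) - 1) * exp (- \<alpha> * t))"
        by (simp only: real_norm_def abs_mult abs_exp_cancel abs_of_nonneg powr_ge_zero)
      show "norm (of_real t powr (w - 1) * complex_of_real (exp (- \<alpha> * t - \<beta> / t)))
         \<le> norm (C * (t powr ((Re w + real N) - 1) * exp (- \<alpha> * t)))"
        unfolding n1 n3 using le unfolding n2 .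
    qed
  qed
qed

section \<open>The Bessel integral by exponential substitution\<close>

lemma complex_change_of_variables:
  fixes f :: "real \<Rightarrow> complex" and g :: "real \<Rightarrow> real"
  assumes S: "S \<in> sets lebesgue" and g: "\<And>x. x \<in> S \<Longrightarrow> (g has_field_derivative g' x) (at x within S)"
    and inj: "inj_on g S" and f: "f absolutely_integrable_on g ` S"
  shows "(\<lambda>x. \<bar>g' x\<bar> *\<^sub>R f (g x)) absolutely_integrable_on S"
    and "integral S (\<lambda>x. \<bar>g' x\<bar> *\<^sub>R f (g x)) = integral (g ` S) f"
proof -
  show abs: "(\<lambda>x. \<bar>g' x\<bar> *\<^sub>R f (g x)) absolutely_integrable_on S"
    using absolutely_integrable_change_of_variables_real[OF S g inj, of f] f by simp
  have int: "(\<lambda>x. \<bar>g' x\<bar> *\<^sub>R f (g x)) integrable_on S" "f integrable_on g ` S"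
    using abs f absolutely_integrable_on_def by blast+
  have p: "integral S (\<lambda>x. \<bar>g' x\<bar> * h (f (g x))) = integral (g ` S) (\<lambda>x. h (f x))" if h: "bounded_linear h" for h :: "complex \<Rightarrow> real"
  proof -
    have "(\<lambda>x. h (f x)) absolutely_integrable_on g ` S"
      using absolutely_integrable_linear[OF f h] by (simp add: o_def)
    then show ?thesis
      using has_absolute_integral_change_of_variables_1'[OF S g inj, of "\<lambda>x. h (f x)" "integral (g ` S) (\<lambda>x. h (f x))"] by simp
  qed
  have l: "h (integral S (\<lambda>x. \<bar>g' x\<bar> *\<^sub>R f (g x))) = h (integral (g ` S) f)" if h: "bounded_linear h" for h :: "complex \<Rightarrow> real"
    using integral_linear[OF int(1) h] integral_linear[OF int(2) h] p[OF h]
    by (simp add: o_def linear_scale[OF bounded_linear.linear[OF h]])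
  show "integral S (\<lambda>x. \<bar>g' x\<bar> *\<^sub>R f (g x)) = integral (g ` S) f"
    using l[OF bounded_linear_Re] l[OF bounded_linear_Im] by (simp add: complex_eq_iff)
qed

lemma even_integral_half_line:
  fixes k :: "real \<Rightarrow> complex"
  assumes i: "integrable lborel k" and e: "\<And>u. k (- u) = k u"
  shows "(\<integral>u. k u \<partial>lborel) = 2 * integral {0..} k"
proof -
  have ind: "integrable lborel (\<lambda>u. indicator A u *\<^sub>R k u)" if "A \<in> sets borel" for A
    using that by (intro integrable_mult_indicator i) auto
  have "(\<integral>u. k u \<partial>lborel) = (\<integral>u. indicator {0..} u *\<^sub>R k u + indicator {..<0} u *\<^sub>R k u \<partial>lborel)"
    by (intro Bochner_Integration.integral_cong refl) (auto simp: indicator_def)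
  also have "\<dots> = (\<integral>u. indicator {0..} u *\<^sub>R k u \<partial>lborel) + (\<integral>u. indicator {..<0} u *\<^sub>R k u \<partial>lborel)"
    by (intro Bochner_Integration.integral_add ind) auto
  also have "(\<integral>u. indicator {..<0} u *\<^sub>R k u \<partial>lborel) = (\<integral>u. indicator {0<..} u *\<^sub>R k u \<partial>lborel)"
    by (subst lborel_integral_real_affine[of "-1" _ 0]) (auto simp: e indicator_def intro!: Bochner_Integration.integral_cong)
  also have "\<dots> = (\<integral>u. indicator {0..} u *\<^sub>R k u \<partial>lborel)"
  proof (rule integral_cong_AE)
    show "AE u in lborel. indicator {0<..} u *\<^sub>R k u = indicator {0..} u *\<^sub>R k u"
      using AE_lborel_singleton[of "0::real"] by eventually_elim (auto simp: indicator_def)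
  qed (use ind in auto)
  also have "(\<integral>u. indicator {0..} u *\<^sub>R k u \<partial>lborel) = integral {0..} k"
    using set_borel_integral_eq_integral(2)[of "{0..}" k] ind[of "{0..}"]
    by (simp add: set_integrable_def set_lebesgue_integral_def)
  finally show ?thesis by simp
qed

text \<open>The substitution t = (m/K) exp(u) balances the two exponents: K^2 t and m^2/t become K m
  exp(u) and K m exp(-u), with sum 2 K m cosh(u). As dt/t = du, the power of t becomes (m/K)^w
  exp(wu), whose even part gives cosh(wu) on the half line and the factor 2.\<close>

lemma bessel_integral:
  fixes w :: complex and K m :: real
  assumes K: "K > 0" and m: "m > 0"
  shows "(\<integral>t. of_real t powr (w - 1) * of_real (exp (- K\<^sup>2 * t - m\<^sup>2 / t)) \<partial>pos_measure)
     = 2 * of_real (m / K) powr w * bessel_K w (2 * K * m)"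
proof -
  define f where "f = (\<lambda>t. complex_of_real t powr (w - 1) * of_real (exp (- K\<^sup>2 * t - m\<^sup>2 / t)))"
  define r where "r = m / K"
  have r: "r > 0" using K m by (simp add: r_def)
  define h where "h = (\<lambda>u. of_real (exp (- (2 * K * m) * cosh u)) * exp (w * complex_of_real u))"
  have i: "set_integrable lborel {0<..} f"
    using bessel_integrand_integrable[of "K\<^sup>2" "m\<^sup>2" w] K m unfolding integrable_pos_measure_iff f_def by simp
  then have ai: "f absolutely_integrable_on {0<..}"
    unfolding set_integrable_def by (rule integrable_completion[THEN iffD2, rotated]) (use i in \<open>auto simp: set_integrable_def\<close>)
  have img: "(\<lambda>u. r * exp u) ` UNIV = {0<..}"
  proof
    show "{0<..} \<subseteq> (\<lambda>u. r * exp u) ` UNIV"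
    proof
      fix t :: real assume "t \<in> {0<..}"
      then have "t = r * exp (ln (t / r))" using r by simp
      then show "t \<in> (\<lambda>u. r * exp u) ` UNIV" by blast
    qed
  qed (use r in auto)
  have gd: "((\<lambda>u. r * exp u) has_field_derivative r * exp u) (at u within UNIV)" for u
    by (auto intro!: derivative_eq_intros)
  have inj: "inj (\<lambda>u. r * exp u)" using r by (auto simp: inj_def)
  have ai': "f absolutely_integrable_on (\<lambda>u. r * exp u) ` UNIV" unfolding img by (rule ai)
  have "UNIV \<in> sets (lebesgue :: real measure)" by simp
  note cv = complex_change_of_variables[OF this gd inj ai']
  have e: "\<bar>r * exp u\<bar> *\<^sub>R f (r * exp u) = of_real r powr w * h u" for u
  proof -
    have p: "r * exp u > 0" using r by simp
    have "complex_of_real (r * exp u) * of_real (r * exp u) powr (w - 1) = of_real (r * exp u) powr w"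
      using p by (simp add: powr_diff)
    also have "\<dots> = of_real r powr w * of_real (exp u) powr w"
      using r by (simp add: powr_times_real)
    also have "complex_of_real (exp u) powr w = exp (w * of_real u)"
      by (simp add: powr_def Ln_of_real mult.commute)
    finally have 1: "complex_of_real (r * exp u) * of_real (r * exp u) powr (w - 1) = of_real r powr w * exp (w * of_real u)" .
    have c1: "K\<^sup>2 * (r * exp u) = K * m * exp u" using K by (simp add: r_def power2_eq_square)
    have c2: "m\<^sup>2 / (r * exp u) = K * m * exp (- u)"
      using K m by (simp add: r_def power2_eq_square exp_minus field_simps)
    have c3: "2 * cosh u = exp u + exp (- u)" by (simp add: cosh_field_def)
    have "- (2 * K * m) * cosh u = - (K * m * exp u) - K * m * exp (- u)" using c3 by algebra
    then have "- K\<^sup>2 * (r * exp u) - m\<^sup>2 / (r * exp u) = - (2 * K * m) * cosh u"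
      by (simp only: c2 mult_minus_left c1)
    then have "f (r * exp u) = of_real (r * exp u) powr (w - 1) * of_real (exp (- (2 * K * m) * cosh u))"
      by (simp only: f_def)
    then have "\<bar>r * exp u\<bar> *\<^sub>R f (r * exp u) = (complex_of_real (r * exp u) * of_real (r * exp u) powr (w - 1)) * of_real (exp (- (2 * K * m) * cosh u))"
      using r by (simp add: scaleR_conv_of_real mult_ac)
    then show ?thesis unfolding 1 h_def by (simp only: mult_ac)
  qed
  have mh: "h \<in> borel_measurable borel"
    unfolding h_def by (intro borel_measurable_continuous_onI continuous_intros)
  have rw: "of_real r powr w \<noteq> (0::complex)" using r by simp
  have "(\<lambda>u. of_real r powr w * h u) absolutely_integrable_on UNIV" using cv(1) unfolding e .
  then have "integrable lebesgue (\<lambda>u. of_real r powr w * h u)" by (simp add: set_integrable_def)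
  then have "integrable lborel (\<lambda>u. of_real r powr w * h u)"
    using mh by (subst (asm) integrable_completion) auto
  then have "integrable lborel (\<lambda>u. (1 / of_real r powr w) * (of_real r powr w * h u))" by (rule integrable_mult_right)
  then have ih: "integrable lborel h" using rw by simp
  have ih': "integrable lborel (\<lambda>u. h (- u))"
    using lborel_integrable_real_affine[OF ih, of "-1" 0] by simp
  define k where "k = (\<lambda>u. of_real (exp (- (2 * K * m) * cosh u)) * cosh (w * complex_of_real u))"
  have kh: "k u = (h u + h (- u)) / 2" for u
  proof -
    have "cosh (w * complex_of_real u) = (exp (w * of_real u) + exp (- (w * of_real u))) / 2"
      by (rule cosh_field_def)
    then show ?thesis unfolding k_def h_def by (simp only:) (simp add: distrib_left)
  qed
  have ik: "integrable lborel k" unfolding kh by (intro integrable_divide Bochner_Integration.integrable_add ih ih')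
  have "(\<integral>u. k u \<partial>lborel) = ((\<integral>u. h u \<partial>lborel) + (\<integral>u. h (- u) \<partial>lborel)) / 2"
    unfolding kh using ih ih' by simp
  also have "(\<integral>u. h (- u) \<partial>lborel) = (\<integral>u. h u \<partial>lborel)"
    using lborel_integral_real_affine[of "-1" h 0] by simp
  finally have "(\<integral>u. h u \<partial>lborel) = (\<integral>u. k u \<partial>lborel)" by simp
  also have "\<dots> = 2 * integral {0..} k"
    by (rule even_integral_half_line[OF ik]) (simp add: k_def)
  also have "integral {0..} k = bessel_K w (2 * K * m)"
    unfolding bessel_K_def k_def ..
  finally have Ih: "(\<integral>u. h u \<partial>lborel) = 2 * bessel_K w (2 * K * m)" .
  have "(\<integral>t. f t \<partial>pos_measure) = integral {0<..} f"
    unfolding integral_pos_measure by (rule set_borel_integral_eq_integral(2)[OF i])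
  also have "\<dots> = integral UNIV (\<lambda>u. of_real r powr w * h u)"
    using cv(2) unfolding e img by simp
  also have "\<dots> = of_real r powr w * (\<integral>u. h u \<partial>lborel)"
  proof -
    have "set_integrable lborel UNIV (\<lambda>u. of_real r powr w * h u)"
      using integrable_mult_right[OF ih] by (simp add: set_integrable_def)
    from set_borel_integral_eq_integral(2)[OF this]
    have "(\<integral>u. of_real r powr w * h u \<partial>lborel) = integral UNIV (\<lambda>u. of_real r powr w * h u)"
      unfolding set_lebesgue_integral_def by (simp only: indicator_UNIV scaleR_one)
    then show ?thesis unfolding integral_mult_right_zero by (rule sym)
  qed
  finally show ?thesis unfolding Ih f_def r_def by simp
qed

section \<open>One row of the double series\<close>

lemma powr_minus_half_split:
  assumes "t > 0"
  shows "complex_of_real t powr ((s - 1/2) - 1) = of_real t powr (s - 1) * of_real (t powr (- 1/2))"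
proof -
  have "(s - 1/2) - 1 = (s - 1) + complex_of_real (- 1/2)" by simp
  then have "complex_of_real t powr ((s - 1/2) - 1) = of_real t powr (s - 1) * of_real t powr complex_of_real (- 1/2)"
    by (simp only: powr_add)
  moreover have "complex_of_real t powr complex_of_real (- 1/2) = of_real (t powr (- 1/2))"
    using assms by (intro powr_of_real) auto
  ultimately show ?thesis by (simp only:)
qed

text \<open>The shifted inversion formula is multiplied by t^(s-1) exp(-K^2 t) and integrated over
  t. Its factor t^(-1/2) lowers s to s - 1/2, which becomes the Bessel index and the argument of the
  second Gamma factor. The three summability hypotheses justify the interchanges; Re s > 1/2 makes
  t^(s - 3/2) integrable at 0 when the pole term is present.\<close>

lemma shifted_epstein_row:
  fixes x K :: real and s :: complex
  assumes B: "class_B \<delta> a lam b mu \<phi> \<psi>" and K: "K > 0" and s: "Re s > 0"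
    and res: "residue \<phi> 1 \<noteq> 0 \<Longrightarrow> Re s > 1/2"
    and sm: "summable (\<lambda>m. norm (a (Suc m)) * ((lam (Suc m) - x)\<^sup>2 + K\<^sup>2) powr (- Re s))"
    and sp: "summable (\<lambda>m. norm (a (Suc m)) * ((lam (Suc m) + x)\<^sup>2 + K\<^sup>2) powr (- Re s))"
    and sb: "summable (\<lambda>m. norm (b (Suc m)) * (\<integral>t. t powr (Re s - 3/2) * exp (- K\<^sup>2 * t - (mu (Suc m))\<^sup>2 / t) \<partial>pos_measure))"
  shows "Gamma s * (\<Sum>m. a (Suc m) * ((of_real ((lam (Suc m) - x)\<^sup>2 + K\<^sup>2) powr (- s) + (-1) ^ \<delta> * of_real ((lam (Suc m) + x)\<^sup>2 + K\<^sup>2) powr (- s)) / 2))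
    = (if \<delta> = 0 then \<phi> 0 * (Gamma s * of_real (x\<^sup>2 + K\<^sup>2) powr (- s))
          + of_real (sqrt pi / 2) * residue \<phi> 1 * (Gamma (s - 1/2) * of_real K powr (1 - 2 * s)) else 0)
      + (\<Sum>m. b (Suc m) * of_real (trig \<delta> (2 * mu (Suc m) * x)) * (2 * of_real (mu (Suc m) / K) powr (s - 1/2) * bessel_K (s - 1/2) (2 * K * mu (Suc m))))"
proof -
  note fra = class_BD(2)[OF B] and frb = class_BD(3)[OF B] and \<delta> = class_BD(1)[OF B]
  have K2: "K\<^sup>2 > 0" using K by simp
  have A: "(l + y)\<^sup>2 + K\<^sup>2 > 0" for l y using K2 by (rule add_nonneg_pos[rotated]) simp
  define G where "G = (\<lambda>A t. complex_of_real t powr (s - 1) * of_real (exp (- A * t)))"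
  have iG: "integrable pos_measure (G A)" and IG: "integral\<^sup>L pos_measure (G A) = Gamma s * of_real A powr (- s)" if "A > 0" for A
    unfolding G_def by (rule gamma_power_integral[OF s that])+
  have nG: "norm (G A t) = t powr (Re s - 1) * exp (- A * t)" if "t \<in> space pos_measure" for A t
    using that by (simp add: G_def norm_mult norm_powr_real_powr)
  have InG: "(\<integral>t. norm (G A t) \<partial>pos_measure) = Gamma (Re s) * A powr (- Re s)" if "A > 0" for A
    using gamma_power_integral_real(2)[OF s that] by (subst Bochner_Integration.integral_cong[OF refl nG]) auto
  define h where "h = (\<lambda>t. G (K\<^sup>2) t)"
  have hG: "h t * of_real (exp (- t * A)) = G (A + K\<^sup>2) t" for t A
  proof -
    have "exp (- (A + K\<^sup>2) * t) = exp (- K\<^sup>2 * t) * exp (- t * A)"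
      unfolding exp_add[symmetric] by (rule arg_cong[of _ _ exp]) (simp add: algebra_simps)
    then show ?thesis unfolding h_def G_def by (simp only: of_real_mult mult.assoc)
  qed
  define Fa where "Fa = (\<lambda>m t. (a (Suc m) / 2) * (G ((lam (Suc m) - x)\<^sup>2 + K\<^sup>2) t + (-1) ^ \<delta> * G ((lam (Suc m) + x)\<^sup>2 + K\<^sup>2) t))"
  have A': "(l - y)\<^sup>2 + K\<^sup>2 > 0" for l y using A[of l "- y"] by simp
  have iFa: "integrable pos_measure (Fa m)" for m
    unfolding Fa_def by (intro integrable_mult_right Bochner_Integration.integrable_add iG A A')
  have bFa: "norm (Fa m t) \<le> norm (a (Suc m)) / 2 * (norm (G ((lam (Suc m) - x)\<^sup>2 + K\<^sup>2) t) + norm (G ((lam (Suc m) + x)\<^sup>2 + K\<^sup>2) t))" for m t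
    unfolding Fa_def norm_mult
    by (intro mult_mono order_trans[OF norm_triangle_ineq add_mono]) (auto simp: norm_mult norm_power norm_divide)
  have IbFa: "(\<integral>t. norm (Fa m t) \<partial>pos_measure) \<le> Gamma (Re s) / 2 * (norm (a (Suc m)) * ((lam (Suc m) - x)\<^sup>2 + K\<^sup>2) powr (- Re s)
      + norm (a (Suc m)) * ((lam (Suc m) + x)\<^sup>2 + K\<^sup>2) powr (- Re s))" for m
  proof -
    have "(\<integral>t. norm (Fa m t) \<partial>pos_measure) \<le> (\<integral>t. norm (a (Suc m)) / 2 * (norm (G ((lam (Suc m) - x)\<^sup>2 + K\<^sup>2) t) + norm (G ((lam (Suc m) + x)\<^sup>2 + K\<^sup>2) t)) \<partial>pos_measure)"
      by (intro integral_mono bFa integrable_norm iFa integrable_mult_right Bochner_Integration.integrable_add iG A A')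
    also have "\<dots> = norm (a (Suc m)) / 2 * ((\<integral>t. norm (G ((lam (Suc m) - x)\<^sup>2 + K\<^sup>2) t) \<partial>pos_measure) + (\<integral>t. norm (G ((lam (Suc m) + x)\<^sup>2 + K\<^sup>2) t) \<partial>pos_measure))"
      by (subst integral_mult_right_zero, subst Bochner_Integration.integral_add) (auto intro!: integrable_norm iG A A')
    also have "\<dots> = Gamma (Re s) / 2 * (norm (a (Suc m)) * ((lam (Suc m) - x)\<^sup>2 + K\<^sup>2) powr (- Re s)
      + norm (a (Suc m)) * ((lam (Suc m) + x)\<^sup>2 + K\<^sup>2) powr (- Re s))"
      unfolding InG[OF A] InG[OF A'] by (simp add: algebra_simps)
    finally show ?thesis .
  qed
  have sIFa: "summable (\<lambda>m. \<integral>t. norm (Fa m t) \<partial>pos_measure)"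
    by (rule summable_comparison_test'[OF summable_mult[OF summable_add[OF sm sp], of "Gamma (Re s) / 2"], of 0]) (use IbFa in auto)
  have pw: "(\<Sum>m. Fa m t) = h t * (\<Sum>m. a (Suc m) * of_real (shifted_gaussian \<delta> t x (lam (Suc m))))"
    and smFa: "summable (\<lambda>m. norm (Fa m t))" if "t \<in> space pos_measure" for t
  proof -
    have t: "t > 0" using that by simp
    have e: "Fa m t = h t * (a (Suc m) * of_real (shifted_gaussian \<delta> t x (lam (Suc m))))" for m
      unfolding Fa_def hG[symmetric] shifted_gaussian_def by (simp add: algebra_simps add_divide_distrib)
    have n: "norm (a (Suc m) * of_real (shifted_gaussian \<delta> t x (lam (Suc m)))) \<le> 
        exp (- t * x\<^sup>2) * (norm (a (Suc m)) * lam (Suc m) ^ 0 * exp (- (lam (Suc m))\<^sup>2 * (t / 2))) * exp (2 * t * x\<^sup>2)" for m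
    proof -
      define l where "l = lam (Suc m)"
      have q: "exp (- t * (l + y)\<^sup>2) \<le> exp (- t * y\<^sup>2) * exp (- l\<^sup>2 * (t / 2)) * exp (2 * t * y\<^sup>2)" for y
      proof -
        \<comment> \<open>This square encodes (l + y)^2 >= l^2/2 - y^2, so a Gaussian with shifted
          centre is dominated by a centred one of half the rate.\<close>
        have "0 \<le> t / 2 * (l + 2 * y)\<^sup>2" using t by simp
        then have "- t * (l + y)\<^sup>2 \<le> - t * y\<^sup>2 + - l\<^sup>2 * (t / 2) + 2 * t * y\<^sup>2"
          by (simp add: power2_eq_square algebra_simps)
        then show ?thesis by (simp only: exp_add[symmetric] exp_le_cancel_iff)
      qed
      have "\<bar>shifted_gaussian \<delta> t x l\<bar> \<le> (exp (- t * (l - x)\<^sup>2) + exp (- t * (l + x)\<^sup>2)) / 2"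
      proof -
        have "\<bar>(p + (-1) ^ \<delta> * q) / 2\<bar> \<le> (p + q) / 2" if "0 \<le> p" "0 \<le> q" for p q :: real
          using \<delta> that by (elim disjE) (auto simp: abs_le_iff)
        then show ?thesis unfolding shifted_gaussian_def by simp
      qed
      also have "\<dots> \<le> exp (- t * x\<^sup>2) * exp (- l\<^sup>2 * (t / 2)) * exp (2 * t * x\<^sup>2)"
        using q[of x] q[of "- x"] by simp
      finally have "\<bar>shifted_gaussian \<delta> t x l\<bar> \<le> exp (- t * x\<^sup>2) * exp (- l\<^sup>2 * (t / 2)) * exp (2 * t * x\<^sup>2)" .
      from mult_left_mono[OF this norm_ge_zero[of "a (Suc m)"]]
      show ?thesis by (simp add: norm_mult l_def mult_ac)
    qed
    have t2: "t / 2 > 0" using t by simp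
    have S: "summable (\<lambda>m. norm (a (Suc m) * of_real (shifted_gaussian \<delta> t x (lam (Suc m)))))"
      by (rule summable_comparison_test'[OF summable_mult2[OF summable_mult[OF theta_terms_summable[OF fra class_BD(4)[OF B] t2, of 0],
            of "exp (- t * x\<^sup>2)"], of "exp (2 * t * x\<^sup>2)"], of 0])
        (use n in \<open>simp only: real_norm_def abs_norm_cancel\<close>)
    show "summable (\<lambda>m. norm (Fa m t))" unfolding e norm_mult[of "h t"] by (intro summable_mult S)
    show "(\<Sum>m. Fa m t) = h t * (\<Sum>m. a (Suc m) * of_real (shifted_gaussian \<delta> t x (lam (Suc m))))"
      unfolding e by (rule suminf_mult[OF summable_norm_cancel[OF S]])
  qed
  have La: "(\<lambda>m. integral\<^sup>L pos_measure (Fa m)) sums (\<integral>t. (\<Sum>m. Fa m t) \<partial>pos_measure)"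
    and iLa: "integrable pos_measure (\<lambda>t. \<Sum>m. Fa m t)"
    using sums_integral[OF iFa AE_I2[OF smFa] sIFa] integrable_suminf[OF iFa AE_I2[OF smFa] sIFa] by auto
  have IFa: "integral\<^sup>L pos_measure (Fa m) = Gamma s * (a (Suc m) * ((of_real ((lam (Suc m) - x)\<^sup>2 + K\<^sup>2) powr (- s) + (-1) ^ \<delta> * of_real ((lam (Suc m) + x)\<^sup>2 + K\<^sup>2) powr (- s)) / 2))" for m
  proof -
    have "integral\<^sup>L pos_measure (Fa m) = (a (Suc m) / 2) * (integral\<^sup>L pos_measure (G ((lam (Suc m) - x)\<^sup>2 + K\<^sup>2))
        + (\<integral>t. (-1) ^ \<delta> * G ((lam (Suc m) + x)\<^sup>2 + K\<^sup>2) t \<partial>pos_measure))"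
      unfolding Fa_def integral_mult_right_zero[of _ "a (Suc m) / 2"]
      by (subst Bochner_Integration.integral_add[OF iG[OF A'] integrable_mult_right[OF iG[OF A]]]) (rule refl)
    also have "\<dots> = (a (Suc m) / 2) * (Gamma s * of_real ((lam (Suc m) - x)\<^sup>2 + K\<^sup>2) powr (- s)
        + (-1) ^ \<delta> * (Gamma s * of_real ((lam (Suc m) + x)\<^sup>2 + K\<^sup>2) powr (- s)))"
      unfolding integral_mult_right_zero IG[OF A] IG[OF A'] ..
    finally show ?thesis by (simp add: algebra_simps)
  qed
  define Fb where "Fb = (\<lambda>m t. (b (Suc m) * of_real (trig \<delta> (2 * mu (Suc m) * x))) * (of_real t powr ((s - 1/2) - 1) * of_real (exp (- K\<^sup>2 * t - (mu (Suc m))\<^sup>2 / t))))"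
  have mp: "mu (Suc m) > 0" for m using frequencies_pos[OF frb] .
  have iBI: "integrable pos_measure (\<lambda>t. of_real t powr ((s - 1/2) - 1) * complex_of_real (exp (- K\<^sup>2 * t - (mu (Suc m))\<^sup>2 / t)))" for m
    by (rule bessel_integrand_integrable[OF K2]) (use mp[of m] in simp)
  have iFb: "integrable pos_measure (Fb m)" for m
    unfolding Fb_def by (intro integrable_mult_right iBI)
  have trig1: "\<bar>trig \<delta> y\<bar> \<le> 1" for y by (simp add: trig_def)
  have nBI: "norm (of_real t powr ((s - 1/2) - 1) * complex_of_real (exp (- K\<^sup>2 * t - c / t))) = t powr (Re s - 3/2) * exp (- K\<^sup>2 * t - c / t)"
    if "t \<in> space pos_measure" for t c
    using that by (simp add: norm_mult norm_powr_real_powr)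
  have irB: "integrable pos_measure (\<lambda>t. t powr (Re s - 3/2) * exp (- K\<^sup>2 * t - (mu (Suc m))\<^sup>2 / t))" for m
    using integrable_norm[OF iBI[of m]] by (subst (asm) Bochner_Integration.integrable_cong[OF refl nBI]) auto
  have bFb: "norm (Fb m t) \<le> norm (b (Suc m)) * (t powr (Re s - 3/2) * exp (- K\<^sup>2 * t - (mu (Suc m))\<^sup>2 / t))"
    if "t \<in> space pos_measure" for m t
    unfolding Fb_def norm_mult[of "b (Suc m) * _"] nBI[OF that]
    using trig1[of "2 * mu (Suc m) * x"] by (intro mult_right_mono) (auto simp: norm_mult mult_left_le)
  have IbFb: "(\<integral>t. norm (Fb m t) \<partial>pos_measure) \<le> norm (b (Suc m)) * (\<integral>t. t powr (Re s - 3/2) * exp (- K\<^sup>2 * t - (mu (Suc m))\<^sup>2 / t) \<partial>pos_measure)" for m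
    unfolding integral_mult_right_zero[symmetric]
    by (intro integral_mono integrable_norm iFb integrable_mult_right irB bFb)
  have sIFb: "summable (\<lambda>m. \<integral>t. norm (Fb m t) \<partial>pos_measure)"
    by (rule summable_comparison_test'[OF sb, of 0]) (use IbFb in auto)
  define gb where "gb = (\<lambda>m t. b (Suc m) * complex_of_real (t powr (- 1/2) * exp (- (mu (Suc m))\<^sup>2 / t) * trig \<delta> (2 * mu (Suc m) * x)))"
  have eb: "Fb m t = h t * gb m t" if "t \<in> space pos_measure" for m t
  proof -
    have t: "t > 0" using that by simp
    note 1 = powr_minus_half_split[OF t, of s]
    have 2: "exp (- K\<^sup>2 * t - (mu (Suc m))\<^sup>2 / t) = exp (- K\<^sup>2 * t) * exp (- (mu (Suc m))\<^sup>2 / t)"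
      by (simp flip: exp_add)
    show ?thesis unfolding Fb_def gb_def h_def G_def 1 2 by (simp only: of_real_mult mult_ac)
  qed
  have smFb: "summable (\<lambda>m. norm (Fb m t))" and pwb: "(\<Sum>m. Fb m t) = h t * (\<Sum>m. gb m t)" if "t \<in> space pos_measure" for t
  proof -
    have t: "t > 0" using that by simp
    have n: "norm (gb m t) \<le> t powr (- 1/2) * (norm (b (Suc m)) * mu (Suc m) ^ 0 * exp (- (mu (Suc m))\<^sup>2 * (1 / t)))" for m
    proof -
      have "norm (gb m t) = norm (b (Suc m)) * (t powr (- 1/2) * exp (- (mu (Suc m))\<^sup>2 / t) * \<bar>trig \<delta> (2 * mu (Suc m) * x)\<bar>)"
        unfolding gb_def norm_mult norm_of_real abs_mult by simp
      also have "\<dots> \<le> norm (b (Suc m)) * (t powr (- 1/2) * exp (- (mu (Suc m))\<^sup>2 / t) * 1)"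
        by (intro mult_left_mono trig1) auto
      finally show ?thesis by (simp add: mult_ac)
    qed
    have t1: "1 / t > 0" using t by simp
    have S: "summable (\<lambda>m. norm (gb m t))"
      by (rule summable_comparison_test'[OF summable_mult[OF theta_terms_summable[OF frb class_BD(5)[OF B] t1, of 0], of "t powr (- 1/2)"], of 0])
        (use n in \<open>simp only: real_norm_def abs_norm_cancel\<close>)
    show "summable (\<lambda>m. norm (Fb m t))" unfolding eb[OF that] norm_mult[of "h t"] by (intro summable_mult S)
    show "(\<Sum>m. Fb m t) = h t * (\<Sum>m. gb m t)"
      unfolding eb[OF that] by (rule suminf_mult[OF summable_norm_cancel[OF S]])
  qed
  have Lb: "(\<lambda>m. integral\<^sup>L pos_measure (Fb m)) sums (\<integral>t. (\<Sum>m. Fb m t) \<partial>pos_measure)"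
    and iLb: "integrable pos_measure (\<lambda>t. \<Sum>m. Fb m t)"
    using sums_integral[OF iFb AE_I2[OF smFb] sIFb] integrable_suminf[OF iFb AE_I2[OF smFb] sIFb] by auto
  have IFb: "integral\<^sup>L pos_measure (Fb m) = b (Suc m) * of_real (trig \<delta> (2 * mu (Suc m) * x)) * (2 * of_real (mu (Suc m) / K) powr (s - 1/2) * bessel_K (s - 1/2) (2 * K * mu (Suc m)))" for m
    unfolding Fb_def integral_mult_right_zero by (subst bessel_integral[OF K mp]) simp
  define Cc where "Cc = (\<lambda>t. if \<delta> = 0 then \<phi> 0 * complex_of_real (exp (- t * x\<^sup>2)) + of_real (sqrt pi / 2 * t powr (- 1/2)) * residue \<phi> 1 else 0)"
  have pwc: "(\<Sum>m. Fa m t) = h t * Cc t + (\<Sum>m. Fb m t)" if "t \<in> space pos_measure" for t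
    using shifted_theta_transformation[OF B, of t x] that
    unfolding pw[OF that] pwb[OF that] gb_def Cc_def by (simp add: distrib_left)
  have IC: "(\<integral>t. h t * Cc t \<partial>pos_measure) = (if \<delta> = 0 then \<phi> 0 * (Gamma s * of_real (x\<^sup>2 + K\<^sup>2) powr (- s))
          + of_real (sqrt pi / 2) * residue \<phi> 1 * (Gamma (s - 1/2) * of_real K powr (1 - 2 * s)) else 0)"
  proof (cases "\<delta> = 0")
    case True
    define H2 where "H2 = (\<lambda>t. residue \<phi> 1 * (complex_of_real t powr ((s - 1/2) - 1) * of_real (exp (- K\<^sup>2 * t))))"
    have H2: "integrable pos_measure H2" "integral\<^sup>L pos_measure H2 = residue \<phi> 1 * (Gamma (s - 1/2) * of_real K powr (1 - 2 * s))"
    proof -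
      have "integrable pos_measure H2 \<and> integral\<^sup>L pos_measure H2 = residue \<phi> 1 * (Gamma (s - 1/2) * of_real K powr (1 - 2 * s))"
      proof (cases "residue \<phi> 1 = 0")
        case False
        then have w: "Re (s - 1/2) > 0" using res by simp
        have "complex_of_real (K\<^sup>2) powr (- (s - 1/2)) = of_real K powr (1 - 2 * s)"
          using powr_of_real_square[OF K, of "- (s - 1/2)"] by (simp add: algebra_simps)
        then show ?thesis unfolding H2_def
          using gamma_power_integral[OF w K2] by (simp add: integral_mult_right_zero)
      qed (simp add: H2_def)
      then show "integrable pos_measure H2" "integral\<^sup>L pos_measure H2 = residue \<phi> 1 * (Gamma (s - 1/2) * of_real K powr (1 - 2 * s))"
        by auto
    qed
    have "h t * Cc t = \<phi> 0 * G (x\<^sup>2 + K\<^sup>2) t + of_real (sqrt pi / 2) * H2 t" if "t \<in> space pos_measure" for t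
    proof -
      have t: "t > 0" using that by simp
      note 1 = powr_minus_half_split[OF t, of s]
      have 2: "h t * (of_real (sqrt pi / 2 * t powr (- 1/2)) * residue \<phi> 1) = of_real (sqrt pi / 2) * H2 t"
        unfolding H2_def 1 h_def G_def by (simp only: of_real_mult mult_ac)
      have 3: "h t * (\<phi> 0 * of_real (exp (- t * x\<^sup>2))) = \<phi> 0 * G (x\<^sup>2 + K\<^sup>2) t"
        unfolding hG[symmetric] by (simp only: mult_ac)
      have "Cc t = \<phi> 0 * complex_of_real (exp (- t * x\<^sup>2)) + of_real (sqrt pi / 2 * t powr (- 1/2)) * residue \<phi> 1"
        using True by (simp add: Cc_def)
      then show ?thesis by (simp only: distrib_left 2 3)
    qed
    then have "(\<integral>t. h t * Cc t \<partial>pos_measure) = (\<integral>t. \<phi> 0 * G (x\<^sup>2 + K\<^sup>2) t + of_real (sqrt pi / 2) * H2 t \<partial>pos_measure)"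
      by (intro Bochner_Integration.integral_cong refl)
    also have "\<dots> = \<phi> 0 * (Gamma s * of_real (x\<^sup>2 + K\<^sup>2) powr (- s)) + of_real (sqrt pi / 2) * (residue \<phi> 1 * (Gamma (s - 1/2) * of_real K powr (1 - 2 * s)))"
      using A[of x 0] by (subst Bochner_Integration.integral_add)
        (auto intro!: iG H2(1) integrable_mult_right simp only: integral_mult_right_zero H2(2) IG add_0_right)
    finally show ?thesis using True by (simp add: mult.assoc)
  qed (simp add: Cc_def)
  \<comment> \<open>Integrability of the correction term follows from that of the two series whose
    difference it is, for both parities at once.\<close>
  have "integrable pos_measure (\<lambda>t. (\<Sum>m. Fa m t) - (\<Sum>m. Fb m t))"
    by (rule Bochner_Integration.integrable_diff[OF iLa iLb])
  then have iC: "integrable pos_measure (\<lambda>t. h t * Cc t)"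
    by (subst (asm) Bochner_Integration.integrable_cong[OF refl, of _ _ "\<lambda>t. h t * Cc t"]) (use pwc in auto)
  have "(\<integral>t. (\<Sum>m. Fa m t) \<partial>pos_measure) = (\<integral>t. h t * Cc t + (\<Sum>m. Fb m t) \<partial>pos_measure)"
    by (intro Bochner_Integration.integral_cong refl pwc)
  also have "\<dots> = (\<integral>t. h t * Cc t \<partial>pos_measure) + (\<integral>t. (\<Sum>m. Fb m t) \<partial>pos_measure)"
    by (rule Bochner_Integration.integral_add[OF iC iLb])
  finally have main: "(\<integral>t. (\<Sum>m. Fa m t) \<partial>pos_measure) = (\<integral>t. h t * Cc t \<partial>pos_measure) + (\<integral>t. (\<Sum>m. Fb m t) \<partial>pos_measure)" .
  define V where "V = (\<lambda>m. a (Suc m) * ((of_real ((lam (Suc m) - x)\<^sup>2 + K\<^sup>2) powr (- s) + (-1) ^ \<delta> * of_real ((lam (Suc m) + x)\<^sup>2 + K\<^sup>2) powr (- s)) / 2))"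
  \<comment> \<open>Termwise integration yields the series with the factor Gamma(s) inside; this
    factor has to be nonzero for the summability of \<open>V\<close> itself to follow.\<close>
  have Gn0: "Gamma s \<noteq> 0" using s by (auto simp: Gamma_eq_zero_iff dest: notin_nonpos_Ints_Re)
  have "(\<lambda>m. Gamma s * V m) sums (\<integral>t. (\<Sum>m. Fa m t) \<partial>pos_measure)"
    using La unfolding IFa V_def .
  then have "Gamma s * (\<Sum>m. V m) = (\<integral>t. (\<Sum>m. Fa m t) \<partial>pos_measure)"
    using Gn0 by (simp add: sums_mult_iff[of "Gamma s"] sums_iff) (metis sums_iff sums_mult_D suminf_mult summable_mult_D sums_summable)
  then show ?thesis unfolding main IC using Lb unfolding IFb V_def by (simp only: sums_iff)
qed

section \<open>Product majorants for the dual side\<close>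

lemma exp_minus_le_powr:
  fixes \<sigma> :: real
  assumes "\<sigma> > 0"
  obtains C where "C > 0" "\<And>u. u > 0 \<Longrightarrow> exp (- u) \<le> C * u powr (- \<sigma>)"
proof -
  obtain N :: nat where N: "\<sigma> \<le> real N" using real_arch_simple by blast
  have "exp (- u) \<le> fact N * u powr (- \<sigma>)" if u: "u > 0" for u :: real
  proof -
    have "u powr \<sigma> \<le> fact N * exp u"
    proof (cases "u \<ge> 1")
      case True
      then have "u powr \<sigma> \<le> u powr real N" using N by (intro powr_mono)
      also have "\<dots> \<le> fact N * exp u" using power_le_exp[of u N] u by (simp add: powr_realpow)
      finally show ?thesis .
    next
      case False
      then have "u powr \<sigma> \<le> 1" using u assms by (simp add: powr_le1)
      also have "1 \<le> fact N * exp u" using u mult_mono[of 1 "fact N :: real" 1 "exp u"] by (simp add: fact_ge_1)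
      finally show ?thesis .
    qed
    then show ?thesis using u by (simp add: exp_minus powr_minus field_simps)
  qed
  then show ?thesis using that[of "fact N"] by simp
qed

lemma bessel_integrand_integrable_real:
  fixes p \<alpha> \<beta> :: real
  assumes "\<alpha> > 0" "\<beta> > 0"
  shows "integrable pos_measure (\<lambda>t. t powr p * exp (- \<alpha> * t - \<beta> / t))"
proof -
  have e: "norm (complex_of_real t powr (of_real (p + 1) - 1) * of_real (exp (- \<alpha> * t - \<beta> / t))) = t powr p * exp (- \<alpha> * t - \<beta> / t)"
    if "t \<in> space pos_measure" for t
    using that by (simp add: norm_mult norm_powr_real_powr)
  show ?thesis
    using integrable_norm[OF bessel_integrand_integrable[OF assms, of "of_real (p + 1)"]]
    by (subst (asm) Bochner_Integration.integrable_cong[OF refl e]) auto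
qed

text \<open>Half of the exponent is kept for the convergence in t; the other half is at least K m by AM-GM.\<close>

lemma bessel_integral_bound:
  fixes p \<sigma> K1 m1 :: real
  assumes K1: "K1 > 0" and m1: "m1 > 0" and \<sigma>: "\<sigma> > 0"
  obtains C where "C \<ge> 0" "\<And>K m. K \<ge> K1 \<Longrightarrow> m \<ge> m1 \<Longrightarrow>
    (\<integral>t. t powr p * exp (- K\<^sup>2 * t - m\<^sup>2 / t) \<partial>pos_measure) \<le> C * (K * m) powr (- \<sigma>)"
proof -
  obtain C1 where C1: "C1 > 0" "\<And>u. u > 0 \<Longrightarrow> exp (- u) \<le> C1 * u powr (- \<sigma>)"
    using exp_minus_le_powr[OF \<sigma>] by blast
  define C0 where "C0 = (\<integral>t. t powr p * exp (- (K1\<^sup>2 / 2) * t - (m1\<^sup>2 / 2) / t) \<partial>pos_measure)"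
  have C0: "C0 \<ge> 0" unfolding C0_def by (intro integral_nonneg_AE AE_I2) auto
  have i0: "integrable pos_measure (\<lambda>t. t powr p * exp (- (K1\<^sup>2 / 2) * t - (m1\<^sup>2 / 2) / t))"
    using K1 m1 by (intro bessel_integrand_integrable_real) auto
  show ?thesis
  proof (rule that[of "C0 * C1"])
    fix K m :: real assume K: "K \<ge> K1" and m: "m \<ge> m1"
    have Kp: "K > 0" and mp: "m > 0" using K m K1 m1 by auto
    have "(\<integral>t. t powr p * exp (- K\<^sup>2 * t - m\<^sup>2 / t) \<partial>pos_measure)
        \<le> (\<integral>t. exp (- (K * m)) * (t powr p * exp (- (K1\<^sup>2 / 2) * t - (m1\<^sup>2 / 2) / t)) \<partial>pos_measure)"
    proof (rule integral_mono)
      show "integrable pos_measure (\<lambda>t. t powr p * exp (- K\<^sup>2 * t - m\<^sup>2 / t))"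
        using Kp mp by (intro bessel_integrand_integrable_real) auto
      show "integrable pos_measure (\<lambda>t. exp (- (K * m)) * (t powr p * exp (- (K1\<^sup>2 / 2) * t - (m1\<^sup>2 / 2) / t)))"
        by (intro integrable_mult_right i0)
      fix t assume "t \<in> space pos_measure"
      then have t: "t > 0" by simp
      have s: "K1\<^sup>2 \<le> K\<^sup>2" "m1\<^sup>2 \<le> m\<^sup>2" using K m K1 m1 by (auto intro: power_mono)
      have 1: "K\<^sup>2 * t / 2 + m\<^sup>2 / t / 2 \<ge> K * m"
      proof -
        have "0 \<le> (K * t - m)\<^sup>2 / (2 * t)" using t by simp
        also have "\<dots> = K\<^sup>2 * t / 2 + m\<^sup>2 / t / 2 - K * m"
          using t by (simp add: power2_eq_square field_simps)
        finally show ?thesis by simp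
      qed
      have 2: "K1\<^sup>2 * t / 2 \<le> K\<^sup>2 * t / 2" using s t by simp
      have 3: "m1\<^sup>2 / t / 2 \<le> m\<^sup>2 / t / 2" using s t by (simp add: divide_right_mono)
      have "- K\<^sup>2 * t - m\<^sup>2 / t \<le> - (K * m) + (- (K1\<^sup>2 / 2) * t - (m1\<^sup>2 / 2) / t)"
      proof -
        have lin: "- A - B \<le> - P + (- (A1 / 2) - B1 / 2)" if "P \<le> A / 2 + B / 2" "A1 / 2 \<le> A / 2" "B1 / 2 \<le> B / 2" for A B P A1 B1 :: real
          using that by linarith
        have eqs: "- (K1\<^sup>2 / 2) * t - (m1\<^sup>2 / 2) / t = - (K1\<^sup>2 * t / 2) - m1\<^sup>2 / t / 2" "- K\<^sup>2 * t = - (K\<^sup>2 * t)" by simp_all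
        show ?thesis unfolding eqs by (rule lin[OF 1 2 3])
      qed
      then have "exp (- K\<^sup>2 * t - m\<^sup>2 / t) \<le> exp (- (K * m)) * exp (- (K1\<^sup>2 / 2) * t - (m1\<^sup>2 / 2) / t)"
        by (simp only: exp_add[symmetric] exp_le_cancel_iff)
      from mult_left_mono[OF this powr_ge_zero[of t p]]
      show "t powr p * exp (- K\<^sup>2 * t - m\<^sup>2 / t) \<le> exp (- (K * m)) * (t powr p * exp (- (K1\<^sup>2 / 2) * t - (m1\<^sup>2 / 2) / t))"
        by (simp only: mult.left_commute)
    qed
    also have "\<dots> = exp (- (K * m)) * C0" unfolding C0_def by (rule integral_mult_right_zero)
    also have "\<dots> \<le> (C1 * (K * m) powr (- \<sigma>)) * C0"
      using C1(2)[of "K * m"] Kp mp C0 by (intro mult_right_mono) auto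
    finally show "(\<integral>t. t powr p * exp (- K\<^sup>2 * t - m\<^sup>2 / t) \<partial>pos_measure) \<le> C0 * C1 * (K * m) powr (- \<sigma>)"
      by (simp add: mult_ac)
  qed (use C0 C1 in auto)
qed

section \<open>Expansion of the double series\<close>

text \<open>A majorant that is a product of two convergent series makes the family absolutely
  summable over pairs, so that row sums and unordered sum agree. It is used for the double series
  and for the series of Bessel terms alike.\<close>

lemma has_sum_product_dominated:
  fixes F :: "nat \<times> nat \<Rightarrow> complex"
  assumes f: "summable f" "\<And>n. f n \<ge> 0" and g: "summable g" "\<And>m. g m \<ge> 0"
    and le: "\<And>n m. norm (F (n, m)) \<le> f n * g m"
  shows "summable (\<lambda>m. norm (F (n, m)))" "summable (\<lambda>n. \<Sum>m. F (n, m))"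
    "(F has_sum (\<Sum>n. \<Sum>m. F (n, m))) UNIV"
proof -
  have row: "summable (\<lambda>m. norm (F (n, m)))" for n
    by (rule summable_comparison_test'[OF summable_mult[OF g(1), of "f n"], of 0]) (use le in auto)
  then show "summable (\<lambda>m. norm (F (n, m)))" .
  have hs: "(h has_sum suminf h) UNIV" if "summable h" "\<And>n. h n \<ge> 0" for h :: "nat \<Rightarrow> real"
    using that by (intro norm_summable_imp_has_sum summable_sums) auto
  have "(\<lambda>(n, m). f n * g m) summable_on Sigma UNIV (\<lambda>_. UNIV)"
  proof (rule summable_on_SigmaI)
    show "((\<lambda>m. case (n, m) of (n, m) \<Rightarrow> f n * g m) has_sum f n * suminf g) UNIV" for n
      by (simp, intro has_sum_cmult_right hs g)
    show "(\<lambda>n. f n * suminf g) summable_on UNIV"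
      using hs[OF f] by (intro summable_on_cmult_left) (auto simp: summable_on_def)
  qed (use f g in auto)
  then have "(\<lambda>x. norm (F x)) summable_on Sigma UNIV (\<lambda>_. UNIV)"
    by (rule Infinite_Sum.abs_summable_on_comparison_test') (use le in auto)
  then have sF: "F summable_on Sigma UNIV (\<lambda>_. UNIV)" by (rule abs_summable_summable)
  have "((\<lambda>m. F (n, m)) has_sum (\<Sum>m. F (n, m))) UNIV" for n
    by (rule norm_summable_imp_has_sum[OF row summable_sums[OF summable_norm_cancel[OF row]]])
  from has_sum_SigmaD[OF has_sum_infsum[OF sF] this]
  have *: "((\<lambda>n. \<Sum>m. F (n, m)) has_sum infsum F (Sigma UNIV (\<lambda>_. UNIV))) UNIV" .
  from has_sum_imp_sums[OF this] show "summable (\<lambda>n. \<Sum>m. F (n, m))" by (rule sums_summable)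
  from has_sum_imp_sums[OF *] have "infsum F (Sigma UNIV (\<lambda>_. UNIV)) = (\<Sum>n. \<Sum>m. F (n, m))"
    by (simp add: sums_iff)
  then show "(F has_sum (\<Sum>n. \<Sum>m. F (n, m))) UNIV" using has_sum_infsum[OF sF] by simp
qed

section \<open>The double series over the integer lattice\<close>

lemma extend_coeff_simps:
  "extend_coeff \<delta> a \<phi> (1 + int n) = a (Suc n)"
  "extend_coeff \<delta> a \<phi> (- 1 - int n) = (- 1) ^ \<delta> * a (Suc n)"
  "extend_coeff \<delta> a \<phi> 0 = - 2 * \<phi> (- of_nat \<delta>)"
  by (auto simp: extend_coeff_def nat_add_distrib)

lemma extend_freq_simps:
  "extend_freq lam (1 + int n) = lam (Suc n)"
  "extend_freq lam (- 1 - int n) = - lam (Suc n)"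
  "extend_freq lam 0 = 0"
  by (auto simp: extend_freq_def nat_add_distrib)

lemma has_sum_reindexI:
  assumes "inj h" "(g has_sum x) UNIV" "\<And>y. f (h y) = g y" "range h = A"
  shows "(f has_sum x) A"
  using assms has_sum_reindex[of h UNIV f x] by (simp add: o_def flip: assms(4))

lemma range_int_shift:
  "range (\<lambda>k. 1 + int k) = {0<..}" "range (\<lambda>k. - 1 - int k) = {..<0}"
proof -
  show "range (\<lambda>k. 1 + int k) = {0<..}"
  proof (intro equalityI subsetI)
    fix x :: int assume "x \<in> {0<..}"
    then show "x \<in> range (\<lambda>k. 1 + int k)" by (intro range_eqI[of _ _ "nat (x - 1)"]) auto
  qed auto
  show "range (\<lambda>k. - 1 - int k) = {..<0}"
  proof (intro equalityI subsetI)
    fix x :: int assume "x \<in> {..<0}"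
    then show "x \<in> range (\<lambda>k. - 1 - int k)" by (intro range_eqI[of _ _ "nat (- x - 1)"]) auto
  qed auto
qed

lemma range_prod_swap: "range (\<lambda>(n, m). (f m, g n)) = {(x, y). x \<in> range f \<and> y \<in> range g}"
proof (intro equalityI subsetI)
  fix p assume "p \<in> {(x, y). x \<in> range f \<and> y \<in> range g}"
  then obtain m n where "p = (f m, g n)" by auto
  then show "p \<in> range (\<lambda>(n, m). (f m, g n))" by (intro range_eqI[of _ _ "(n, m)"]) simp
qed auto

text \<open>The punctured lattice splits into four open quadrants and four half axes. Opposite
  quadrants agree, since Q is even and the parity sign occurs twice; the two mixed quadrants carry
  the sign once. Opposite half axes have weights 1 and \<open>\<epsilon>\<close>, so they double for
  even parity and cancel for odd parity.\<close>

lemma epstein_has_sum: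
  fixes a b c :: real and \<delta> :: nat
  defines "Q \<equiv> \<lambda>u v. a * u\<^sup>2 + b * u * v + c * v\<^sup>2" and "\<epsilon> \<equiv> (- 1 :: complex) ^ \<delta>"
  assumes S1: "((\<lambda>(n, m). a1 (Suc m) * a2 (Suc n) / of_real (Q (lam (Suc m)) (lam' (Suc n))) powr s) has_sum S1) UNIV"
    and S2: "((\<lambda>(n, m). a1 (Suc m) * a2 (Suc n) / of_real (Q (lam (Suc m)) (- lam' (Suc n))) powr s) has_sum S2) UNIV"
    and X1: "((\<lambda>m. a1 (Suc m) / of_real (Q (lam (Suc m)) 0) powr s) has_sum X1) UNIV"
    and X2: "((\<lambda>n. a2 (Suc n) / of_real (Q 0 (lam' (Suc n))) powr s) has_sum X2) UNIV"
  shows "(epstein_term s a b c (extend_coeff \<delta> a1 \<phi>1) (extend_coeff \<delta> a2 \<phi>2) (extend_freq lam) (extend_freq lam') has_sum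
     2 * (S1 + \<epsilon> * S2) + (1 + \<epsilon>) * (- 2 * \<phi>2 (- of_nat \<delta>)) * X1 + (1 + \<epsilon>) * (- 2 * \<phi>1 (- of_nat \<delta>)) * X2) (UNIV - {(0, 0)})"
proof -
  define F where "F = epstein_term s a b c (extend_coeff \<delta> a1 \<phi>1) (extend_coeff \<delta> a2 \<phi>2) (extend_freq lam) (extend_freq lam')"
  have Feq: "F (m, n) = extend_coeff \<delta> a1 \<phi>1 m * extend_coeff \<delta> a2 \<phi>2 n / of_real (Q (extend_freq lam m) (extend_freq lam' n)) powr s" for m n
    by (simp add: F_def epstein_term_def Q_def)
  have ee: "\<epsilon> * (\<epsilon> * y) = y" for y by (simp add: \<epsilon>_def mult.assoc[symmetric] power_mult_distrib[symmetric])
  have Qm: "Q (- u) (- v) = Q u v" "Q (- u) v = Q u (- v)" for u v by (simp_all add: Q_def)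
  have Q0: "Q (- u) 0 = Q u 0" "Q 0 (- u) = Q 0 u" for u by (simp_all add: Q_def)
  note simps = extend_coeff_simps extend_freq_simps
  \<comment> \<open>The given sums are indexed by (n, m), with rows along the second frequency
    sequence, whereas \<open>F\<close> takes the first index first; hence the swapped
    reindexing.\<close>
  have h1: "(F has_sum S1) {(x, y). x \<in> range (\<lambda>k. 1 + int k) \<and> y \<in> range (\<lambda>k. 1 + int k)}"
    by (rule has_sum_reindexI[OF _ S1 _ range_prod_swap]) (auto simp: inj_def Feq simps)
  have h2: "(F has_sum S1) {(x, y). x \<in> range (\<lambda>k. - 1 - int k) \<and> y \<in> range (\<lambda>k. - 1 - int k)}"
    by (rule has_sum_reindexI[OF _ S1 _ range_prod_swap]) (auto simp: inj_def Feq simps Qm ee mult_ac simp flip: \<epsilon>_def)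
  have h3: "(F has_sum \<epsilon> * S2) {(x, y). x \<in> range (\<lambda>k. 1 + int k) \<and> y \<in> range (\<lambda>k. - 1 - int k)}"
    by (rule has_sum_reindexI[OF _ has_sum_cmult_right[OF S2, of \<epsilon>] _ range_prod_swap]) (auto simp: inj_def Feq simps Qm ee mult_ac simp flip: \<epsilon>_def)
  have h4: "(F has_sum \<epsilon> * S2) {(x, y). x \<in> range (\<lambda>k. - 1 - int k) \<and> y \<in> range (\<lambda>k. 1 + int k)}"
    by (rule has_sum_reindexI[OF _ has_sum_cmult_right[OF S2, of \<epsilon>] _ range_prod_swap]) (auto simp: inj_def Feq simps Qm ee mult_ac simp flip: \<epsilon>_def)
  have h5: "(F has_sum (- 2 * \<phi>2 (- of_nat \<delta>)) * X1) (range (\<lambda>m. (1 + int m, 0)))"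
    by (rule has_sum_reindexI[OF _ has_sum_cmult_right[OF X1, of "- 2 * \<phi>2 (- of_nat \<delta>)"] _ refl])
      (auto simp: inj_def Feq simps Q0 mult_ac)
  have h6: "(F has_sum (\<epsilon> * (- 2 * \<phi>2 (- of_nat \<delta>))) * X1) (range (\<lambda>m. (- 1 - int m, 0)))"
    by (rule has_sum_reindexI[OF _ has_sum_cmult_right[OF X1, of "\<epsilon> * (- 2 * \<phi>2 (- of_nat \<delta>))"] _ refl])
      (auto simp: inj_def Feq simps Q0 mult_ac simp flip: \<epsilon>_def)
  have h7: "(F has_sum (- 2 * \<phi>1 (- of_nat \<delta>)) * X2) (range (\<lambda>m. (0, 1 + int m)))"
    by (rule has_sum_reindexI[OF _ has_sum_cmult_right[OF X2, of "- 2 * \<phi>1 (- of_nat \<delta>)"] _ refl])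
      (auto simp: inj_def Feq simps Q0 mult_ac)
  have h8: "(F has_sum (\<epsilon> * (- 2 * \<phi>1 (- of_nat \<delta>))) * X2) (range (\<lambda>m. (0, - 1 - int m)))"
    by (rule has_sum_reindexI[OF _ has_sum_cmult_right[OF X2, of "\<epsilon> * (- 2 * \<phi>1 (- of_nat \<delta>))"] _ refl])
      (auto simp: inj_def Feq simps Q0 mult_ac simp flip: \<epsilon>_def)
  have R: "range (\<lambda>m. (1 + int m, 0 :: int)) = {(x, y). x > 0 \<and> y = 0}" "range (\<lambda>m. (- 1 - int m, 0 :: int)) = {(x, y). x < 0 \<and> y = 0}"
    "range (\<lambda>m. (0 :: int, 1 + int m)) = {(x, y). x = 0 \<and> y > 0}" "range (\<lambda>m. (0 :: int, - 1 - int m)) = {(x, y). x = 0 \<and> y < 0}"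
  proof -
    have "range (\<lambda>m. (g m, z)) = {(x, y). x \<in> range g \<and> y = z}" "range (\<lambda>m. (z, g m)) = {(x, y). x = z \<and> y \<in> range g}"
      for g :: "nat \<Rightarrow> int" and z :: int by auto
    then show "range (\<lambda>m. (1 + int m, 0 :: int)) = {(x, y). x > 0 \<and> y = 0}" "range (\<lambda>m. (- 1 - int m, 0 :: int)) = {(x, y). x < 0 \<and> y = 0}"
      "range (\<lambda>m. (0 :: int, 1 + int m)) = {(x, y). x = 0 \<and> y > 0}" "range (\<lambda>m. (0 :: int, - 1 - int m)) = {(x, y). x = 0 \<and> y < 0}"
      by (auto simp: range_int_shift)
  qed
  define A1 :: "(int \<times> int) set" where "A1 = {(x, y). x > 0 \<and> y > 0}"
  define A2 :: "(int \<times> int) set" where "A2 = {(x, y). x < 0 \<and> y < 0}"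
  define A3 :: "(int \<times> int) set" where "A3 = {(x, y). x > 0 \<and> y < 0}"
  define A4 :: "(int \<times> int) set" where "A4 = {(x, y). x < 0 \<and> y > 0}"
  define A5 :: "(int \<times> int) set" where "A5 = {(x, y). x > 0 \<and> y = 0}"
  define A6 :: "(int \<times> int) set" where "A6 = {(x, y). x < 0 \<and> y = 0}"
  define A7 :: "(int \<times> int) set" where "A7 = {(x, y). x = 0 \<and> y > 0}"
  define A8 :: "(int \<times> int) set" where "A8 = {(x, y). x = 0 \<and> y < 0}"
  note A_defs = A1_def A2_def A3_def A4_def A5_def A6_def A7_def A8_def
  have k1: "(F has_sum S1) A1"
    using h1 unfolding A1_def range_int_shift greaterThan_iff lessThan_iff .
  have k2: "(F has_sum S1) A2"
    using h2 unfolding A2_def range_int_shift greaterThan_iff lessThan_iff .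
  have k3: "(F has_sum \<epsilon> * S2) A3"
    using h3 unfolding A3_def range_int_shift greaterThan_iff lessThan_iff .
  have k4: "(F has_sum \<epsilon> * S2) A4"
    using h4 unfolding A4_def range_int_shift greaterThan_iff lessThan_iff .
  have k5: "(F has_sum (- 2 * \<phi>2 (- of_nat \<delta>)) * X1) A5"
    using h5 unfolding A5_def R .
  have k6: "(F has_sum (\<epsilon> * (- 2 * \<phi>2 (- of_nat \<delta>))) * X1) A6"
    using h6 unfolding A6_def R .
  have k7: "(F has_sum (- 2 * \<phi>1 (- of_nat \<delta>)) * X2) A7"
    using h7 unfolding A7_def R .
  have k8: "(F has_sum (\<epsilon> * (- 2 * \<phi>1 (- of_nat \<delta>))) * X2) A8"
    using h8 unfolding A8_def R .
  have u2: "(F has_sum S1 + S1) (A1 \<union> A2)"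
    by (rule has_sum_Un_disjoint[OF k1 k2]) (auto simp: A_defs)
  have u3: "(F has_sum S1 + S1 + \<epsilon> * S2) (A1 \<union> A2 \<union> A3)"
    by (rule has_sum_Un_disjoint[OF u2 k3]) (auto simp: A_defs)
  have u4: "(F has_sum S1 + S1 + \<epsilon> * S2 + \<epsilon> * S2) (A1 \<union> A2 \<union> A3 \<union> A4)"
    by (rule has_sum_Un_disjoint[OF u3 k4]) (auto simp: A_defs)
  have u5: "(F has_sum S1 + S1 + \<epsilon> * S2 + \<epsilon> * S2 + (- 2 * \<phi>2 (- of_nat \<delta>)) * X1) (A1 \<union> A2 \<union> A3 \<union> A4 \<union> A5)"
    by (rule has_sum_Un_disjoint[OF u4 k5]) (auto simp: A_defs)
  have u6: "(F has_sum S1 + S1 + \<epsilon> * S2 + \<epsilon> * S2 + (- 2 * \<phi>2 (- of_nat \<delta>)) * X1 + (\<epsilon> * (- 2 * \<phi>2 (- of_nat \<delta>))) * X1) (A1 \<union> A2 \<union> A3 \<union> A4 \<union> A5 \<union> A6)"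
    by (rule has_sum_Un_disjoint[OF u5 k6]) (auto simp: A_defs)
  have u7: "(F has_sum S1 + S1 + \<epsilon> * S2 + \<epsilon> * S2 + (- 2 * \<phi>2 (- of_nat \<delta>)) * X1 + (\<epsilon> * (- 2 * \<phi>2 (- of_nat \<delta>))) * X1 + (- 2 * \<phi>1 (- of_nat \<delta>)) * X2) (A1 \<union> A2 \<union> A3 \<union> A4 \<union> A5 \<union> A6 \<union> A7)"
    by (rule has_sum_Un_disjoint[OF u6 k7]) (auto simp: A_defs)
  have u8: "(F has_sum S1 + S1 + \<epsilon> * S2 + \<epsilon> * S2 + (- 2 * \<phi>2 (- of_nat \<delta>)) * X1 + (\<epsilon> * (- 2 * \<phi>2 (- of_nat \<delta>))) * X1 + (- 2 * \<phi>1 (- of_nat \<delta>)) * X2 + (\<epsilon> * (- 2 * \<phi>1 (- of_nat \<delta>))) * X2) (A1 \<union> A2 \<union> A3 \<union> A4 \<union> A5 \<union> A6 \<union> A7 \<union> A8)"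
    by (rule has_sum_Un_disjoint[OF u7 k8]) (auto simp: A_defs)
  have "(x, y) \<in> A1 \<union> A2 \<union> A3 \<union> A4 \<union> A5 \<union> A6 \<union> A7 \<union> A8 \<longleftrightarrow> (x, y) \<noteq> (0, 0)" for x y
    by (cases x "0::int" rule: linorder_cases; cases y "0::int" rule: linorder_cases) (simp_all add: A_defs)
  then have "p \<in> A1 \<union> A2 \<union> A3 \<union> A4 \<union> A5 \<union> A6 \<union> A7 \<union> A8 \<longleftrightarrow> p \<in> UNIV - {(0, 0)}" for p
    by (cases p) blast
  then have "A1 \<union> A2 \<union> A3 \<union> A4 \<union> A5 \<union> A6 \<union> A7 \<union> A8 = UNIV - {(0, 0)}" by (rule set_eqI)
  with u8 have "(F has_sum S1 + S1 + \<epsilon> * S2 + \<epsilon> * S2 + (- 2 * \<phi>2 (- of_nat \<delta>)) * X1 + (\<epsilon> * (- 2 * \<phi>2 (- of_nat \<delta>))) * X1 + (- 2 * \<phi>1 (- of_nat \<delta>)) * X2 + (\<epsilon> * (- 2 * \<phi>1 (- of_nat \<delta>))) * X2) (UNIV - {(0, 0)})" by simp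
  then show ?thesis unfolding F_def by (simp add: algebra_simps)
qed

text \<open>Each frequency is bounded by x divided by the first one of the other sequence, and only
  finitely many lie below a bound. Finiteness matters because a \<open>sum\<close> over an infinite
  set would silently be 0.\<close>

lemma finite_product_fiber:
  assumes fr: "frequencies mu" "frequencies lam"
  shows "finite {(m, n). m \<ge> 1 \<and> n \<ge> 1 \<and> mu m * lam n = x}"
proof -
  have fin: "finite {m. m \<ge> 1 \<and> f m \<le> B}" if "frequencies f" for f B
  proof -
    have "eventually (\<lambda>m. f m > B) sequentially"
      using that by (simp add: frequencies_def filterlim_at_top_dense)
    then obtain N where "\<And>m. m \<ge> N \<Longrightarrow> f m > B" by (auto simp: eventually_sequentially)
    then have "{m. m \<ge> 1 \<and> f m \<le> B} \<subseteq> {..<N}" by (auto simp: not_less[symmetric])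
    then show ?thesis by (rule finite_subset) simp
  qed
  have lb: "f 1 > 0 \<and> f 1 \<le> f m" if "frequencies f" "m \<ge> 1" for f m
    using frequencies_pos[OF that(1), of 0] frequencies_mono[OF that(1), of 0 "m - 1"] that(2) by simp
  have "{(m, n). m \<ge> 1 \<and> n \<ge> 1 \<and> mu m * lam n = x} \<subseteq> {m. m \<ge> 1 \<and> mu m \<le> x / lam 1} \<times> {n. n \<ge> 1 \<and> lam n \<le> x / mu 1}"
  proof safe
    fix m n :: nat assume mn: "m \<ge> 1" "n \<ge> 1"
    have "mu m * lam 1 \<le> mu m * lam n" using lb[OF fr(1) mn(1)] lb[OF fr(2) mn(2)] by (intro mult_left_mono) auto
    then show "mu m \<le> mu m * lam n / lam 1" using lb[OF fr(2) mn(2)] by (simp add: pos_le_divide_eq)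
    have "mu 1 * lam n \<le> mu m * lam n" using lb[OF fr(1) mn(1)] lb[OF fr(2) mn(2)] by (intro mult_right_mono) auto
    then show "lam n \<le> mu m * lam n / mu 1" using lb[OF fr(1) mn(1)] by (simp add: pos_le_divide_eq mult.commute)
  qed
  then show ?thesis by (rule finite_subset) (intro finite_cartesian_product fin fr)
qed

text \<open>An absolutely convergent double sum may be regrouped along the level sets of the product
  mu lam. The factor \<open>\<Phi>\<close> is constant on each of them, and what is left inside is
  the generalized divisor function; injectivity of \<open>nu\<close> keeps the level sets
  disjoint.\<close>

lemma gen_divisor_sums:
  fixes \<Phi> :: "real \<Rightarrow> complex"
  assumes fr: "frequencies mu" "frequencies lam" and nu: "increasing_enumeration nu (product_values mu lam)"
    and S: "((\<lambda>(n, m). b (Suc m) * a (Suc n) * of_real (mu (Suc m)) powr z * \<Phi> (mu (Suc m) * lam (Suc n))) has_sum S) UNIV"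
  shows "(\<lambda>j. gen_divisor z (nu (Suc j)) b a mu lam * \<Phi> (nu (Suc j))) sums S"
proof -
  define G where "G = (\<lambda>(m, n). b m * a n * of_real (mu m) powr z * \<Phi> (mu m * lam n))"
  define fib where "fib = (\<lambda>j. {(m, n). m \<ge> 1 \<and> n \<ge> 1 \<and> mu m * lam n = nu (Suc j)})"
  have mono: "strict_mono_on {1..} nu" and img: "nu ` {1..} = product_values mu lam"
    using nu by (auto simp: increasing_enumeration_def)
  have inj: "i = j" if "nu (Suc i) = nu (Suc j)" for i j
    using inj_onD[OF strict_mono_on_imp_inj_on[OF mono] that] by simp
  have "(G has_sum S) ({1..} \<times> {1..})"
  proof (rule has_sum_reindexI[where h = "\<lambda>(n, m). (Suc m, Suc n)", OF _ S])
    have "range Suc = {1..}" by (auto simp: image_iff Suc_le_eq gr0_conv_Suc)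
    then show "range (\<lambda>(n, m). (Suc m, Suc n)) = {1..} \<times> {1..}"
      unfolding range_prod_swap by auto
  qed (auto simp: inj_def G_def)
  also have "{1..} \<times> {1..} = snd ` Sigma UNIV fib"
  proof (intro equalityI subsetI)
    fix p :: "nat \<times> nat" assume "p \<in> {1..} \<times> {1..}"
    then obtain m n where p: "p = (m, n)" "m \<ge> 1" "n \<ge> 1" by auto
    then have "mu m * lam n \<in> nu ` {1..}" unfolding img product_values_def by auto
    then obtain j where "j \<ge> 1" "mu m * lam n = nu j" by auto
    then have "(j - 1, (m, n)) \<in> Sigma UNIV fib" using p by (auto simp: fib_def)
    then show "p \<in> snd ` Sigma UNIV fib" unfolding p(1) by (rule image_eqI[rotated]) simp
  qed (auto simp: fib_def)
  finally have "(G has_sum S) (snd ` Sigma UNIV fib)" .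
  moreover have "inj_on snd (Sigma UNIV fib)"
    unfolding inj_on_def by (auto simp: fib_def intro: inj)
  ultimately have "((G \<circ> snd) has_sum S) (Sigma UNIV fib)" by (simp add: has_sum_reindex)
  then have "((\<lambda>j. gen_divisor z (nu (Suc j)) b a mu lam * \<Phi> (nu (Suc j))) has_sum S) UNIV"
  proof (rule has_sum_SigmaD)
    fix j
    have "finite (fib j)" unfolding fib_def by (rule finite_product_fiber[OF fr])
    then have "((\<lambda>y. (G \<circ> snd) (j, y)) has_sum (\<Sum>y\<in>fib j. (G \<circ> snd) (j, y))) (fib j)" by (rule has_sum_finite)
    also have "(\<Sum>y\<in>fib j. (G \<circ> snd) (j, y)) = gen_divisor z (nu (Suc j)) b a mu lam * \<Phi> (nu (Suc j))"
      unfolding gen_divisor_def sum_distrib_right fib_def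
      by (rule sum.cong) (auto simp: G_def)
    finally show "((\<lambda>y. (G \<circ> snd) (j, y)) has_sum gen_divisor z (nu (Suc j)) b a mu lam * \<Phi> (nu (Suc j))) (fib j)" .
  qed
  then show ?thesis by (rule has_sum_imp_sums)
qed

text \<open>
  If the residue term is present, this forces Re s > 1, hence Re (2s - 1) > Re s, so that \<open>\<phi>\<^sub>2(2s - 1)\<close> is the value
  of a convergent series.
\<close>

lemma residue_nonzero_abscissa:
  assumes B: "class_B \<delta> a lam b mu \<phi> \<psi>" and r: "residue \<phi> 1 \<noteq> 0"
  shows "1 \<le> abs_abscissa a lam"
proof (rule ccontr)
  assume "\<not> 1 \<le> abs_abscissa a lam"
  then have "abs_abscissa a lam < ereal 1" by (simp add: one_ereal_def not_le)
  then obtain \<sigma> where \<sigma>: "abs_abscissa a lam < ereal \<sigma>" "\<sigma> < 1"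
    using ereal_dense2[of "abs_abscissa a lam" "ereal 1"] by auto
  note fr = class_BD(2)[OF B]
  define S where "S = {s. Re s > \<sigma>}"
  have "dirichlet_series a lam holomorphic_on S"
    unfolding dirichlet_series_def
  proof (rule holomorphic_on_suminf)
    show "open S" unfolding S_def by (rule open_halfspace_Re_gt)
    show "(\<lambda>s. a (Suc n) * complex_of_real (lam (Suc n)) powr (- s)) holomorphic_on S" for n
      using frequencies_pos[OF fr, of n] by (intro holomorphic_intros) auto
    fix z assume "z \<in> S"
    define d where "d = (Re z - \<sigma>) / 2"
    have d: "d > 0" using \<open>z \<in> S\<close> by (simp add: S_def d_def)
    have re: "\<sigma> \<le> Re w \<and> \<sigma> < Re w \<and> Re w \<le> Re z + d" if "w \<in> cball z d" for w
    proof -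
      have "\<bar>Re z - Re w\<bar> \<le> d" using that abs_Re_le_cmod[of "z - w"] by (simp add: dist_norm)
      moreover have "Re z - d = \<sigma> + d" by (simp add: d_def field_simps)
      ultimately show ?thesis using d by linarith
    qed
    \<comment> \<open>Two majorants are needed on the disc: the terms are largest at the left end
      for frequencies above 1 and at the right end for frequencies below 1.\<close>
    have "abs_abscissa a lam < ereal (Re z + d)"
      using \<sigma> d \<open>z \<in> S\<close> by (auto simp: S_def intro: less_trans)
    note sums = summable_above_abscissa[OF fr \<sigma>(1)] summable_above_abscissa[OF fr this]
    show "\<exists>d M. 0 < d \<and> cball z d \<subseteq> S \<and> summable M \<and>
       (\<forall>n. \<forall>w\<in>cball z d. norm (a (Suc n) * complex_of_real (lam (Suc n)) powr (- w)) \<le> M n)"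
    proof (intro exI conjI allI ballI)
      show "summable (\<lambda>n. norm (a (Suc n)) * lam (Suc n) powr (- \<sigma>) + norm (a (Suc n)) * lam (Suc n) powr (- (Re z + d)))"
        by (intro summable_add sums)
      fix n w assume w: "w \<in> cball z d"
      define l where "l = lam (Suc n)"
      have l: "l > 0" using frequencies_pos[OF fr, of n] by (simp add: l_def)
      have "l powr (- Re w) \<le> l powr (- \<sigma>) + l powr (- (Re z + d))"
      proof (cases "l \<ge> 1")
        case True
        then have "l powr (- Re w) \<le> l powr (- \<sigma>)" using re[OF w] by (intro powr_mono) auto
        then show ?thesis by (simp add: add_increasing2)
      next
        case False
        then have "l powr (- Re w) \<le> l powr (- (Re z + d))" using re[OF w] l by (intro powr_mono') auto
        then show ?thesis by (simp add: add_increasing)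
      qed
      from mult_left_mono[OF this norm_ge_zero[of "a (Suc n)"]]
      show "norm (a (Suc n) * complex_of_real (lam (Suc n)) powr (- w))
          \<le> norm (a (Suc n)) * lam (Suc n) powr (- \<sigma>) + norm (a (Suc n)) * lam (Suc n) powr (- (Re z + d))"
        using l by (simp add: norm_mult norm_powr_real_powr l_def distrib_left)
    qed (use d re in \<open>auto simp: S_def\<close>)
  qed
  moreover have "\<phi> s = dirichlet_series a lam s" if "s \<in> S" for s
  proof -
    have "ereal \<sigma> < ereal (Re s)" using that by (simp add: S_def)
    with \<sigma>(1) have "abs_abscissa a lam < ereal (Re s)" by (rule less_trans)
    then show ?thesis using class_BD(8)[OF B] by (simp add: continues_series_def)
  qed
  ultimately have "\<phi> holomorphic_on S" by (simp cong: holomorphic_cong)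
  moreover have "open S" unfolding S_def by (rule open_halfspace_Re_gt)
  ultimately have "residue \<phi> 1 = 0" using \<sigma>(2) by (intro residue_holo[of S]) (auto simp: S_def)
  then show False using r by simp
qed

text \<open>Both parities are carried together, with the sign (-1)^\<delta> and a conditional for
  the residue terms. Only the dual series of \<phi>1 is transformed, row by row in the frequencies
  of \<phi>2, so the data are asymmetric and can be reused with the two series exchanged.\<close>

theorem epstein_zeta_expansion:
  fixes a b c :: real
  assumes form: "a > 0" "c > 0" "4 * a * c - b\<^sup>2 > 0" and k: "k = sqrt (4 * a * c - b\<^sup>2) / (2 * a)"
    and B1: "class_B \<delta> a1 lam b1 mu \<phi>1 \<psi>1" and B2: "class_B \<delta> a2 lam' b2 mu' \<phi>2 \<psi>2"
    and sa1: "ereal (Re s) > abs_abscissa a1 lam" and sa2: "ereal (Re s) > abs_abscissa a2 lam'"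
    and sb1: "ereal (Re s) > abs_abscissa b1 mu"
    and nu: "increasing_enumeration nu (product_values mu lam')"
  defines "F \<equiv> epstein_term s a b c (extend_coeff \<delta> a1 \<phi>1) (extend_coeff \<delta> a2 \<phi>2) (extend_freq lam) (extend_freq lam')"
    and "T \<equiv> \<lambda>j. gen_divisor (2 * s - 1) (nu j) b1 a2 mu lam' * of_real (trig \<delta> (b * nu j / a)) *
                of_real (nu j) powr (1/2 - s) * bessel_K (s - 1/2) (2 * k * nu j)"
  shows "F summable_on (UNIV - {(0, 0)})" and "summable (\<lambda>j. T (Suc j))"
    and "of_real a powr s * Gamma s * infsum F (UNIV - {(0, 0)}) =
       (if \<delta> = 0 then - 4 * \<phi>2 0 * Gamma s * \<phi>1 (2 * s) + 2 * of_real (sqrt pi) * residue \<phi>1 1 * Gamma (s - 1/2) * of_real k powr (1 - 2 * s) *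
               \<phi>2 (2 * s - 1) else 0) + 8 * (-1) ^ \<delta> * of_real k powr (1/2 - s) * (\<Sum>j. T (Suc j))"
proof -
  define \<sigma> where "\<sigma> = Re s"
  have \<sigma>: "\<sigma> > 0" unfolding \<sigma>_def by (rule abscissa_dual_positive[OF B1 sb1])
  note \<delta> = class_BD(1)[OF B1] and fr1 = class_BD(2)[OF B1] and fr2 = class_BD(2)[OF B2] and frm = class_BD(3)[OF B1]
  define l1 where "l1 = (\<lambda>m. lam (Suc m))"
  define l2 where "l2 = (\<lambda>n. lam' (Suc n))"
  define mm where "mm = (\<lambda>m. mu (Suc m))"
  have l1p: "l1 m > 0" for m using frequencies_pos[OF fr1] by (simp add: l1_def)
  have l2p: "l2 m > 0" for m using frequencies_pos[OF fr2] by (simp add: l2_def)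
  have mmp: "mm m > 0" for m using frequencies_pos[OF frm] by (simp add: mm_def)
  define Q where "Q = (\<lambda>u v. a * u\<^sup>2 + b * u * v + c * v\<^sup>2)"
  have kp: "k > 0" using form k by simp
  have k2: "k\<^sup>2 = (4 * a * c - b\<^sup>2) / (4 * a\<^sup>2)" using form k by (simp add: power_divide)
  have Qsq: "Q u v = a * ((u + b * v / (2 * a))\<^sup>2 + (k * v)\<^sup>2)" for u v
    unfolding Q_def power_mult_distrib k2 using form by (simp add: power2_eq_square field_simps)
  define D where "D = 4 * a * c - b\<^sup>2"
  have D: "D > 0" using form by (simp add: D_def)
  \<comment> \<open>Completing the square in either variable gives Q >= D v^2/(4a) and Q >= D
    u^2/(4c). The geometric mean of the two bounds is \<open>\<kappa>\<close> |u| |v|.\<close>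
  define \<kappa> where "\<kappa> = D / (4 * sqrt (a * c))"
  have \<kappa>: "\<kappa> > 0" using D form by (simp add: \<kappa>_def)
  have Qlow: "Q u v \<ge> \<kappa> * (\<bar>u\<bar> * \<bar>v\<bar>)" for u v
  proof -
    have "Q u v = a * (u + b * v / (2 * a))\<^sup>2 + D / (4 * a) * v\<^sup>2"
      unfolding Q_def D_def using form by (simp add: power2_eq_square field_simps)
    then have 1: "Q u v \<ge> D / (4 * a) * v\<^sup>2" using form by simp
    have "Q u v = c * (v + b * u / (2 * c))\<^sup>2 + D / (4 * c) * u\<^sup>2"
      unfolding Q_def D_def using form by (simp add: power2_eq_square field_simps)
    then have 2: "Q u v \<ge> D / (4 * c) * u\<^sup>2" using form by simp
    have "(\<kappa> * (\<bar>u\<bar> * \<bar>v\<bar>))\<^sup>2 = (D / (4 * a) * v\<^sup>2) * (D / (4 * c) * u\<^sup>2)"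
      using form by (simp add: \<kappa>_def power_mult_distrib power_divide power2_eq_square[of D])
    also have "\<dots> \<le> Q u v * Q u v"
    proof (rule mult_mono[OF 1 2])
      show "0 \<le> Q u v" by (rule order_trans[OF _ 1]) (use D form in auto)
    qed (use D form in auto)
    finally have "(\<kappa> * (\<bar>u\<bar> * \<bar>v\<bar>))\<^sup>2 \<le> (Q u v)\<^sup>2" by (simp add: power2_eq_square)
    moreover have "0 \<le> Q u v" by (rule order_trans[OF _ 1]) (use D form in auto)
    ultimately show ?thesis by (rule power2_le_imp_le)
  qed
  define A where "A = (\<lambda>m. norm (a1 (Suc m)) * l1 m powr (- \<sigma>))"
  define A' where "A' = (\<lambda>n. norm (a2 (Suc n)) * l2 n powr (- \<sigma>))"
  define B where "B = (\<lambda>m. norm (b1 (Suc m)) * mm m powr (- \<sigma>))"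
  have sA: "summable A" unfolding A_def l1_def \<sigma>_def by (rule summable_above_abscissa[OF fr1 sa1])
  have sA': "summable A'" unfolding A'_def l2_def \<sigma>_def by (rule summable_above_abscissa[OF fr2 sa2])
  have sB: "summable B" unfolding B_def mm_def \<sigma>_def by (rule summable_above_abscissa[OF frm sb1])
  have ABp: "A m \<ge> 0" "A' m \<ge> 0" "B m \<ge> 0" for m by (simp_all add: A_def A'_def B_def)
  have Qpos: "Q (l1 m) (l2 n) > 0" "Q (l1 m) (- l2 n) > 0" "Q (l1 m) 0 > 0" "Q 0 (l2 n) > 0" for m n
  proof -
    show "Q (l1 m) (l2 n) > 0" "Q (l1 m) (- l2 n) > 0"
      using Qlow[of "l1 m" "l2 n"] Qlow[of "l1 m" "- l2 n"] \<kappa> l1p[of m] l2p[of n]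
      by (auto intro: less_le_trans[rotated])
    show "Q (l1 m) 0 > 0" "Q 0 (l2 n) > 0" using form l1p[of m] l2p[of n] by (auto simp: Q_def)
  qed
  have Qpow: "Q (l1 m) v powr (- \<sigma>) \<le> \<kappa> powr (- \<sigma>) * (l1 m powr (- \<sigma>) * l2 n powr (- \<sigma>))"
    if "v = l2 n \<or> v = - l2 n" for m n v
  proof -
    have "\<kappa> * (l1 m * l2 n) \<le> Q (l1 m) v"
      using Qlow[of "l1 m" v] that l1p[of m] l2p[of n] by auto
    moreover have "\<kappa> * (l1 m * l2 n) > 0" using \<kappa> l1p[of m] l2p[of n] by simp
    ultimately have "Q (l1 m) v powr (- \<sigma>) \<le> (\<kappa> * (l1 m * l2 n)) powr (- \<sigma>)"
      using \<sigma> by (intro powr_mono2') auto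
    then show ?thesis using \<kappa> l1p[of m] l2p[of n] by (simp add: powr_mult)
  qed
  define q where "q = (\<lambda>v (n, m). a1 (Suc m) * a2 (Suc n) / of_real (Q (l1 m) (v n)) powr s)"
  have nq: "norm (q v (n, m)) \<le> (\<kappa> powr (- \<sigma>) * A' n) * A m" if v: "v n = l2 n \<or> v n = - l2 n" for v n m
  proof -
    have p: "Q (l1 m) (v n) > 0" using v Qpos(1,2)[of m n] by auto
    have "norm (q v (n, m)) = norm (a1 (Suc m)) * norm (a2 (Suc n)) * Q (l1 m) (v n) powr (- \<sigma>)"
      using p by (simp add: q_def norm_mult norm_divide norm_inverse norm_powr_real_powr \<sigma>_def powr_minus divide_inverse)
    also have "\<dots> \<le> norm (a1 (Suc m)) * norm (a2 (Suc n)) * (\<kappa> powr (- \<sigma>) * (l1 m powr (- \<sigma>) * l2 n powr (- \<sigma>)))"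
      by (intro mult_left_mono Qpow v) auto
    finally show ?thesis by (simp add: A_def A'_def mult_ac)
  qed
  have sA'': "summable (\<lambda>n. \<kappa> powr (- \<sigma>) * A' n)" by (intro summable_mult sA')
  have pA'': "\<kappa> powr (- \<sigma>) * A' n \<ge> 0" for n using ABp by simp
  note hq = has_sum_product_dominated[OF sA'' pA'' sA ABp(1), of "q l2", OF nq]
  note hq' = has_sum_product_dominated[OF sA'' pA'' sA ABp(1), of "q (\<lambda>n. - l2 n)", OF nq]
  define S1 where "S1 = (\<Sum>n. \<Sum>m. q l2 (n, m))"
  define S2 where "S2 = (\<Sum>n. \<Sum>m. q (\<lambda>n. - l2 n) (n, m))"
  have HS1: "(q l2 has_sum S1) UNIV" unfolding S1_def by (rule hq(3)) auto
  have HS2: "(q (\<lambda>n. - l2 n) has_sum S2) UNIV" unfolding S2_def by (rule hq'(3)) auto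
  have sq_powr: "of_real (e * x\<^sup>2) powr (- s) = of_real e powr (- s) * complex_of_real x powr (- (2 * s))" if "x > 0" "e > 0" for e x
  proof -
    have "complex_of_real (e * x\<^sup>2) powr (- s) = of_real e powr (- s) * of_real (x\<^sup>2) powr (- s)"
      using that by (simp only: of_real_mult, subst powr_times_real) auto
    also have "complex_of_real (x\<^sup>2) powr (- s) = of_real x powr (- (2 * s))"
      using powr_of_real_square[OF that(1), of "- s"] by simp
    finally show ?thesis .
  qed
  have axis: "((\<lambda>m. al (Suc m) / of_real (e * (lm (Suc m))\<^sup>2) powr s) has_sum (of_real e powr (- s) * dirichlet_series al lm (2 * s))) UNIV"
    and axis_s: "abs_abscissa al lm < ereal (Re (2 * s))"
    if fr: "frequencies lm" and ab: "ereal (Re s) > abs_abscissa al lm" and e: "e > 0" for al lm e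
  proof -
    show lt: "abs_abscissa al lm < ereal (Re (2 * s))"
      using \<sigma> by (intro less_trans[OF ab]) (simp add: \<sigma>_def)
    have "summable (\<lambda>m. norm (al (Suc m)) * lm (Suc m) powr (- (2 * \<sigma>)))"
      using summable_above_abscissa[OF fr lt] by (simp add: \<sigma>_def)
    then have sm: "summable (\<lambda>m. norm (al (Suc m) * of_real (lm (Suc m)) powr (- (2 * s))))"
      using frequencies_pos[OF fr] by (simp add: norm_mult norm_powr_real_powr less_imp_le \<sigma>_def)
    have "((\<lambda>m. al (Suc m) * complex_of_real (lm (Suc m)) powr (- (2 * s))) has_sum dirichlet_series al lm (2 * s)) UNIV"
      unfolding dirichlet_series_def
      by (rule norm_summable_imp_has_sum[OF sm summable_sums[OF summable_norm_cancel[OF sm]]])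
    from has_sum_cmult_right[OF this, of "of_real e powr (- s)"]
    show "((\<lambda>m. al (Suc m) / of_real (e * (lm (Suc m))\<^sup>2) powr s) has_sum (of_real e powr (- s) * dirichlet_series al lm (2 * s))) UNIV"
    proof (rule has_sum_cong[THEN iffD1, rotated])
      fix m
      have "al (Suc m) / of_real (e * (lm (Suc m))\<^sup>2) powr s = al (Suc m) * of_real (e * (lm (Suc m))\<^sup>2) powr (- s)"
        by (simp only: powr_minus divide_inverse)
      then show "of_real e powr (- s) * (al (Suc m) * of_real (lm (Suc m)) powr (- (2 * s))) = al (Suc m) / of_real (e * (lm (Suc m))\<^sup>2) powr s"
        unfolding sq_powr[OF frequencies_pos[OF fr, of m] e] by (simp only: mult_ac)
    qed
  qed
  define \<epsilon> where "\<epsilon> = (- 1 :: complex) ^ \<delta>"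
  define X1 where "X1 = of_real a powr (- s) * dirichlet_series a1 lam (2 * s)"
  define X2 where "X2 = of_real c powr (- s) * dirichlet_series a2 lam' (2 * s)"
  have HX1: "((\<lambda>m. a1 (Suc m) / of_real (Q (lam (Suc m)) 0) powr s) has_sum X1) UNIV"
    using axis(1)[OF fr1 sa1 form(1)] by (simp add: Q_def X1_def)
  have HX2: "((\<lambda>n. a2 (Suc n) / of_real (Q 0 (lam' (Suc n))) powr s) has_sum X2) UNIV"
    using axis(1)[OF fr2 sa2 form(2)] by (simp add: Q_def X2_def)
  have HF: "(F has_sum 2 * (S1 + \<epsilon> * S2) + (1 + \<epsilon>) * (- 2 * \<phi>2 (- of_nat \<delta>)) * X1 + (1 + \<epsilon>) * (- 2 * \<phi>1 (- of_nat \<delta>)) * X2) (UNIV - {(0, 0)})"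
    unfolding F_def \<epsilon>_def
    by (rule epstein_has_sum) (use HS1 HS2 HX1 HX2 in \<open>simp_all add: q_def Q_def l1_def l2_def case_prod_unfold\<close>)
  then show "F summable_on (UNIV - {(0, 0)})" by (auto simp: summable_on_def)
  have ZF: "infsum F (UNIV - {(0, 0)}) = 2 * (S1 + \<epsilon> * S2) + (1 + \<epsilon>) * (- 2 * \<phi>2 (- of_nat \<delta>)) * X1 + (1 + \<epsilon>) * (- 2 * \<phi>1 (- of_nat \<delta>)) * X2"
    by (rule infsumI[OF HF])
  have ee: "\<epsilon> * (\<epsilon> * y) = y" for y by (simp add: \<epsilon>_def mult.assoc[symmetric] power_mult_distrib[symmetric])
  define K where "K = (\<lambda>n. k * l2 n)"
  define x where "x = (\<lambda>n. b * l2 n / (2 * a))"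
  have Kp: "K n > 0" for n using kp l2p by (simp add: K_def)
  have as: "complex_of_real a powr s \<noteq> 0" using form by simp
  have Qx: "of_real a powr s * (y / of_real (Q (l1 m) (l2 n)) powr s) = y * of_real ((l1 m + x n)\<^sup>2 + (K n)\<^sup>2) powr (- s)"
    "of_real a powr s * (y / of_real (Q (l1 m) (- l2 n)) powr s) = y * of_real ((l1 m - x n)\<^sup>2 + (K n)\<^sup>2) powr (- s)"
    "of_real a powr s * (y / of_real (Q 0 (l2 n)) powr s) = y * of_real ((x n)\<^sup>2 + (K n)\<^sup>2) powr (- s)" for m n y
  proof -
    have g: "of_real a powr s * (y / of_real (a * R) powr s) = y * complex_of_real R powr (- s)" if "R > 0" for R
    proof -
      have "complex_of_real (a * R) powr s = of_real a powr s * of_real R powr s"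
        using that form by (simp only: of_real_mult, subst powr_times_real) auto
      then show ?thesis using as by (simp add: powr_minus field_simps)
    qed
    have p: "u\<^sup>2 + (K n)\<^sup>2 > 0" for u using Kp[of n] by (intro add_nonneg_pos) auto
    have e: "Q (l1 m) (l2 n) = a * ((l1 m + x n)\<^sup>2 + (K n)\<^sup>2)" "Q (l1 m) (- l2 n) = a * ((l1 m - x n)\<^sup>2 + (K n)\<^sup>2)"
      "Q 0 (l2 n) = a * ((x n)\<^sup>2 + (K n)\<^sup>2)"
      unfolding Qsq x_def K_def by simp_all
    show "of_real a powr s * (y / of_real (Q (l1 m) (l2 n)) powr s) = y * of_real ((l1 m + x n)\<^sup>2 + (K n)\<^sup>2) powr (- s)"
      "of_real a powr s * (y / of_real (Q (l1 m) (- l2 n)) powr s) = y * of_real ((l1 m - x n)\<^sup>2 + (K n)\<^sup>2) powr (- s)"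
      "of_real a powr s * (y / of_real (Q 0 (l2 n)) powr s) = y * of_real ((x n)\<^sup>2 + (K n)\<^sup>2) powr (- s)"
      unfolding e by (rule g[OF p])+
  qed
  have res: "Re s > 1" if "residue \<phi>1 1 \<noteq> 0"
    using less_le_trans[OF le_less_trans[OF residue_nonzero_abscissa[OF B1 that] sa1] order_refl]
    by (simp add: one_ereal_def)
  \<comment> \<open>The smallest K and the smallest dual frequency are the thresholds, so a single
    constant serves all pairs of frequencies.\<close>
  obtain C where C: "C \<ge> 0" "\<And>K m. K \<ge> k * l2 0 \<Longrightarrow> m \<ge> mm 0 \<Longrightarrow>
      (\<integral>t. t powr (\<sigma> - 3/2) * exp (- K\<^sup>2 * t - m\<^sup>2 / t) \<partial>pos_measure) \<le> C * (K * m) powr (- \<sigma>)"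
    using bessel_integral_bound[OF mult_pos_pos[OF kp l2p[of 0]] mmp[of 0] \<sigma>, where p = "\<sigma> - 3/2"] by blast
  have Kge: "K n \<ge> k * l2 0" for n using frequencies_mono[OF fr2, of 0 n] kp by (simp add: K_def l2_def)
  have mge: "mm m \<ge> mm 0" for m using frequencies_mono[OF frm, of 0 m] by (simp add: mm_def)
  define Jb where "Jb = (\<lambda>n m. \<integral>t. t powr (\<sigma> - 3/2) * exp (- (K n)\<^sup>2 * t - (mm m)\<^sup>2 / t) \<partial>pos_measure)"
  have Jb0: "Jb n m \<ge> 0" for n m unfolding Jb_def by (intro integral_nonneg_AE AE_I2) auto
  have Jb: "Jb n m \<le> (C * k powr (- \<sigma>) * l2 n powr (- \<sigma>)) * mm m powr (- \<sigma>)" for n m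
  proof -
    have "Jb n m \<le> C * (K n * mm m) powr (- \<sigma>)" unfolding Jb_def by (rule C(2)[OF Kge mge])
    also have "(K n * mm m) powr (- \<sigma>) = k powr (- \<sigma>) * l2 n powr (- \<sigma>) * mm m powr (- \<sigma>)"
      using kp l2p[of n] mmp[of m] by (simp add: K_def powr_mult)
    finally show ?thesis by (simp add: mult_ac)
  qed
  define E where "E = (\<lambda>(n, m). a2 (Suc n) * (b1 (Suc m) * of_real (trig \<delta> (2 * mm m * x n)) *
      (2 * of_real (mm m / K n) powr (s - 1/2) * bessel_K (s - 1/2) (2 * K n * mm m))))"
  have nE: "norm (E (n, m)) \<le> (C * k powr (- \<sigma>) * A' n) * B m" for n m
  proof -
    have bi: "2 * of_real (mm m / K n) powr (s - 1/2) * bessel_K (s - 1/2) (2 * K n * mm m)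
        = (\<integral>t. of_real t powr ((s - 1/2) - 1) * of_real (exp (- (K n)\<^sup>2 * t - (mm m)\<^sup>2 / t)) \<partial>pos_measure)"
      by (rule bessel_integral[OF Kp mmp, symmetric])
    have "norm (2 * of_real (mm m / K n) powr (s - 1/2) * bessel_K (s - 1/2) (2 * K n * mm m)) \<le> 
       (\<integral>t. norm (of_real t powr ((s - 1/2) - 1) * complex_of_real (exp (- (K n)\<^sup>2 * t - (mm m)\<^sup>2 / t))) \<partial>pos_measure)"
      unfolding bi by (rule integral_norm_bound)
    also have "\<dots> = Jb n m"
      unfolding Jb_def by (intro Bochner_Integration.integral_cong refl) (auto simp: norm_mult norm_powr_real_powr \<sigma>_def)
    finally have nb: "norm (2 * of_real (mm m / K n) powr (s - 1/2) * bessel_K (s - 1/2) (2 * K n * mm m)) \<le> Jb n m" .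
    have t1: "\<bar>trig \<delta> y\<bar> \<le> 1" for y by (simp add: trig_def)
    have "norm (E (n, m)) = norm (a2 (Suc n)) * (norm (b1 (Suc m)) * \<bar>trig \<delta> (2 * mm m * x n)\<bar> * 
        norm (2 * of_real (mm m / K n) powr (s - 1/2) * bessel_K (s - 1/2) (2 * K n * mm m)))"
      unfolding E_def prod.case norm_mult[of "a2 (Suc n)"] norm_mult[of "b1 (Suc m) * _"] norm_mult[of "b1 (Suc m)"] norm_of_real ..
    also have "\<dots> \<le> norm (a2 (Suc n)) * (norm (b1 (Suc m)) * 1 * ((C * k powr (- \<sigma>) * l2 n powr (- \<sigma>)) * mm m powr (- \<sigma>)))"
      by (intro mult_left_mono mult_mono t1 order_trans[OF nb Jb]) auto
    finally show ?thesis by (simp add: A'_def B_def mult_ac)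
  qed
  have sCA: "summable (\<lambda>n. C * k powr (- \<sigma>) * A' n)" by (intro summable_mult sA')
  have pCA: "C * k powr (- \<sigma>) * A' n \<ge> 0" for n using C ABp by simp
  note hE = has_sum_product_dominated[OF sCA pCA sB ABp(3), of E, OF nE]
  define c0 where "c0 = (if \<delta> = 0 then \<phi>1 0 * Gamma s else 0)"
  define c1 where "c1 = (if \<delta> = 0 then of_real (sqrt pi / 2) * residue \<phi>1 1 * Gamma (s - 1/2) else 0)"
  have row: "of_real a powr s * Gamma s * ((\<Sum>m. q l2 (n, m)) + \<epsilon> * (\<Sum>m. q (\<lambda>n. - l2 n) (n, m)))
     = 2 * \<epsilon> * (a2 (Suc n) * (c0 * of_real ((x n)\<^sup>2 + (K n)\<^sup>2) powr (- s)) + a2 (Suc n) * (c1 * of_real (K n) powr (1 - 2 * s)) + (\<Sum>m. E (n, m)))" for n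
  proof -
    define V where "V = (\<lambda>m. a1 (Suc m) * ((of_real ((lam (Suc m) - x n)\<^sup>2 + (K n)\<^sup>2) powr (- s) + (-1) ^ \<delta> * of_real ((lam (Suc m) + x n)\<^sup>2 + (K n)\<^sup>2) powr (- s)) / 2))"
    \<comment> \<open>Frequency -l2 n puts the centre at x n, and l2 n puts it at -x n. The row
      formula gives weight 1 to the centre x n, so \<open>\<epsilon>\<close> is pulled out using
      \<epsilon>^2 = 1; the 2 undoes the halving in \<open>V\<close>.\<close>
    have eV: "of_real a powr s * (q l2 (n, m) + \<epsilon> * q (\<lambda>n. - l2 n) (n, m)) = 2 * \<epsilon> * a2 (Suc n) * V m" for m
    proof -
      have "of_real a powr s * (q l2 (n, m) + \<epsilon> * q (\<lambda>n. - l2 n) (n, m)) = 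
         of_real a powr s * (a1 (Suc m) * a2 (Suc n) / of_real (Q (l1 m) (l2 n)) powr s) + 
         \<epsilon> * (of_real a powr s * (a1 (Suc m) * a2 (Suc n) / of_real (Q (l1 m) (- l2 n)) powr s))"
        unfolding q_def by (simp add: distrib_left mult.left_commute)
      also have "\<dots> = a1 (Suc m) * a2 (Suc n) * of_real ((l1 m + x n)\<^sup>2 + (K n)\<^sup>2) powr (- s) + \<epsilon> * (a1 (Suc m) * a2 (Suc n) * of_real ((l1 m - x n)\<^sup>2 + (K n)\<^sup>2) powr (- s))"
        unfolding Qx ..
      also have "\<dots> = \<epsilon> * (a1 (Suc m) * a2 (Suc n) * of_real ((l1 m - x n)\<^sup>2 + (K n)\<^sup>2) powr (- s)) + \<epsilon> * (\<epsilon> * (a1 (Suc m) * a2 (Suc n) * of_real ((l1 m + x n)\<^sup>2 + (K n)\<^sup>2) powr (- s)))"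
        unfolding ee by (rule add.commute)
      also have "\<dots> = 2 * \<epsilon> * a2 (Suc n) * V m"
        unfolding V_def l1_def \<epsilon>_def[symmetric] by (simp add: field_simps)
      finally show ?thesis .
    qed
    have sums_q: "(\<lambda>m. q l2 (n, m)) sums (\<Sum>m. q l2 (n, m))" "(\<lambda>m. q (\<lambda>n. - l2 n) (n, m)) sums (\<Sum>m. q (\<lambda>n. - l2 n) (n, m))"
      by (intro summable_sums summable_norm_cancel[OF hq(1)] summable_norm_cancel[OF hq'(1)]; simp)+
    have "(\<lambda>m. of_real a powr s * (q l2 (n, m) + \<epsilon> * q (\<lambda>n. - l2 n) (n, m))) sums (of_real a powr s * ((\<Sum>m. q l2 (n, m)) + \<epsilon> * (\<Sum>m. q (\<lambda>n. - l2 n) (n, m))))"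
      by (intro sums_mult sums_add sums_q)
    then have 1: "(\<lambda>m. 2 * \<epsilon> * a2 (Suc n) * V m) sums (of_real a powr s * ((\<Sum>m. q l2 (n, m)) + \<epsilon> * (\<Sum>m. q (\<lambda>n. - l2 n) (n, m))))"
      unfolding eV .
    have up: "(u + x n)\<^sup>2 + (K n)\<^sup>2 = Q u (l2 n) / a" "(u - x n)\<^sup>2 + (K n)\<^sup>2 = Q u (- l2 n) / a" for u
      unfolding Qsq x_def K_def using form by simp_all
    have sm: "summable (\<lambda>m. norm (a1 (Suc m)) * (Q (l1 m) v / a) powr (- Re s))" if v: "v = l2 n \<or> v = - l2 n" for v
    proof (rule summable_comparison_test'[OF summable_mult[OF sA, of "a powr \<sigma> * (\<kappa> powr (- \<sigma>) * l2 n powr (- \<sigma>))"], of 0])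
      fix m
      have p: "Q (l1 m) v > 0" using v Qpos(1,2)[of m n] by auto
      have "(Q (l1 m) v / a) powr (- Re s) = a powr \<sigma> * Q (l1 m) v powr (- \<sigma>)"
        using p form by (simp add: powr_divide \<sigma>_def powr_minus field_simps)
      also have "\<dots> \<le> a powr \<sigma> * (\<kappa> powr (- \<sigma>) * (l1 m powr (- \<sigma>) * l2 n powr (- \<sigma>)))"
        by (intro mult_left_mono Qpow v) auto
      finally have "norm (a1 (Suc m)) * (Q (l1 m) v / a) powr (- Re s) \<le> norm (a1 (Suc m)) * (a powr \<sigma> * (\<kappa> powr (- \<sigma>) * (l1 m powr (- \<sigma>) * l2 n powr (- \<sigma>))))"
        by (rule mult_left_mono) simp
      then show "norm (norm (a1 (Suc m)) * (Q (l1 m) v / a) powr (- Re s)) \<le> a powr \<sigma> * (\<kappa> powr (- \<sigma>) * l2 n powr (- \<sigma>)) * A m"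
        by (simp add: A_def mult_ac)
    qed
    have sJ: "summable (\<lambda>m. norm (b1 (Suc m)) * (\<integral>t. t powr (Re s - 3/2) * exp (- (K n)\<^sup>2 * t - (mu (Suc m))\<^sup>2 / t) \<partial>pos_measure))"
    proof (rule summable_comparison_test'[OF summable_mult[OF sB, of "C * k powr (- \<sigma>) * l2 n powr (- \<sigma>)"], of 0])
      fix m
      have "norm (b1 (Suc m)) * Jb n m \<le> norm (b1 (Suc m)) * ((C * k powr (- \<sigma>) * l2 n powr (- \<sigma>)) * mm m powr (- \<sigma>))"
        by (intro mult_left_mono Jb) auto
      moreover have "norm (b1 (Suc m)) * Jb n m \<ge> 0" using Jb0 by simp
      ultimately show "norm (norm (b1 (Suc m)) * (\<integral>t. t powr (Re s - 3/2) * exp (- (K n)\<^sup>2 * t - (mu (Suc m))\<^sup>2 / t) \<partial>pos_measure))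
          \<le> C * k powr (- \<sigma>) * l2 n powr (- \<sigma>) * B m"
        unfolding Jb_def mm_def \<sigma>_def by (simp add: B_def mm_def \<sigma>_def mult_ac)
    qed
    have "Gamma s * (\<Sum>m. V m) = (if \<delta> = 0 then \<phi>1 0 * (Gamma s * of_real ((x n)\<^sup>2 + (K n)\<^sup>2) powr (- s))
          + of_real (sqrt pi / 2) * residue \<phi>1 1 * (Gamma (s - 1/2) * of_real (K n) powr (1 - 2 * s)) else 0)
      + (\<Sum>m. b1 (Suc m) * of_real (trig \<delta> (2 * mu (Suc m) * x n)) * (2 * of_real (mu (Suc m) / K n) powr (s - 1/2) * bessel_K (s - 1/2) (2 * K n * mu (Suc m))))"
      unfolding V_def
    proof (rule shifted_epstein_row[OF B1 Kp])
      show "summable (\<lambda>m. norm (a1 (Suc m)) * ((lam (Suc m) - x n)\<^sup>2 + (K n)\<^sup>2) powr (- Re s))"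
        unfolding up(2) using sm[of "- l2 n"] by (simp add: l1_def)
      show "summable (\<lambda>m. norm (a1 (Suc m)) * ((lam (Suc m) + x n)\<^sup>2 + (K n)\<^sup>2) powr (- Re s))"
        unfolding up(1) using sm[of "l2 n"] by (simp add: l1_def)
    qed (use \<sigma> res sJ in \<open>auto simp: \<sigma>_def\<close>)
    then have 2: "a2 (Suc n) * (Gamma s * (\<Sum>m. V m)) = a2 (Suc n) * (c0 * of_real ((x n)\<^sup>2 + (K n)\<^sup>2) powr (- s)) + a2 (Suc n) * (c1 * of_real (K n) powr (1 - 2 * s)) 
       + a2 (Suc n) * (\<Sum>m. b1 (Suc m) * of_real (trig \<delta> (2 * mm m * x n)) * (2 * of_real (mm m / K n) powr (s - 1/2) * bessel_K (s - 1/2) (2 * K n * mm m)))"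
      unfolding c0_def c1_def mm_def by (simp add: distrib_left mult.assoc)
    \<comment> \<open>Summability of \<open>V\<close> and of the Bessel terms is recovered by
      dividing by a2 (Suc n), so a vanishing coefficient is split off; then both sides are
      0.\<close>
    show ?thesis
    proof (cases "a2 (Suc n) = 0")
      case True
      then show ?thesis by (simp add: q_def E_def)
    next
      case False
      have e0: "\<epsilon> \<noteq> 0" by (simp add: \<epsilon>_def)
      have nz: "2 * \<epsilon> * a2 (Suc n) \<noteq> 0" using e0 False by simp
      have sV: "summable V" by (rule summable_mult_D[OF sums_summable[OF 1] nz])
      have 3: "of_real a powr s * ((\<Sum>m. q l2 (n, m)) + \<epsilon> * (\<Sum>m. q (\<lambda>n. - l2 n) (n, m))) = 2 * \<epsilon> * a2 (Suc n) * (\<Sum>m. V m)"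
        using sums_unique2[OF 1 sums_mult[OF summable_sums[OF sV]]] .
      define g where "g = (\<lambda>m. b1 (Suc m) * of_real (trig \<delta> (2 * mm m * x n)) * (2 * of_real (mm m / K n) powr (s - 1/2) * bessel_K (s - 1/2) (2 * K n * mm m)))"
      have Eg: "E (n, m) = a2 (Suc n) * g m" for m by (simp add: E_def g_def)
      have "summable (\<lambda>m. a2 (Suc n) * g m)"
        using summable_norm_cancel[OF hE(1)[of n]] unfolding Eg .
      then have "summable g" using False by (rule summable_mult_D)
      then have 4: "a2 (Suc n) * (\<Sum>m. g m) = (\<Sum>m. E (n, m))" unfolding Eg by (rule suminf_mult[symmetric])
      have "of_real a powr s * Gamma s * ((\<Sum>m. q l2 (n, m)) + \<epsilon> * (\<Sum>m. q (\<lambda>n. - l2 n) (n, m)))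
          = Gamma s * (2 * \<epsilon> * a2 (Suc n) * (\<Sum>m. V m))" unfolding 3[symmetric] by (simp only: mult_ac)
      also have "\<dots> = 2 * \<epsilon> * (a2 (Suc n) * (Gamma s * (\<Sum>m. V m)))" by (simp only: mult_ac)
      finally show ?thesis unfolding 2 4[symmetric] g_def .
    qed
  qed
  have rsums: "(\<lambda>n. of_real a powr s * Gamma s * ((\<Sum>m. q l2 (n, m)) + \<epsilon> * (\<Sum>m. q (\<lambda>n. - l2 n) (n, m)))) sums (of_real a powr s * Gamma s * (S1 + \<epsilon> * S2))"
    unfolding S1_def S2_def by (intro sums_mult sums_add summable_sums hq(2) hq'(2)) auto
  \<comment> \<open>The constant terms of the rows add up to the axis sum \<open>X2\<close>. In the
    final formula they contribute 4 \<phi>1(0), which cancels the weight 2 (-2 \<phi>1(0)) of the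
    axis m = 0 when \<delta> = 0; only the other axis remains.\<close>
  have X2sums: "(\<lambda>n. a2 (Suc n) * (c0 * of_real ((x n)\<^sup>2 + (K n)\<^sup>2) powr (- s))) sums (c0 * (of_real a powr s * X2))"
  proof -
    have "(\<lambda>n. c0 * (of_real a powr s * (a2 (Suc n) / of_real (Q 0 (l2 n)) powr s))) sums (c0 * (of_real a powr s * X2))"
      unfolding l2_def by (intro sums_mult has_sum_imp_sums HX2)
    then show ?thesis unfolding Qx by (simp only: mult_ac)
  qed
  \<comment> \<open>Since K n = k l2 n, the pole terms add up to \<phi>2(2s - 1). A nonzero residue
    forces Re s > 1, so that the series converges at 2s - 1; otherwise \<open>c1\<close> is 0 and
    both sides vanish.\<close>
  have Rsums: "(\<lambda>n. a2 (Suc n) * (c1 * of_real (K n) powr (1 - 2 * s))) sums (c1 * (of_real k powr (1 - 2 * s) * \<phi>2 (2 * s - 1)))"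
  proof (cases "residue \<phi>1 1 = 0")
    case False
    have r1: "Re s > 1" using res False by blast
    have lt: "abs_abscissa a2 lam' < ereal (Re (2 * s - 1))" using r1 by (intro less_trans[OF sa2]) simp
    have eq: "\<phi>2 (2 * s - 1) = dirichlet_series a2 lam' (2 * s - 1)"
      using class_BD(8)[OF B2] lt by (simp only: continues_series_def)
    have "summable (\<lambda>n. norm (a2 (Suc n) * of_real (lam' (Suc n)) powr (- (2 * s - 1))))"
      using summable_above_abscissa[OF fr2 lt] by (simp add: norm_mult norm_powr_real_powr less_imp_le[OF frequencies_pos[OF fr2]])
    then have "(\<lambda>n. a2 (Suc n) * of_real (lam' (Suc n)) powr (- (2 * s - 1))) sums dirichlet_series a2 lam' (2 * s - 1)"
      unfolding dirichlet_series_def by (rule summable_sums[OF summable_norm_cancel])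
    then have "(\<lambda>n. c1 * (of_real k powr (1 - 2 * s) * (a2 (Suc n) * of_real (lam' (Suc n)) powr (- (2 * s - 1))))) sums (c1 * (of_real k powr (1 - 2 * s) * \<phi>2 (2 * s - 1)))"
      unfolding eq by (intro sums_mult)
    moreover have "c1 * (of_real k powr (1 - 2 * s) * (a2 (Suc n) * of_real (lam' (Suc n)) powr (- (2 * s - 1)))) = a2 (Suc n) * (c1 * of_real (K n) powr (1 - 2 * s))" for n
    proof -
      have "complex_of_real (K n) powr (1 - 2 * s) = of_real k powr (1 - 2 * s) * of_real (lam' (Suc n)) powr (1 - 2 * s)"
        unfolding K_def using kp l2p[of n] by (simp only: of_real_mult l2_def, subst powr_times_real) auto
      then show ?thesis by (simp add: mult_ac)
    qed
    ultimately show ?thesis by (simp only:)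
  qed (simp add: c1_def)
  have Esums: "(\<lambda>n. \<Sum>m. E (n, m)) sums (\<Sum>n. \<Sum>m. E (n, m))" by (rule summable_sums[OF hE(2)])
  \<comment> \<open>The coefficient 8 (-1)^\<delta> of the Bessel series is assembled from 2
    \<epsilon> here, the 2 in front of S1 + \<epsilon> S2 in the lattice sum, and the 2 of the
    Bessel integral.\<close>
  have main: "of_real a powr s * Gamma s * (S1 + \<epsilon> * S2) = 2 * \<epsilon> * (c0 * (of_real a powr s * X2) + c1 * (of_real k powr (1 - 2 * s) * \<phi>2 (2 * s - 1)) + (\<Sum>n. \<Sum>m. E (n, m)))"
    using rsums unfolding row by (rule sums_unique2) (intro sums_mult sums_add X2sums Rsums Esums)
  define \<Phi> where "\<Phi> = (\<lambda>v. of_real (trig \<delta> (b * v / a)) * of_real v powr (1/2 - s) * bessel_K (s - 1/2) (2 * k * v))"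
  define kk where "kk = 2 * complex_of_real k powr (1/2 - s)"
  have kk0: "kk \<noteq> 0" using kp by (simp add: kk_def)
  have EP: "E (n, m) = kk * (b1 (Suc m) * a2 (Suc n) * of_real (mu (Suc m)) powr (2 * s - 1) * \<Phi> (mu (Suc m) * lam' (Suc n)))" for n m
  proof -
    have "2 * mm m * x n = b * (mm m * l2 n) / a" using form by (simp add: x_def)
    moreover have "2 * K n * mm m = 2 * k * (mm m * l2 n)" by (simp add: K_def)
    \<comment> \<open>The exponents are redistributed so that everything depending on the product mu
      lam' alone is separated. The factor mu^(2s - 1) left over is the weight of the generalized
      divisor function.\<close>
    moreover have "complex_of_real (mm m / K n) powr (s - 1/2) = of_real k powr (1/2 - s) * (of_real (mm m) powr (2 * s - 1) * of_real (mm m * l2 n) powr (1/2 - s))"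
    proof -
      define u v w where "u = complex_of_real (ln (mm m))" and "v = complex_of_real (ln k)" and "w = complex_of_real (ln (l2 n))"
      have p: "mm m / K n > 0" "mm m * l2 n > 0" using mmp[of m] Kp[of n] l2p[of n] by auto
      have L: "Ln (complex_of_real (mm m / K n)) = u - v - w" "Ln (complex_of_real (mm m * l2 n)) = u + w"
          "Ln (complex_of_real (mm m)) = u" "Ln (complex_of_real k) = v"
        using p mmp[of m] kp l2p[of n]
        by (simp_all add: Ln_of_real K_def ln_div ln_mult u_def v_def w_def del: of_real_mult of_real_divide)
      have P: "complex_of_real y powr z = exp (z * Ln (complex_of_real y))" if "y > 0" for y z
        using that by (simp add: powr_def)
      have "(s - 1/2) * (u - v - w) = (1/2 - s) * v + ((2 * s - 1) * u + (1/2 - s) * (u + w))"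
        by (simp add: field_simps)
      then show ?thesis
        unfolding P[OF p(1)] P[OF p(2)] P[OF mmp] P[OF kp] L exp_add[symmetric] by (simp only:)
    qed
    ultimately show ?thesis unfolding E_def prod.case \<Phi>_def kk_def mm_def l2_def
      by (simp only: mult_ac)
  qed
  have E_fun: "(\<lambda>p. (1 / kk) * E p) = (\<lambda>(n, m). b1 (Suc m) * a2 (Suc n) * of_real (mu (Suc m)) powr (2 * s - 1) * \<Phi> (mu (Suc m) * lam' (Suc n)))"
    using kk0 by (intro ext) (auto simp: EP)
  have "((\<lambda>(n, m). b1 (Suc m) * a2 (Suc n) * of_real (mu (Suc m)) powr (2 * s - 1) * \<Phi> (mu (Suc m) * lam' (Suc n))) has_sum ((1 / kk) * (\<Sum>n. \<Sum>m. E (n, m)))) UNIV"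
    using has_sum_cmult_right[OF hE(3), of "1 / kk"] unfolding E_fun .
  from gen_divisor_sums[OF frm fr2 nu this]
  have Tsums: "(\<lambda>j. T (Suc j)) sums ((1 / kk) * (\<Sum>n. \<Sum>m. E (n, m)))"
    unfolding T_def \<Phi>_def by (simp only: mult.assoc)
  then show "summable (\<lambda>j. T (Suc j))" by (rule sums_summable)
  have ET: "(\<Sum>n. \<Sum>m. E (n, m)) = kk * (\<Sum>j. T (Suc j))"
    using Tsums kk0 by (simp add: sums_iff)
  have \<phi>12: "dirichlet_series a1 lam (2 * s) = \<phi>1 (2 * s)"
    using class_BD(8)[OF B1] axis_s[OF fr1 sa1 form(1)] by (simp only: continues_series_def)
  have aX1: "of_real a powr s * X1 = \<phi>1 (2 * s)"
    unfolding X1_def \<phi>12 using as by (simp add: powr_minus)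
  have "of_real a powr s * Gamma s * infsum F (UNIV - {(0, 0)}) = 2 * (of_real a powr s * Gamma s * (S1 + \<epsilon> * S2))
     + (1 + \<epsilon>) * (- 2 * \<phi>2 (- of_nat \<delta>)) * Gamma s * (of_real a powr s * X1) + (1 + \<epsilon>) * (- 2 * \<phi>1 (- of_nat \<delta>)) * Gamma s * (of_real a powr s * X2)"
    unfolding ZF by (simp add: algebra_simps)
  then show "of_real a powr s * Gamma s * infsum F (UNIV - {(0, 0)}) =
       (if \<delta> = 0 then - 4 * \<phi>2 0 * Gamma s * \<phi>1 (2 * s) + 2 * of_real (sqrt pi) * residue \<phi>1 1 * Gamma (s - 1/2) * of_real k powr (1 - 2 * s) *
               \<phi>2 (2 * s - 1) else 0) + 8 * (-1) ^ \<delta> * of_real k powr (1/2 - s) * (\<Sum>j. T (Suc j))"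
    unfolding main aX1 ET kk_def using \<delta>
    by (elim disjE) (simp_all add: \<epsilon>_def c0_def c1_def algebra_simps)
qed

section \<open>Specialization to positive definite forms and both orders of the variables\<close>

lemma pos_def_form_coefficients:
  assumes "pos_def_form a b c"
  shows "a > 0" "c > 0" "4 * a * c - b\<^sup>2 > 0"
proof -
  have Q: "a * x\<^sup>2 + b * x * y + c * y\<^sup>2 > 0" if "(x, y) \<noteq> (0, 0)" for x y
    using assms that unfolding pos_def_form_def by blast
  show a: "a > 0" and "c > 0" using Q[of 1 0] Q[of 0 1] by auto
  \<comment> \<open>At (-b, 2a), where the completed square vanishes, the form takes the value a
    (4ac - b^2).\<close>
  have "a * (- b)\<^sup>2 + b * (- b) * (2 * a) + c * (2 * a)\<^sup>2 > 0"
    using Q[of "- b" "2 * a"] a by simp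
  then have "a * (4 * a * c - b\<^sup>2) > 0" by (simp add: power2_eq_square algebra_simps)
  then show "4 * a * c - b\<^sup>2 > 0" using a by (simp add: zero_less_mult_iff)
qed

lemma infsum_epstein_term_swap:
  "infsum (epstein_term s c b a A2 A1 L' L) (UNIV - {(0, 0)}) = infsum (epstein_term s a b c A1 A2 L L') (UNIV - {(0, 0)})"
  by (rule infsum_reindex_bij_witness[where i = prod.swap and j = prod.swap])
    (auto simp: epstein_term_def algebra_simps)

theorem theorem3p1:
  fixes a b c d k k' :: real
    and \<delta> :: nat
    and a1 a2 b1 b2 :: "nat \<Rightarrow> complex"
    and lam lam' mu mu' nu nu' :: "nat \<Rightarrow> real"
    and \<phi>1 \<phi>2 \<psi>1 \<psi>2 :: "complex \<Rightarrow> complex"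
    and \<sigma>a \<sigma>b :: ereal
    and s :: complex
  assumes "pos_def_form a b c"
    and "d = b\<^sup>2 - 4 * a * c"
    and "k = sqrt \<bar>d\<bar> / (2 * a)"
    and "k' = sqrt \<bar>d\<bar> / (2 * c)"
    and "class_B \<delta> a1 lam b1 mu \<phi>1 \<psi>1"
    and "class_B \<delta> a2 lam' b2 mu' \<phi>2 \<psi>2"
    and "\<sigma>a = max (abs_abscissa a1 lam) (abs_abscissa a2 lam')"
    and "\<sigma>b = max (abs_abscissa b1 mu) (abs_abscissa b2 mu')"
    and "ereal (Re s) > max \<sigma>a \<sigma>b"
    and "increasing_enumeration nu (product_values mu lam')"
    and "increasing_enumeration nu' (product_values mu' lam)"
  shows
    "let A1 = extend_coeff \<delta> a1 \<phi>1; A2 = extend_coeff \<delta> a2 \<phi>2;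
         L = extend_freq lam; L' = extend_freq lam';
         Z = epstein_Z2 s a b c A1 A2 L L';
         T = (\<lambda>(trig :: real \<Rightarrow> real) j.
                gen_divisor (2 * s - 1) (nu j) b1 a2 mu lam' * of_real (trig (b * nu j / a)) *
                of_real (nu j) powr (1/2 - s) * bessel_K (s - 1/2) (2 * k * nu j));
         T' = (\<lambda>(trig :: real \<Rightarrow> real) j.
                gen_divisor (2 * s - 1) (nu' j) b2 a1 mu' lam * of_real (trig (b * nu' j / c)) *
                of_real (nu' j) powr (1/2 - s) * bessel_K (s - 1/2) (2 * k' * nu' j))
     in epstein_term s a b c A1 A2 L L' summable_on (UNIV - {(0, 0)}) \<and>
        (\<delta> = 0 \<longrightarrow>
           summable (\<lambda>j. T cos (Suc j)) \<and>
           of_real a powr s * Gamma s * Z =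
             - 4 * \<phi>2 0 * Gamma s * \<phi>1 (2 * s) +
             2 * of_real (sqrt pi) * residue \<phi>1 1 * Gamma (s - 1/2) * of_real k powr (1 - 2 * s) *
               \<phi>2 (2 * s - 1) +
             8 * of_real k powr (1/2 - s) * (\<Sum>j. T cos (Suc j)) \<and>
           summable (\<lambda>j. T' cos (Suc j)) \<and>
           of_real c powr s * Gamma s * Z =
             - 4 * \<phi>1 0 * Gamma s * \<phi>2 (2 * s) +
             2 * of_real (sqrt pi) * residue \<phi>2 1 * Gamma (s - 1/2) * of_real k' powr (1 - 2 * s) *
               \<phi>1 (2 * s - 1) +
             8 * of_real k' powr (1/2 - s) * (\<Sum>j. T' cos (Suc j))) \<and>
        (\<delta> = 1 \<longrightarrow>
           summable (\<lambda>j. T sin (Suc j)) \<and>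
           of_real a powr s * Gamma s * Z =
             - 8 * of_real k powr (1/2 - s) * (\<Sum>j. T sin (Suc j)) \<and>
           summable (\<lambda>j. T' sin (Suc j)) \<and>
           of_real c powr s * Gamma s * Z =
             - 8 * of_real k' powr (1/2 - s) * (\<Sum>j. T' sin (Suc j)))"
proof -
  note form = pos_def_form_coefficients[OF assms(1)]
  have d: "\<bar>d\<bar> = 4 * a * c - b\<^sup>2" using form(3) assms(2) by simp
  have k: "k = sqrt (4 * a * c - b\<^sup>2) / (2 * a)" "k' = sqrt (4 * c * a - b\<^sup>2) / (2 * c)"
    using assms(3,4) unfolding d by (simp_all add: mult_ac)
  have form': "4 * c * a - b\<^sup>2 > 0" using form(3) by (simp add: mult_ac)
  have ab: "ereal (Re s) > abs_abscissa a1 lam" "ereal (Re s) > abs_abscissa a2 lam'"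
    "ereal (Re s) > abs_abscissa b1 mu" "ereal (Re s) > abs_abscissa b2 mu'"
    using assms(7-9) by auto
  note E = epstein_zeta_expansion[OF form k(1) assms(5,6) ab(1,2,3) assms(10)]
  \<comment> \<open>Exchanging the variables keeps the discriminant and turns k into k'. This
    instance needs the abscissa of b2 in place of that of b1, which is why the maximum over both
    dual series is assumed.\<close>
  note E' = epstein_zeta_expansion[OF form(2,1) form' k(2) assms(6,5) ab(2,1,4) assms(11)]
  note E'' = E'(3)[unfolded infsum_epstein_term_swap]
  show ?thesis
    unfolding Let_def epstein_Z2_def
  proof (intro conjI impI)
    show "epstein_term s a b c (extend_coeff \<delta> a1 \<phi>1) (extend_coeff \<delta> a2 \<phi>2) (extend_freq lam) (extend_freq lam')
        summable_on UNIV - {(0, 0)}" by (rule E(1))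
  qed (use E(2,3) E'(2) E'' in \<open>simp_all add: trig_def[abs_def]\<close>)
qed

end
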